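(* The Markov--Ivanovsky normal form $\mathfrak I_B$ in the Artin braid group $B_n$ is stable (with respect to the random walk with any nondegenerate distribution); that is, for every nondegenerate probability measure $\mu$ on $B_n$ and for almost every path $\{\tau_i\}_{i\in\mathbb Z_+}$ of the random $\mu$-walk on $B_n$, the sequence of words $\{\mathfrak I_B(\tau_i)\}_{i\in\mathbb Z_+}$ converges at infinity.
   Context: Random walk: a probability measure $\mu$ on a countable group $G$ is nondegenerate if its support generates $G$ as a semigroup. The (right-hand) random $\mu$-walk on $G$ is the Markov chain $\tau=\{\tau_i\}_{i\ge 0}$ with $\tau_0=e$ and transition probabilities $P(g,h)=\mu(g^{-1}h)$; "almost every path" refers to the associated Markov measure on $G^{\mathbb Z_+}$. Convergence of words: a sequence $\{V_i\}$ of finite words over an alphabet converges at infinity if for every $k\in\mathbb N$ there is $N\in\mathbb N$ such that for each $j>N$ the word $V_j$ has length greater than $k$ and the prefixes of length $k$ of $V_j$ and $V_N$ coincide. Braid group: $B_n=\langle\sigma_1,\dots,\sigma_{n-1}\mid \sigma_i\sigma_j=\sigma_j\sigma_i\ (|i-j|\ge 2),\ \sigma_i\sigma_{i+1}\sigma_i=\sigma_{i+1}\sigma_i\sigma_{i+1}\rangle$. For $1\le i<j\le n$ put $s_{ji}=\sigma_{j-1}\sigma_{j-2}\cdots\sigma_{i+1}\sigma_i^2\sigma_{i+1}^{-1}\cdots\sigma_{j-2}^{-1}\sigma_{j-1}^{-1}$. For $m\in\{2,\dots,n\}$, $P_m$ is the subgroup generated by $\{s_{ji}: 1\le i<j\le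 m\}$ (the pure braid group; $P_n$ is normal of index $n!$ in $B_n$), and $F_{m-1}$ is the subgroup generated by $\{s_{mi}:1\le i<m\}$. It is known that $F_{m-1}$ is free of rank $m-1$ on these generators and normal in $P_m$, that $P_2=F_1$, and that $P_k=F_{k-1}\rtimes P_{k-1}$ for $k\in\{3,\dots,n\}$. Hence each $\gamma\in P_n$ is uniquely a product $\gamma=\gamma_{n-1}\gamma_{n-2}\cdots\gamma_1$ with $\gamma_i\in F_i$. Markov--Ivanovsky normal form: for $\gamma\in P_n$, written uniquely as $\gamma=\gamma_{n-1}\gamma_{n-2}\cdots\gamma_1$ with $\gamma_i\in F_i$, $\mathfrak I_P(\gamma)$ is the concatenated word $V_{n-1}V_{n-2}\cdots V_1$, where $V_i$ is the reduced word representing $\gamma_i$ in the generators $s_{(i+1)j}$, $1\le j\le i$, and their inverses. Fix an arbitrary set $\Pi_n\subset B_n$ of coset representatives for $P_n$ in $B_n$; each $\beta\in B_n$ is uniquely $\beta=\gamma_\beta\pi_\beta$ with $\gamma_\beta\in P_n$, $\pi_\beta\in\Pi_n$. Then $\mathfrak I_B(\beta)$ is the word $\mathfrak I_P(\gamma_\beta)\pi_\beta$, i.e. $\mathfrak I_P(\gamma_\beta)$ followed by the letter $\pi_\beta$; the alphabet is $\{s_{ji}^{\pm1}\}$ together with $\Pi_n$.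
   Formalization: The theorem is stated for n ≥ 3; the claim fails for n = 1 (all normal forms have length 1) and for n = 2 (B_2 is infinite cyclic, and the simple random walk is recurrent, so word lengths do not tend to infinity). *)

theory Defs
  imports "HOL-Probability.Probability" "HOL-Algebra.Generated_Groups" "HOL-Algebra.Coset"
begin

section \<open>Words and group presentations\<close>

text \<open>The letter \<open>(a, True)\<close> stands for the generator \<open>a\<close>, and \<open>(a, False)\<close> for its
  formal inverse.\<close>

type_synonym 'a gword = "('a \<times> bool) list"

definition gwords :: "'a set \<Rightarrow> 'a gword set" where
  "gwords S = lists (S \<times> UNIV)"

definition reduced :: "'a gword \<Rightarrow> bool" where
  "reduced w \<longleftrightarrow> successively (\<lambda>x y. \<not> (fst x = fst y \<and> snd x \<noteq> snd y)) w"

definition word_value :: "('g, 'm) monoid_scheme \<Rightarrow> ('a \<Rightarrow> 'g) \<Rightarrow> 'a gword \<Rightarrow> 'g" where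
  "word_value G f w =
     foldr (\<lambda>(a, b) g. (if b then f a else inv\<^bsub>G\<^esub> (f a)) \<otimes>\<^bsub>G\<^esub> g) w \<one>\<^bsub>G\<^esub>"

text \<open>The congruence on words over \<open>S\<close> generated by the relations \<open>u = v\<close> for \<open>(u, v) \<in> R\<close>.\<close>

inductive_set pres_rel :: "'a set \<Rightarrow> ('a gword \<times> 'a gword) set \<Rightarrow> ('a gword \<times> 'a gword) set"
  for S R where
  rel: "(u, v) \<in> R \<Longrightarrow> u \<in> gwords S \<Longrightarrow> v \<in> gwords S \<Longrightarrow> (u, v) \<in> pres_rel S R"
| cancel: "a \<in> S \<Longrightarrow> ([(a, b), (a, \<not> b)], []) \<in> pres_rel S R"
| refl: "w \<in> gwords S \<Longrightarrow> (w, w) \<in> pres_rel S R"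
| sym: "(u, v) \<in> pres_rel S R \<Longrightarrow> (v, u) \<in> pres_rel S R"
| trans: "(u, v) \<in> pres_rel S R \<Longrightarrow> (v, w) \<in> pres_rel S R \<Longrightarrow> (u, w) \<in> pres_rel S R"
| append: "(u, u') \<in> pres_rel S R \<Longrightarrow> (v, v') \<in> pres_rel S R \<Longrightarrow> (u @ v, u' @ v') \<in> pres_rel S R"

definition presented_group :: "'a set \<Rightarrow> ('a gword \<times> 'a gword) set \<Rightarrow> 'a gword set monoid" where
  "presented_group S R =
     \<lparr> carrier = gwords S // pres_rel S R,
       mult = (\<lambda>A B. \<Union>u\<in>A. \<Union>v\<in>B. pres_rel S R `` {u @ v}),
       one = pres_rel S R `` {[]} \<rparr>"

lemma pres_rel_gwords: "(u, v) \<in> pres_rel S R \<Longrightarrow> u \<in> gwords S \<and> v \<in> gwords S"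
  by (induction rule: pres_rel.induct) (auto simp: gwords_def)

lemma equiv_pres_rel: "equiv (gwords S) (pres_rel S R)"
  using pres_rel_gwords[of _ _ S R]
  by (intro equivI refl_onI symI transI)
     (auto intro: pres_rel.refl pres_rel.sym pres_rel.trans)

lemma presented_group_mult_class:
  assumes "u \<in> gwords S" "v \<in> gwords S"
  shows "pres_rel S R `` {u} \<otimes>\<^bsub>presented_group S R\<^esub> pres_rel S R `` {v} = pres_rel S R `` {u @ v}"
proof -
  have "congruent2 (pres_rel S R) (pres_rel S R) (\<lambda>u v. pres_rel S R `` {u @ v})"
    by (auto simp: congruent2_def intro!: equiv_class_eq[OF equiv_pres_rel] pres_rel.append)
  from UN_equiv_class2[OF equiv_pres_rel equiv_pres_rel this assms]
  show ?thesis by (simp add: presented_group_def)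
qed

lemma gwords_inverse:
  assumes "w \<in> gwords S"
  shows "\<exists>v\<in>gwords S. (v @ w, []) \<in> pres_rel S R"
  using assms
proof (induction w)
  case Nil
  then show ?case by (auto simp: gwords_def intro!: bexI[of _ "[]"] pres_rel.refl)
next
  case (Cons x w)
  obtain a b where x: "x = (a, b)" "a \<in> S" and w: "w \<in> gwords S"
    using Cons.prems by (cases x) (auto simp: gwords_def)
  obtain v where v: "v \<in> gwords S" "(v @ w, []) \<in> pres_rel S R" using Cons.IH w by blast
  have "([(a, \<not> b), (a, \<not> \<not> b)], []) \<in> pres_rel S R" by (rule pres_rel.cancel[OF x(2)])
  from pres_rel.append[OF pres_rel.refl[OF v(1)] pres_rel.append[OF this pres_rel.refl[OF w]]]
  have "(v @ [(a, \<not> b)] @ x # w, v @ w) \<in> pres_rel S R" using x by simp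
  then have "((v @ [(a, \<not> b)]) @ x # w, []) \<in> pres_rel S R"
    using v(2) by (auto intro: pres_rel.trans)
  moreover have "v @ [(a, \<not> b)] \<in> gwords S" using v x by (auto simp: gwords_def)
  ultimately show ?case by blast
qed

lemma group_presented_group: "group (presented_group S R)"
proof (rule groupI)
  let ?G = "presented_group S R" and ?c = "\<lambda>w. pres_rel S R `` {w}"
  have carr: "x \<in> carrier ?G \<longleftrightarrow> (\<exists>w\<in>gwords S. x = ?c w)" for x
    by (auto simp: presented_group_def quotient_def)
  have one: "\<one>\<^bsub>?G\<^esub> = ?c []" by (simp add: presented_group_def)
  have app: "u @ v \<in> gwords S" if "u \<in> gwords S" "v \<in> gwords S" for u v :: "'a gword"
    using that by (auto simp: gwords_def)
  have nil: "[] \<in> gwords S" by (simp add: gwords_def)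
  note mc = presented_group_mult_class
  show "x \<otimes>\<^bsub>?G\<^esub> y \<in> carrier ?G" if "x \<in> carrier ?G" "y \<in> carrier ?G" for x y
    using that app by (auto simp: carr mc)
  show "\<one>\<^bsub>?G\<^esub> \<in> carrier ?G" using nil by (auto simp: carr one)
  show "x \<otimes>\<^bsub>?G\<^esub> y \<otimes>\<^bsub>?G\<^esub> z = x \<otimes>\<^bsub>?G\<^esub> (y \<otimes>\<^bsub>?G\<^esub> z)"
    if "x \<in> carrier ?G" "y \<in> carrier ?G" "z \<in> carrier ?G" for x y z
    using that app by (auto simp: carr mc)
  show "\<one>\<^bsub>?G\<^esub> \<otimes>\<^bsub>?G\<^esub> x = x" if "x \<in> carrier ?G" for x
    using that nil by (auto simp: carr one mc)
  show "\<exists>y\<in>carrier ?G. y \<otimes>\<^bsub>?G\<^esub> x = \<one>\<^bsub>?G\<^esub>" if x: "x \<in> carrier ?G" for x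
  proof -
    obtain w where w: "w \<in> gwords S" "x = ?c w" using x by (auto simp: carr)
    obtain v where v: "v \<in> gwords S" "(v @ w, []) \<in> pres_rel S R"
      using gwords_inverse[OF w(1)] by blast
    have "?c v \<otimes>\<^bsub>?G\<^esub> x = \<one>\<^bsub>?G\<^esub>"
      using v w equiv_class_eq[OF equiv_pres_rel v(2)] by (simp add: mc one)
    then show ?thesis using v(1) carr by blast
  qed
qed


section \<open>The braid group and its pure subgroups\<close>

definition braid_relations :: "nat \<Rightarrow> (nat gword \<times> nat gword) set" where
  "braid_relations n =
     {([(i, True), (j, True)], [(j, True), (i, True)]) | i j.
        i \<in> {1..<n} \<and> j \<in> {1..<n} \<and> (i + 2 \<le> j \<or> j + 2 \<le> i)} \<union>
     {([(i, True), (i + 1, True), (i, True)], [(i + 1, True), (i, True), (i + 1, True)]) | i.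
        i \<in> {1..<n} \<and> i + 1 \<in> {1..<n}}"

type_synonym braid = "nat gword set"

definition braid_group :: "nat \<Rightarrow> braid monoid" where
  "braid_group n = presented_group {1..<n} (braid_relations n)"

definition braid_of :: "nat \<Rightarrow> nat gword \<Rightarrow> braid" where
  "braid_of n w = pres_rel {1..<n} (braid_relations n) `` {w}"

definition pure_gen :: "nat \<Rightarrow> nat \<Rightarrow> nat \<Rightarrow> braid" where
  "pure_gen n j i = braid_of n
     (map (\<lambda>k. (k, True)) (rev [i+1..<j]) @ [(i, True), (i, True)] @
      map (\<lambda>k. (k, False)) [i+1..<j])"

definition pure_braids :: "nat \<Rightarrow> nat \<Rightarrow> braid set" where
  "pure_braids n m = generate (braid_group n) {pure_gen n j i | i j. 1 \<le> i \<and> i < j \<and> j \<le> m}"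

text \<open>\<open>free_part n k\<close> is the subgroup \<open>F\<^sub>k\<close> of the braid group on \<open>n\<close> strands, generated
  by \<open>s\<^bsub>(k+1)i\<^esub>\<close> for \<open>1 \<le> i \<le> k\<close>.\<close>

definition free_part :: "nat \<Rightarrow> nat \<Rightarrow> braid set" where
  "free_part n k = generate (braid_group n) (pure_gen n (k + 1) ` {1..k})"

lemma group_braid_group: "group (braid_group n)"
  by (simp add: braid_group_def group_presented_group)


section \<open>The Markov--Ivanovsky normal form\<close>

text \<open>The alphabet: \<open>Pure j i True\<close> and \<open>Pure j i False\<close> are the letters for \<open>s\<^bsub>ji\<^esub>\<close> and its
  inverse, \<open>Rep \<pi>\<close> is the letter for a coset representative.\<close>

datatype mi_letter = Pure nat nat bool | Rep braid

definition free_word :: "nat \<Rightarrow> nat \<Rightarrow> braid \<Rightarrow> nat gword" where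
  "free_word n k g = (THE w. w \<in> gwords {1..k} \<and> reduced w \<and>
     word_value (braid_group n) (pure_gen n (k + 1)) w = g)"

text \<open>The family \<open>(\<gamma>\<^sub>1, \<dots>, \<gamma>\<^bsub>n-1\<^esub>)\<close> with \<open>\<gamma> = \<gamma>\<^bsub>n-1\<^esub> \<cdots> \<gamma>\<^sub>1\<close> and \<open>\<gamma>\<^sub>i \<in> F\<^sub>i\<close>.\<close>

definition pure_components :: "nat \<Rightarrow> braid \<Rightarrow> nat \<Rightarrow> braid" where
  "pure_components n \<gamma> = (THE c. c \<in> (\<Pi>\<^sub>E i\<in>{1..<n}. free_part n i) \<and>
     \<gamma> = foldr (\<lambda>i g. c i \<otimes>\<^bsub>braid_group n\<^esub> g) (rev [1..<n]) \<one>\<^bsub>braid_group n\<^esub>)"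

definition MI_pure :: "nat \<Rightarrow> braid \<Rightarrow> mi_letter list" where
  "MI_pure n \<gamma> =
     concat (map (\<lambda>i. map (\<lambda>(j, b). Pure (i + 1) j b) (free_word n i (pure_components n \<gamma> i)))
       (rev [1..<n]))"

text \<open>The cosets are the right cosets \<open>H #> \<pi>\<close>.\<close>

definition coset_representatives :: "('g, 'm) monoid_scheme \<Rightarrow> 'g set \<Rightarrow> 'g set \<Rightarrow> bool" where
  "coset_representatives G H T \<longleftrightarrow>
     T \<subseteq> carrier G \<and> (\<forall>C\<in>rcosets\<^bsub>G\<^esub> H. \<exists>!t. t \<in> T \<and> t \<in> C)"

definition pure_factorization :: "nat \<Rightarrow> braid set \<Rightarrow> braid \<Rightarrow> braid \<times> braid" where
  "pure_factorization n T \<beta> = (THE (\<gamma>, \<pi>). \<gamma> \<in> pure_braids n n \<and> \<pi> \<in> T \<and>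
     \<beta> = \<gamma> \<otimes>\<^bsub>braid_group n\<^esub> \<pi>)"

definition MI_braid :: "nat \<Rightarrow> braid set \<Rightarrow> braid \<Rightarrow> mi_letter list" where
  "MI_braid n T \<beta> = (case pure_factorization n T \<beta> of (\<gamma>, \<pi>) \<Rightarrow> MI_pure n \<gamma> @ [Rep \<pi>])"


section \<open>Convergence of words\<close>

definition converges_at_infinity :: "(nat \<Rightarrow> 'a list) \<Rightarrow> bool" where
  "converges_at_infinity V \<longleftrightarrow>
     (\<forall>k. \<exists>N. \<forall>j>N. length (V j) > k \<and> take k (V j) = take k (V N))"


section \<open>Random walks on groups\<close>

inductive_set semigroup_span :: "('g, 'm) monoid_scheme \<Rightarrow> 'g set \<Rightarrow> 'g set" for G S where
  incl: "x \<in> S \<Longrightarrow> x \<in> semigroup_span G S"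
| mult: "x \<in> semigroup_span G S \<Longrightarrow> y \<in> semigroup_span G S \<Longrightarrow> x \<otimes>\<^bsub>G\<^esub> y \<in> semigroup_span G S"

definition nondegenerate :: "('g, 'm) monoid_scheme \<Rightarrow> 'g pmf \<Rightarrow> bool" where
  "nondegenerate G \<mu> \<longleftrightarrow> semigroup_span G (set_pmf \<mu>) = carrier G"

text \<open>\<open>M\<close> is the law, on the space of sequences in \<open>S\<close>, of the Markov chain started at
  \<open>x\<^sub>0\<close> with transition probabilities \<open>P\<close>; for countable \<open>S\<close> it is determined by its values
  on cylinders.\<close>

definition markov_measure :: "'s set \<Rightarrow> 's \<Rightarrow> ('s \<Rightarrow> 's \<Rightarrow> real) \<Rightarrow> (nat \<Rightarrow> 's) measure \<Rightarrow> bool" where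
  "markov_measure S x\<^sub>0 P M \<longleftrightarrow>
     prob_space M \<and> sets M = sets (\<Pi>\<^sub>M i\<in>UNIV. count_space S) \<and>
     (\<forall>k. \<forall>g\<in>{..k} \<rightarrow> S. measure M {\<tau>\<in>space M. \<forall>i\<le>k. \<tau> i = g i} =
        (if g 0 = x\<^sub>0 then \<Prod>i<k. P (g i) (g (Suc i)) else 0))"

definition random_walk_measure ::
    "('g, 'm) monoid_scheme \<Rightarrow> 'g pmf \<Rightarrow> (nat \<Rightarrow> 'g) measure \<Rightarrow> bool" where
  "random_walk_measure G \<mu> M \<longleftrightarrow>
     markov_measure (carrier G) \<one>\<^bsub>G\<^esub> (\<lambda>g h. pmf \<mu> (inv\<^bsub>G\<^esub> g \<otimes>\<^bsub>G\<^esub> h)) M"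

lemma random_walk_measure_exists:
  fixes G :: "('g, 'm) monoid_scheme"
  assumes "group G" and cnt: "countable (carrier G)" and supp: "set_pmf \<mu> \<subseteq> carrier G"
  shows "\<exists>M. random_walk_measure G \<mu> M"
proof -
  interpret group G by fact
  let ?X = "\<Pi>\<^sub>M i\<in>(UNIV :: nat set). measure_pmf \<mu>"
  let ?Y = "\<Pi>\<^sub>M i\<in>(UNIV :: nat set). count_space (carrier G)"
  interpret X: product_prob_space "\<lambda>_::nat. measure_pmf \<mu>" UNIV ..
  define p where "p x = (if x \<in> carrier G then x else \<one>\<^bsub>G\<^esub>)" for x
  define W where "W x = rec_nat \<one>\<^bsub>G\<^esub> (\<lambda>i g. g \<otimes>\<^bsub>G\<^esub> p (x i))" for x :: "nat \<Rightarrow> 'g"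
  have W0: "W x 0 = \<one>\<^bsub>G\<^esub>" and WS: "W x (Suc i) = W x i \<otimes>\<^bsub>G\<^esub> p (x i)" for x i
    by (simp_all add: W_def)
  have p: "p x \<in> carrier G" for x by (simp add: p_def)
  have Wc: "W x i \<in> carrier G" for x i by (induction i) (simp_all add: W0 WS p)
  have mW: "(\<lambda>x. W x i) \<in> measurable ?X (count_space (carrier G))" for i
  proof (induction i)
    case 0
    then show ?case by (simp add: W0)
  next
    case (Suc i)
    have "(\<lambda>x. g \<otimes>\<^bsub>G\<^esub> p (x i)) \<in> measurable ?X (count_space (carrier G))"
      if "g \<in> carrier G" for g
    proof (rule measurable_compose[of "\<lambda>x. x i" _ "measure_pmf \<mu>"])
      show "(\<lambda>x. x i) \<in> measurable ?X (measure_pmf \<mu>)" by (rule measurable_component_singleton) simp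
      show "(\<lambda>y. g \<otimes>\<^bsub>G\<^esub> p y) \<in> measurable (measure_pmf \<mu>) (count_space (carrier G))"
        using that p by (auto simp: measurable_def)
    qed
    from measurable_compose_countable'[OF this Suc cnt] show ?case by (simp add: WS)
  qed
  have mW': "W \<in> measurable ?X ?Y"
    by (rule measurable_PiM_single') (use mW Wc in \<open>auto simp: space_PiM PiE_def\<close>)
  define M where "M = distr ?X ?Y W"
  have pm: "measure (measure_pmf \<mu>) (p -` {h}) = pmf \<mu> h" for h
  proof -
    have "measure (measure_pmf \<mu>) (p -` {h}) = measure (measure_pmf \<mu>) {h}"
      using supp by (intro measure_pmf.finite_measure_eq_AE)
        (auto simp: AE_measure_pmf_iff p_def split: if_splits)
    then show ?thesis by (simp add: measure_pmf_single)
  qed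
  have cyl: "measure M {\<tau>\<in>space M. \<forall>i\<le>k. \<tau> i = g i} =
      (if g 0 = \<one>\<^bsub>G\<^esub> then \<Prod>i<k. pmf \<mu> (inv\<^bsub>G\<^esub> (g i) \<otimes>\<^bsub>G\<^esub> g (Suc i)) else 0)"
    if g: "g \<in> {..k} \<rightarrow> carrier G" for k g
  proof -
    have sp: "space ?Y = (UNIV \<rightarrow> carrier G)" by (simp add: space_PiM PiE_UNIV_domain)
    have "{\<tau>\<in>space ?Y. \<forall>i\<le>k. \<tau> i = g i} = (\<Inter>i\<in>{..k}. {\<tau>\<in>space ?Y. \<tau> i \<in> {g i}})" by auto
    moreover have "{\<tau>\<in>space ?Y. \<tau> i \<in> {g i}} \<in> sets ?Y" if "i \<le> k" for i
      by (rule sets_Collect_single) (use that g in auto)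
    ultimately have S: "{\<tau>\<in>space ?Y. \<forall>i\<le>k. \<tau> i = g i} \<in> sets ?Y"
      by (auto intro!: sets.finite_INT)
    have "measure M {\<tau>\<in>space M. \<forall>i\<le>k. \<tau> i = g i} = measure ?X {x. \<forall>i\<le>k. W x i = g i}"
      unfolding M_def space_distr
      by (subst measure_distr[OF mW' S])
        (auto intro!: arg_cong[where f = "measure ?X"] simp: sp space_PiM Wc)
    also have "\<dots> = (if g 0 = \<one>\<^bsub>G\<^esub> then \<Prod>i<k. pmf \<mu> (inv\<^bsub>G\<^esub> (g i) \<otimes>\<^bsub>G\<^esub> g (Suc i)) else 0)"
    proof (cases "g 0 = \<one>\<^bsub>G\<^esub>")
      case False
      then have "{x. \<forall>i\<le>k. W x i = g i} = {}" using W0 by force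
      then have "measure ?X {x. \<forall>i\<le>k. W x i = g i} = 0" by (simp only: measure_empty)
      then show ?thesis using False by simp
    next
      case True
      have "(\<forall>i\<le>k. W x i = g i) \<longleftrightarrow> (\<forall>i<k. p (x i) = inv\<^bsub>G\<^esub> (g i) \<otimes>\<^bsub>G\<^esub> g (Suc i))" for x
        using g
      proof (induction k)
        case 0
        then show ?case by (simp add: W0 True)
      next
        case (Suc k)
        have gk: "g k \<in> carrier G" "g (Suc k) \<in> carrier G" using Suc.prems by auto
        have IH: "(\<forall>i\<le>k. W x i = g i) \<longleftrightarrow> (\<forall>i<k. p (x i) = inv\<^bsub>G\<^esub> (g i) \<otimes>\<^bsub>G\<^esub> g (Suc i))"
          using Suc.prems by (intro Suc.IH) auto
        have st: "g k \<otimes>\<^bsub>G\<^esub> p (x k) = g (Suc k) \<longleftrightarrow> p (x k) = inv\<^bsub>G\<^esub> (g k) \<otimes>\<^bsub>G\<^esub> g (Suc k)"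
          using gk p[of "x k"] by (metis inv_solve_left)
        show ?case using IH st by (auto simp: le_Suc_eq less_Suc_eq WS)
      qed
      then have "{x. \<forall>i\<le>k. W x i = g i} =
          {x\<in>space ?X. \<forall>i\<in>{..<k}. x i \<in> p -` {inv\<^bsub>G\<^esub> (g i) \<otimes>\<^bsub>G\<^esub> g (Suc i)}}"
        by (auto simp: space_PiM)
      also have "measure ?X \<dots> = (\<Prod>i<k. pmf \<mu> (inv\<^bsub>G\<^esub> (g i) \<otimes>\<^bsub>G\<^esub> g (Suc i)))"
        using X.emeasure_PiM_Collect[of "{..<k}" "\<lambda>i. p -` {inv\<^bsub>G\<^esub> (g i) \<otimes>\<^bsub>G\<^esub> g (Suc i)}"]
        by (simp add: X.emeasure_eq_measure measure_pmf.emeasure_eq_measure pm prod_ennreal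
            prod_nonneg)
      finally show ?thesis using True by simp
    qed
    finally show ?thesis .
  qed
  have "prob_space M" unfolding M_def by (rule X.prob_space_distr[OF mW'])
  moreover have "sets M = sets ?Y" by (simp add: M_def)
  ultimately have "random_walk_measure G \<mu> M"
    unfolding random_walk_measure_def markov_measure_def using cyl by blast
  then show ?thesis by blast
qed

lemma countable_braid_group: "countable (carrier (braid_group n))"
proof -
  have "carrier (braid_group n) = (\<lambda>w. pres_rel {1..<n} (braid_relations n) `` {w}) ` gwords {1..<n}"
    by (auto simp: braid_group_def presented_group_def quotient_def)
  then show ?thesis by simp
qed

end

theory Submission
  imports Defs "HOL-Complex_Analysis.Great_Picard"
begin

text \<open>Write \<open>\<tau> = \<gamma> \<pi>\<close> with \<open>\<gamma>\<close> pure, and let \<open>A \<tau>\<close> be the component of \<open>\<gamma>\<close> in the free group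
  \<open>F = F\<^bsub>n-1\<^esub>\<close>; its reduced word is a prefix of the normal form, so it suffices that this
  word converges. A subsequential limit of averaged step distributions gives, for each
  cylinder \<open>C\<close> of \<open>F\<close>, a bounded harmonic function \<open>h\<close> with \<open>h \<tau>\<close> the mass that a finitely additive
  measure \<open>\<nu>\<^sub>\<tau>\<close> on \<open>F\<close> gives to \<open>C\<close>. The increments of a bounded martingale are
  square summable, so along almost every path \<open>\<nu>\<^sub>\<tau>\<close> is asymptotically invariant under
  \<open>\<tau> k \<tau>\<inverse>\<close> for each fixed \<open>k\<close>; for suitable \<open>k\<close> these conjugates lie in \<open>F\<close>, as \<open>F\<close> is
  normal in the pure braid group. Translates of a half-tree by a non-commuting pair in \<open>F\<close>
  produce many disjoint half-trees, hence almost invariance forces the mass of each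
  cylinder to tend to \<open>0\<close> or \<open>1\<close>, and the masses single out an infinite word \<open>z\<close>.
  The product \<open>c\<close> of the generators of \<open>F\<close> commutes with \<open>P\<^bsub>n-1\<^esub>\<close>, so its conjugate by \<open>\<tau>\<close> is
  \<open>A \<tau> c (A \<tau>)\<inverse>\<close>. If \<open>A \<tau>\<close> failed to approach \<open>z\<close>, the axis of this element
  would contain long pieces of \<open>z\<close>, and \<open>z\<close> would end periodically in \<open>c\<close> or \<open>c\<inverse>\<close>; there are
  countably many such words, and each has probability zero.

  Freeness of \<open>F\<^bsub>m-1\<^esub>\<close> and uniqueness of the decomposition come from the Artin action on the
  free group: an element of \<open>F\<^bsub>m-1\<^esub>\<close> conjugates the \<open>m\<close>-th generator by a word from which
  the element can be read off after killing that generator, while \<open>P\<^bsub>m-1\<^esub>\<close> fixes it.\<close>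

section \<open>Reduced words and the free group\<close>

text \<open>The coset representatives are arbitrary, so the free component \<open>A\<close> is not
  equivariant under the braid group; the only visible symmetry is that left multiplication by
  \<open>F\<close> translates it. Right multiplication of \<tau> by
  \<open>\<pi>\<inverse> f \<pi>\<close> with \<open>f\<close> in \<open>F\<close> is left
  multiplication by the conjugate of \<open>f\<close> by the pure part \<gamma>. This right factor
  depends on \<tau> only through \<pi>, which takes finitely many values, so invariance in the limit
  for each fixed factor can be used although the factor varies along the path. The masses find
  \<open>z\<close> but do not tell where \<open>A \<tau>\<close> is, since conjugation by \<tau>
  acts on \<open>F\<close> by an automorphism that changes with \<tau>. The element \<open>c\<close>
  is chosen because its conjugate depends on \<open>A \<tau>\<close> alone. Every use of the masses
  is a finite linear inequality between indicators, so finite additivity suffices and no measure on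
  the space of infinite words is constructed. A non-commuting pair in \<open>F\<close> exists from
  \<open>n = 3\<close> on; for \<open>n = 2\<close> the braid group is infinite cyclic and the
  simple walk on it is recurrent.\<close>

definition flip :: "'a \<times> bool \<Rightarrow> 'a \<times> bool" where
  "flip x = (fst x, \<not> snd x)"

lemma flip_flip [simp]: "flip (flip x) = x"
  by (simp add: flip_def)

lemma flip_neq [simp]: "flip x \<noteq> x" "x \<noteq> flip x"
  by (auto simp: flip_def prod_eq_iff)

lemma flip_eq_iff [simp]: "flip x = flip y \<longleftrightarrow> x = y"
  by (metis flip_flip)

lemma fst_flip [simp]: "fst (flip x) = fst x"
  by (simp add: flip_def)

lemma flip_Pair: "flip (a, b) = (a, \<not> b)"
  by (simp add: flip_def)

lemma reduced_altdef: "reduced w \<longleftrightarrow> successively (\<lambda>x y. y \<noteq> flip x) w"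
proof -
  have "(\<lambda>x y::'a \<times> bool. \<not> (fst x = fst y \<and> snd x \<noteq> snd y)) = (\<lambda>x y. y \<noteq> flip x)"
    by (auto simp: fun_eq_iff flip_def prod_eq_iff)
  then show ?thesis by (simp only: reduced_def)
qed

lemma reduced_Nil [simp]: "reduced []"
  by (simp add: reduced_def)

lemma reduced_single [simp]: "reduced [x]"
  by (simp add: reduced_def)

lemma reduced_Cons: "reduced (x # w) \<longleftrightarrow> reduced w \<and> (w = [] \<or> hd w \<noteq> flip x)"
  by (auto simp: reduced_altdef successively_Cons)

lemma reduced_append:
  "reduced (u @ v) \<longleftrightarrow> reduced u \<and> reduced v \<and> (u = [] \<or> v = [] \<or> hd v \<noteq> flip (last u))"
  by (auto simp: reduced_altdef successively_append_iff)

definition inv_word :: "('a \<times> bool) list \<Rightarrow> ('a \<times> bool) list" where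
  "inv_word w = rev (map flip w)"

lemma inv_word_Nil [simp]: "inv_word [] = []"
  by (simp add: inv_word_def)

lemma inv_word_Cons: "inv_word (x # v) = inv_word v @ [flip x]"
  by (simp add: inv_word_def)

lemma inv_word_inv_word [simp]: "inv_word (inv_word w) = w"
  by (simp add: inv_word_def rev_map o_def)

lemma length_inv_word [simp]: "length (inv_word w) = length w"
  by (simp add: inv_word_def)

lemma inv_word_eq_Nil [simp]: "inv_word w = [] \<longleftrightarrow> w = []"
  by (simp add: inv_word_def)

lemma last_inv_word: "w \<noteq> [] \<Longrightarrow> last (inv_word w) = flip (hd w)"
  by (simp add: inv_word_def last_rev hd_map)

lemma reduced_inv_word [simp]: "reduced (inv_word w) \<longleftrightarrow> reduced w"
proof -
  have *: "reduced (inv_word w)" if "reduced w" for w :: "('a \<times> bool) list"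
    using that
    by (induction w) (auto simp: inv_word_Cons reduced_append reduced_Cons last_inv_word)
  show ?thesis using *[of w] *[of "inv_word w"] by auto
qed

definition rcons :: "'a \<times> bool \<Rightarrow> ('a \<times> bool) list \<Rightarrow> ('a \<times> bool) list" where
  "rcons x w = (if w \<noteq> [] \<and> hd w = flip x then tl w else x # w)"

lemma reduced_tl: "reduced w \<Longrightarrow> reduced (tl w)"
  by (cases w) (auto simp: reduced_Cons)

lemma reduced_rcons: "reduced w \<Longrightarrow> reduced (rcons x w)"
  by (auto simp: rcons_def reduced_Cons reduced_tl)

lemma rcons_flip: "reduced w \<Longrightarrow> rcons x (rcons (flip x) w) = w"
  by (cases w) (auto simp: rcons_def reduced_Cons neq_Nil_conv)

lemma reduced_foldr_rcons: "reduced w \<Longrightarrow> reduced (foldr rcons u w)"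
  by (induction u) (auto intro: reduced_rcons)

lemma foldr_rcons_reduced: "reduced (u @ v) \<Longrightarrow> foldr rcons u v = u @ v"
  by (induction u) (auto simp: reduced_Cons rcons_def)

text \<open>Letters act on reduced words as permutations, by \<open>rcons_flip\<close>; a cancelling
  pair therefore acts as the identity, and associativity needs no confluence argument.\<close>

lemma foldr_rcons_rcons:
  assumes "reduced u" "reduced w"
  shows "foldr rcons (rcons x u) w = rcons x (foldr rcons u w)"
  using assms rcons_flip[OF reduced_foldr_rcons, of w x "tl u"]
  by (cases u) (auto simp: rcons_def)

lemma foldr_rcons_foldr:
  assumes "reduced v" "reduced w"
  shows "foldr rcons (foldr rcons u v) w = foldr rcons u (foldr rcons v w)"
  using assms by (induction u) (auto simp: foldr_rcons_rcons reduced_foldr_rcons)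

lemma foldr_rcons_inv_word:
  assumes "reduced w"
  shows "foldr rcons (inv_word u) (foldr rcons u w) = w"
  using assms
proof (induction u)
  case (Cons x u)
  then show ?case
    using rcons_flip[OF reduced_foldr_rcons, of w "flip x" u] by (simp add: inv_word_Cons)
qed simp

text \<open>Every element of the type \<open>'a\<close> is a free generator. The group is written
  additively because \<open>group_add\<close> does not assume commutativity.\<close>

typedef 'a fg = "{w :: ('a \<times> bool) list. reduced w}"
  morphisms word Abs_fg
  by (rule exI[of _ "[]"]) simp

setup_lifting type_definition_fg

lemma reduced_word [simp]: "reduced (word u)"
  using word[of u] by simp

instantiation fg :: (type) group_add
begin

lift_definition zero_fg :: "'a fg" is "[]" by simp

lift_definition plus_fg :: "'a fg \<Rightarrow> 'a fg \<Rightarrow> 'a fg" is "foldr rcons"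
  by (rule reduced_foldr_rcons)

lift_definition uminus_fg :: "'a fg \<Rightarrow> 'a fg" is inv_word by simp

definition minus_fg :: "'a fg \<Rightarrow> 'a fg \<Rightarrow> 'a fg" where
  "minus_fg a b = a + - b"

instance
proof
  fix a b c :: "'a fg"
  show "a + b + c = a + (b + c)" by transfer (rule foldr_rcons_foldr)
  show "0 + a = a" by transfer simp
  show "a + 0 = a" by transfer (simp add: foldr_rcons_reduced)
  show "- a + a = 0"
  proof transfer
    fix a :: "('a \<times> bool) list" assume "reduced a"
    then show "foldr rcons (inv_word a) a = []"
      using foldr_rcons_inv_word[of "[]" a] foldr_rcons_reduced[of a "[]"] by simp
  qed
  show "a + - b = a - b" by (simp add: minus_fg_def)
qed

end

lemma word_zero [simp]: "word 0 = []" by transfer simp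
lemma word_uminus: "word (- u) = inv_word (word u)" by transfer simp
lemma word_plus: "word (u + v) = foldr rcons (word u) (word v)" by transfer simp
lemma word_eq_Nil [simp]: "word u = [] \<longleftrightarrow> u = 0" by transfer simp

lemma word_plus_reduced: "reduced (word u @ word v) \<Longrightarrow> word (u + v) = word u @ word v"
  by (simp add: word_plus foldr_rcons_reduced)

lift_definition letter :: "'a \<times> bool \<Rightarrow> 'a fg" is "\<lambda>x. [x]" by simp

lemma word_letter [simp]: "word (letter x) = [x]" by transfer simp

lemma letter_flip: "letter (flip x) = - letter x"
  by transfer (simp add: inv_word_def)

lemma word_letter_plus: "word (letter x + u) = rcons x (word u)"
  by transfer simp

definition of_word :: "('a \<times> bool) list \<Rightarrow> 'a fg" where
  "of_word w = foldr (\<lambda>x u. letter x + u) w 0"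

lemma of_word_Nil [simp]: "of_word [] = 0"
  and of_word_Cons: "of_word (x # w) = letter x + of_word w"
  by (simp_all add: of_word_def)

lemma of_word_append: "of_word (u @ v) = of_word u + of_word v"
  by (induction u) (simp_all add: of_word_Cons add.assoc)

lemma word_of_word: "reduced w \<Longrightarrow> word (of_word w) = w"
  by (induction w) (auto simp: of_word_Cons word_letter_plus reduced_Cons rcons_def)

lemma of_word_word [simp]: "of_word (word u) = u"
  by (metis word_of_word reduced_word word_inject)

lemma of_word_inv_word: "of_word (inv_word w) = - of_word w"
  by (induction w) (simp_all add: inv_word_Cons of_word_append of_word_Cons letter_flip minus_add
      del: add_uminus_conv_diff)

lemma fg_induct [case_names zero letter]:
  assumes "P 0" "\<And>x u. P u \<Longrightarrow> P (letter x + u)"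
  shows "P u"
proof -
  have "P (of_word w)" for w by (induction w) (auto simp: assms of_word_Cons)
  from this[of "word u"] show ?thesis by simp
qed

lemma word_plus_letter:
  "word (u + letter x) = (if u \<noteq> 0 \<and> last (word u) = flip x then butlast (word u) else word u @ [x])"
proof (cases "u \<noteq> 0 \<and> last (word u) = flip x")
  case True
  define v where "v = of_word (butlast (word u))"
  have r: "reduced (butlast (word u))"
    using reduced_word[of u] True append_butlast_last_id[of "word u"]
    by (metis reduced_append word_eq_Nil)
  have "word u = butlast (word u) @ [flip x]"
    using True append_butlast_last_id[of "word u"] by simp
  then have "u = v + letter (flip x)"
    unfolding v_def by (metis of_word_append of_word_word of_word_Cons of_word_Nil add_0_right)
  then have "u + letter x = v" by (simp add: letter_flip)
  then show ?thesis using True r by (simp add: v_def word_of_word)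
next
  case False
  then have "reduced (word u @ word (letter x))" by (auto simp: reduced_append)
  from word_plus_reduced[OF this] False show ?thesis by auto
qed

lemma set_rcons: "set (rcons x w) \<subseteq> insert x (set w)"
  by (cases w) (auto simp: rcons_def)

lemma set_word_plus: "set (word (u + v)) \<subseteq> set (word u) \<union> set (word v)"
proof -
  have "set (foldr rcons u' v') \<subseteq> set u' \<union> set v'" for u' v' :: "('a \<times> bool) list"
    by (induction u') (use set_rcons in fastforce)+
  then show ?thesis by (simp add: word_plus)
qed

section \<open>Half-trees\<close>

text \<open>In the Cayley tree rooted at the unit these are the vertices beyond the last edge of the
  path \<open>w\<close>; \<open>w = []\<close> gives the whole group and an unreduced
  \<open>w\<close> the empty set.\<close>

definition cyl :: "('a \<times> bool) list \<Rightarrow> 'a fg set" where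
  "cyl w = {u. prefix w (word u)}"


lemma mem_translate: "y \<in> (+) k ` H \<longleftrightarrow> - k + y \<in> H" for k :: "'a fg"
  by (auto simp: image_iff add.assoc[symmetric] intro!: bexI[of _ "- k + y"])

lemma translate_translate: "(+) k ` (+) l ` H = (+) (k + l) ` H" for k :: "'a fg"
  by (auto simp: image_image add.assoc)

lemma translate_Compl: "(+) k ` (- H) = - (+) k ` H" for k :: "'a fg"
  by (auto simp: mem_translate simp del: image_iff)

text \<open>The complement appears exactly for the edge from the unit to
  \<open>letter (flip x)\<close>: its far end is moved to the unit, so the root changes
  sides.\<close>

lemma translate_letter_cyl:
  assumes "reduced w" "w \<noteq> []"
  shows "(+) (letter x) ` cyl w =
    (if w = [flip x] then - cyl [x] else if hd w = flip x then cyl (tl w) else cyl (x # w))"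
proof -
  have "prefix w (rcons (flip x) v) \<longleftrightarrow>
      (if w = [flip x] then \<not> prefix [x] v else if hd w = flip x then prefix (tl w) v
       else prefix (x # w) v)" if "reduced v" for v
    using assms that
    by (cases v; cases "tl v"; cases w; cases "tl w") (auto simp: rcons_def reduced_Cons)
  note * = this
  show ?thesis
  proof (rule Set.set_eqI)
    fix y
    have "y \<in> (+) (letter x) ` cyl w \<longleftrightarrow> prefix w (rcons (flip x) (word y))"
      by (simp add: mem_translate cyl_def word_letter_plus flip: letter_flip)
    then show "y \<in> (+) (letter x) ` cyl w \<longleftrightarrow> y \<in> (if w = [flip x] then - cyl [x]
        else if hd w = flip x then cyl (tl w) else cyl (x # w))"
      unfolding *[OF reduced_word] by (simp add: cyl_def)
  qed
qed

text \<open>The two sides of an edge of the Cayley tree. Complements are included to make the notion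
  invariant under translation, which \<open>cyl\<close> is not.\<close>

definition half_tree :: "'a fg set \<Rightarrow> bool" where
  "half_tree H \<longleftrightarrow> (\<exists>w. w \<noteq> [] \<and> reduced w \<and> (H = cyl w \<or> H = - cyl w))"

lemma half_tree_cyl: "w \<noteq> [] \<Longrightarrow> reduced w \<Longrightarrow> half_tree (cyl w)"
  by (auto simp: half_tree_def)

lemma half_tree_Compl [simp]: "half_tree (- H) \<longleftrightarrow> half_tree H"
  by (auto simp: half_tree_def)

lemma half_tree_translate: "half_tree H \<Longrightarrow> half_tree ((+) k ` H)"
proof (induction k rule: fg_induct)
  case (letter x k)
  then obtain w where w: "w \<noteq> []" "reduced w" "(+) k ` H = cyl w \<or> (+) k ` H = - cyl w"
    unfolding half_tree_def by auto
  have "half_tree ((+) (letter x) ` cyl w)"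
    unfolding translate_letter_cyl[OF w(2,1)]
    using w by (cases w; cases "tl w") (auto intro!: half_tree_cyl simp: reduced_Cons)
  then have "half_tree ((+) (letter x) ` (+) k ` H)"
    using w(3) by (auto simp: translate_Compl)
  then show ?case by (simp add: translate_translate)
qed simp

lemma half_tree_neq: assumes "half_tree H" shows "H \<noteq> {}" "H \<noteq> UNIV"
proof -
  obtain w where w: "w \<noteq> []" "reduced w" "H = cyl w \<or> H = - cyl w"
    using assms by (auto simp: half_tree_def)
  have "of_word w \<in> cyl w" "0 \<notin> cyl w" using w by (auto simp: cyl_def word_of_word)
  with w(3) show "H \<noteq> {}" "H \<noteq> UNIV" by auto
qed

lemma cyl_cases: "cyl v \<subseteq> cyl w \<or> cyl w \<subseteq> cyl v \<or> cyl v \<inter> cyl w = {}"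
  unfolding cyl_def by (auto dest: prefix_same_cases intro: prefix_order.trans)

text \<open>The only property of trees that the later arguments use; it rests on the comparability
  of two prefixes of one word.\<close>

lemma half_tree_cases:
  assumes "half_tree H" "half_tree J"
  shows "H \<subseteq> J \<or> J \<subseteq> H \<or> H \<inter> J = {} \<or> H \<union> J = UNIV"
proof -
  obtain w where "H = cyl w \<or> H = - cyl w" using assms(1) by (auto simp: half_tree_def)
  moreover obtain v where "J = cyl v \<or> J = - cyl v" using assms(2) by (auto simp: half_tree_def)
  ultimately show ?thesis using cyl_cases[of v w] by fast
qed

text \<open>Only one edge enters \<open>cyl w\<close> by the letter \<open>last w\<close>, and it
  starts at \<open>butlast w\<close>. A translation preserving the half-tree preserves this edge, so
  it fixes a vertex, and the group acts freely on vertices.\<close>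

lemma half_tree_translate_neq:
  assumes "half_tree H" and eq: "(+) k ` H = H"
  shows "k = 0"
proof -
  obtain w where w: "w \<noteq> []" "reduced w" "H = cyl w \<or> H = - cyl w"
    using assms by (auto simp: half_tree_def)
  have kw: "(+) k ` cyl w = cyl w" using w(3) eq by (metis translate_Compl double_compl)
  have mem: "k + u \<in> cyl w \<longleftrightarrow> u \<in> cyl w" for u
    using kw mem_translate[of "k + u" k "cyl w"] by (simp add: add.assoc[symmetric])
  have enter: "word u = butlast w" if "u \<notin> cyl w" "u + letter (last w) \<in> cyl w" for u
  proof -
    have "\<not> prefix w (word u)" "prefix w (word (u + letter (last w)))"
      using that by (auto simp: cyl_def)
    then have "word u @ [last w] = w"
      by (auto simp: word_plus_letter split: if_splits
          dest: prefix_order.trans[OF _ prefixeq_butlast])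
    then show ?thesis by (metis butlast_snoc)
  qed
  define u where "u = of_word (butlast w)"
  have r: "reduced (butlast w)" using w by (metis append_butlast_last_id reduced_append)
  have "of_word w = u + letter (last w)"
    using w(1) unfolding u_def by (metis append_butlast_last_id of_word_append of_word_Cons
        of_word_Nil add_0_right)
  then have "u + letter (last w) \<in> cyl w" using w by (metis cyl_def mem_Collect_eq
        word_of_word prefix_order.refl)
  moreover have "u \<notin> cyl w"
    using r w(1) prefix_length_le[of w "butlast w"]
    by (cases "length w") (auto simp: u_def cyl_def word_of_word)
  ultimately have "word (k + u) = butlast w"
    using mem[of u] mem[of "u + letter (last w)"] by (intro enter) (simp_all add: add.assoc)
  then have "k + u = 0 + u" by (metis u_def of_word_word add_0_left)
  then show ?thesis by (rule add_right_imp_eq)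
qed

text \<open>A half-tree separating \<open>p\<close> from \<open>q\<close> comes from a prefix of one
  of their two words; this is what makes \<open>gap\<close> meaningful.\<close>

lemma finite_separating_half_trees: "finite {J. half_tree J \<and> p \<in> J \<and> q \<notin> J}"
proof (rule finite_subset)
  show "{J. half_tree J \<and> p \<in> J \<and> q \<notin> J} \<subseteq>
      cyl ` {w. prefix w (word p)} \<union> (\<lambda>w. - cyl w) ` {w. prefix w (word q)}"
    by (auto simp: half_tree_def cyl_def)
  show "finite (cyl ` {w. prefix w (word p)} \<union> (\<lambda>w. - cyl w) ` {w. prefix w (word q)})"
    by (simp flip: set_prefixes_eq)
qed

text \<open>A word-free substitute for the distance of the edges bounding the two half-trees.\<close>

definition gap :: "'a fg set \<Rightarrow> 'a fg set \<Rightarrow> nat" where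
  "gap X Y = card {J. half_tree J \<and> X \<subseteq> J \<and> J \<subseteq> Y}"

lemma finite_gap:
  assumes "half_tree X" "half_tree Y"
  shows "finite {J. half_tree J \<and> X \<subseteq> J \<and> J \<subseteq> Y}"
proof -
  obtain p q where "p \<in> X" "q \<notin> Y" using half_tree_neq[OF assms(1)] half_tree_neq[OF assms(2)] by auto
  then show ?thesis by (intro finite_subset[OF _ finite_separating_half_trees[of p q]]) auto
qed

lemma gap_translate: "gap ((+) k ` X) ((+) k ` Y) = gap X Y" for k :: "'a fg"
proof -
  have inj: "inj ((`) ((+) k))" by (intro inj_onI) (metis inj_image_eq_iff inj_on_add)
  have sub: "(+) k ` X \<subseteq> J \<longleftrightarrow> X \<subseteq> (+) (- k) ` J" "J \<subseteq> (+) k ` X \<longleftrightarrow> (+) (- k) ` J \<subseteq> X" for J X :: "'a fg set"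
    by (force simp: mem_translate add.assoc[symmetric])+
  have "{J. half_tree J \<and> (+) k ` X \<subseteq> J \<and> J \<subseteq> (+) k ` Y} =
      (`) ((+) k) ` {J. half_tree J \<and> X \<subseteq> J \<and> J \<subseteq> Y}" (is "?L = ?R")
  proof (intro equalityI subsetI)
    fix J assume J: "J \<in> ?L"
    show "J \<in> ?R"
      using J by (intro image_eqI[of _ _ "(+) (- k) ` J"])
        (auto simp: sub half_tree_translate translate_translate simp del: image_image)
  qed (auto intro: half_tree_translate)
  then show ?thesis
    unfolding gap_def by (simp add: card_image[OF inj_on_subset[OF inj]])
qed

lemma gap_strict_mono:
  assumes "half_tree X" "half_tree X'" "half_tree Y" "half_tree Y'"
    and "X \<subset> X'" "X' \<subseteq> Y'" "Y' \<subseteq> Y"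
  shows "gap X' Y' < gap X Y"
  unfolding gap_def
proof (rule psubset_card_mono[OF finite_gap[OF assms(1,3)]])
  have "X \<in> {J. half_tree J \<and> X \<subseteq> J \<and> J \<subseteq> Y}" "X \<notin> {J. half_tree J \<and> X' \<subseteq> J \<and> J \<subseteq> Y'}"
    using assms by auto
  then show "{J. half_tree J \<and> X' \<subseteq> J \<and> J \<subseteq> Y'} \<subset> {J. half_tree J \<and> X \<subseteq> J \<and> J \<subseteq> Y}"
    using assms by blast
qed

text \<open>A half-tree between \<open>X\<close> and \<open>Z\<close> is comparable with
  \<open>Y\<close>: it meets \<open>Y\<close> in \<open>X\<close>, and both avoid the complement of
  \<open>Z\<close>. So the interval splits at \<open>Y\<close>, which is counted twice.\<close>

lemma gap_split:
  assumes "half_tree X" "half_tree Y" "half_tree Z" "X \<subseteq> Y" "Y \<subseteq> Z"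
  shows "gap X Z + 1 = gap X Y + gap Y Z"
proof -
  let ?I = "\<lambda>X Z. {J. half_tree J \<and> X \<subseteq> J \<and> J \<subseteq> Z}"
  have cmp: "J \<subseteq> Y \<or> Y \<subseteq> J" if "half_tree J" "X \<subseteq> J" "J \<subseteq> Z" for J
    using half_tree_cases[OF that(1) assms(2)] half_tree_neq[OF assms(1)] half_tree_neq[OF assms(3)]
      that assms by blast
  have "?I X Z = ?I X Y \<union> ?I Y Z" using cmp assms by blast
  moreover have "?I X Y \<inter> ?I Y Z = {Y}" using assms by blast
  ultimately show ?thesis
    using card_Un_Int[OF finite_gap[OF assms(1,2)] finite_gap[OF assms(2,3)]] by (simp add: gap_def)
qed

section \<open>Translates of a half-tree by multiples and by a non-commuting pair\<close>

fun nmult :: "nat \<Rightarrow> 'a::monoid_add \<Rightarrow> 'a" where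
  "nmult 0 k = 0"
| "nmult (Suc j) k = k + nmult j k"

lemma mult_add: "nmult (i + j) k = nmult i k + nmult j k"
  by (induction i) (simp_all add: add.assoc)

lemma mult_Suc': "nmult (Suc j) k = nmult j k + k"
  using mult_add[of j 1 k] by simp

text \<open>Translation by \<open>nmult j k\<close> carries the pair \<open>H\<close>,
  \<open>k + H\<close> to another pair with the same \<open>gap\<close> from the first set to the
  complement of the second. Were the \<open>j\<close>-th translate comparable with \<open>H\<close>,
  one interval would lie strictly inside the other, which changes the gap. The two cannot cover the
  group because both miss \<open>k + H\<close>, for the \<open>j\<close>-th translate by
  induction.\<close>

lemma disjoint_multiples:
  assumes H: "half_tree H" and dis: "(+) k ` H \<inter> H = {}" and tf: "\<And>j. j > 0 \<Longrightarrow> nmult j k \<noteq> 0"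
    and "j > 0"
  shows "(+) (nmult j k) ` H \<inter> H = {}"
  using \<open>j > 0\<close>
proof (induction j rule: less_induct)
  case (less j)
  let ?T = "\<lambda>j. (+) (nmult j k) ` H"
  have TH: "half_tree (?T j)" for j using H by (rule half_tree_translate)
  have T_Suc: "(+) k ` ?T j = ?T (Suc j)" for j by (simp add: translate_translate)
  have T_1: "(+) (nmult j k) ` (+) k ` H = ?T (Suc j)" for j
    by (simp only: translate_translate mult_Suc')
  have T1: "?T 1 = (+) k ` H" by simp
  have dis1: "?T j \<inter> ?T (Suc j) = {}"
    unfolding T_1[symmetric] using dis by (force simp: mem_translate)
  show ?case
  proof (cases "j = 1")
    case True
    then show ?thesis using dis by simp
  next
    case False
    then have "?T (j - 1) \<inter> H = {}" using less by simp
    then have "(+) k ` ?T (j - 1) \<inter> (+) k ` H = {}" by (force simp: mem_translate)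
    then have d2: "?T j \<inter> (+) k ` H = {}" using less.prems by (simp only: T_Suc) simp
    have nH: "H \<noteq> ?T j" using half_tree_translate_neq[OF H, of "nmult j k"] tf less.prems by metis
    have g0: "gap H (- (+) k ` H) = gap (?T j) (- ?T (Suc j))"
      unfolding T_1[symmetric] by (simp only: gap_translate flip: translate_Compl)
    have kH: "half_tree ((+) k ` H)" for k using H by (rule half_tree_translate)
    consider "?T j \<subseteq> H" | "H \<subseteq> ?T j" | "?T j \<inter> H = {}" | "?T j \<union> H = UNIV"
      using half_tree_cases[OF TH[of j] H] by blast
    then show ?thesis
    proof cases
      case 1
      then have "(+) k ` ?T j \<subseteq> (+) k ` H" by blast
      then have "?T (Suc j) \<subseteq> (+) k ` H" by (simp only: T_Suc)
      then have "gap H (- (+) k ` H) < gap (?T j) (- ?T (Suc j))"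
        using 1 nH dis H TH[of j] TH[of "Suc j"] kH[of k]
        by (intro gap_strict_mono) auto
      then show ?thesis using g0 by simp
    next
      case 2
      then have "(+) k ` H \<subseteq> (+) k ` ?T j" by blast
      then have "(+) k ` H \<subseteq> ?T (Suc j)" by (simp only: T_Suc)
      then have "gap (?T j) (- ?T (Suc j)) < gap H (- (+) k ` H)"
        using 2 nH dis1 H TH[of j] TH[of "Suc j"] kH[of k]
        by (intro gap_strict_mono) auto
      then show ?thesis using g0 by simp
    next
      case 4
      then show ?thesis using d2 dis half_tree_neq[OF kH[of k]] by blast
    qed
  qed
qed

text \<open>By additivity of \<open>gap\<close>, both products push \<open>H\<close> equally deep
  into itself, so nested images would coincide, and then the two products would be equal. Since both
  images lie in \<open>H\<close>, they cannot cover the group either.\<close>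

lemma nested_translates_disjoint:
  assumes H: "half_tree H" and s: "(+) s ` H \<subseteq> H" and t: "(+) t ` H \<subseteq> H" and ne: "s + t \<noteq> t + s"
  shows "(+) (s + t) ` H \<inter> (+) (t + s) ` H = {}" "(+) (s + t) ` H \<subseteq> H" "(+) (t + s) ` H \<subseteq> H"
proof -
  have TH: "half_tree ((+) k ` H)" for k using H by (rule half_tree_translate)
  have sub: "(+) (s + t) ` H \<subseteq> (+) s ` H" "(+) (t + s) ` H \<subseteq> (+) t ` H"
    using s t by (auto simp: translate_translate[symmetric] simp del: image_image)
  then show sub': "(+) (s + t) ` H \<subseteq> H" "(+) (t + s) ` H \<subseteq> H" using s t by auto
  have g: "gap ((+) (s + t) ` H) H + 1 = gap ((+) t ` H) H + gap ((+) s ` H) H"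
    using gap_split[OF TH TH H sub(1) s] by (simp only: gap_translate flip: translate_translate)
  have g': "gap ((+) (t + s) ` H) H + 1 = gap ((+) s ` H) H + gap ((+) t ` H) H"
    using gap_split[OF TH TH H sub(2) t] by (simp only: gap_translate flip: translate_translate)
  have geq: "gap ((+) (s + t) ` H) H = gap ((+) (t + s) ` H) H" using g g' by simp
  have neq: "(+) (s + t) ` H \<noteq> (+) (t + s) ` H"
  proof
    assume "(+) (s + t) ` H = (+) (t + s) ` H"
    then have "(+) (- (t + s)) ` (+) (s + t) ` H = (+) (- (t + s)) ` (+) (t + s) ` H" by simp
    then have "(+) (- (t + s) + (s + t)) ` H = H" by (simp only: translate_translate) simp
    from half_tree_translate_neq[OF H this] ne show False
      by (metis add.left_inverse left_minus minus_unique minus_minus)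
  qed
  from half_tree_cases[OF TH[of "s + t"] TH[of "t + s"]]
  show "(+) (s + t) ` H \<inter> (+) (t + s) ` H = {}"
  proof (elim disjE)
    assume "(+) (s + t) ` H \<subseteq> (+) (t + s) ` H"
    then show ?thesis
      using gap_strict_mono[OF TH[of "s + t"] TH[of "t + s"] H H _ sub'(2) subset_refl] neq geq by auto
  next
    assume "(+) (t + s) ` H \<subseteq> (+) (s + t) ` H"
    then show ?thesis
      using gap_strict_mono[OF TH[of "t + s"] TH[of "s + t"] H H _ sub'(1) subset_refl] neq geq by auto
  qed (use sub' half_tree_neq[OF H] in auto)
qed

text \<open>The elements whose images decide between the two alternatives in \<open>dichotomy\<close>.\<close>

definition probes :: "nat \<Rightarrow> 'b::group_add \<Rightarrow> 'b \<Rightarrow> 'b set" where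
  "probes N a b = insert 0 ((\<lambda>j. nmult j a) ` {..N} \<union> (\<lambda>j. nmult j b) ` {..N} \<union>
     (\<Union>s\<in>{a, - a}. \<Union>t\<in>{b, - b}. {s + t, t + s}))"

lemma finite_probes [simp]: "finite (probes N a b)"
  by (simp add: probes_def)

lemma probes_subset:
  assumes "0 \<in> U" "a \<in> U" "b \<in> U" "\<And>u v. u \<in> U \<Longrightarrow> v \<in> U \<Longrightarrow> u + v \<in> U" "\<And>u. u \<in> U \<Longrightarrow> - u \<in> U"
  shows "probes N a b \<subseteq> U"
proof -
  have "nmult j u \<in> U" if "u \<in> U" for j u using assms that by (induction j) auto
  then show ?thesis using assms by (auto simp: probes_def simp del: add_uminus_conv_diff)
qed

lemma mult_uminus: "nmult j (- k) = - nmult j k" for k :: "'b::group_add"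
  by (induction j) (simp_all add: minus_add mult_Suc'[of _ k] del: add_uminus_conv_diff nmult.simps(2), simp)

lemma mult_diff: "i \<le> j \<Longrightarrow> nmult j k = nmult (j - i) k + nmult i k"
  using mult_add[of "j - i" i k] by simp

lemma inj_mult:
  fixes a :: "'b::group_add"
  assumes "\<And>j. j > 0 \<Longrightarrow> nmult j a \<noteq> 0"
  shows "inj (\<lambda>j. nmult j a)"
proof (rule linorder_injI)
  fix i j :: nat assume "i < j"
  with assms[of "j - i"] mult_diff[of i j a] show "nmult i a \<noteq> nmult j a"
    by (metis add_0_left add_right_imp_eq order_less_imp_le zero_less_diff)
qed

lemma sum_indicator_card:
  "finite J \<Longrightarrow> (\<Sum>u\<in>J. indicator H (f u) :: real) = card {u\<in>J. f u \<in> H}"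
  by (simp add: indicator_def sum.If_cases Int_def)

text \<open>The pointwise form of the disjointness of the multiples. The sign of \<open>k\<close> in
  \<open>dis\<close> reflects that \<open>nmult j k + y\<close> lies in \<open>H\<close> when
  \<open>y\<close> lies in the translate of \<open>H\<close> by the negative.\<close>

lemma card_multiples_le_1:
  assumes H: "half_tree H" and dis: "(+) (- k) ` H \<inter> H = {}" and tf: "\<And>j. j > 0 \<Longrightarrow> nmult j k \<noteq> 0"
  shows "card {j\<in>{..<N}. nmult j k + y \<in> H} \<le> 1"
proof -
  have "\<not> i < j" if "nmult i k + y \<in> H" "nmult j k + y \<in> H" for i j
  proof
    assume "i < j"
    define z where "z = nmult i k + y"
    have z: "z \<in> H" "nmult (j - i) k + z \<in> H"
      using that \<open>i < j\<close> mult_diff[of i j k] by (auto simp: z_def add.assoc[symmetric])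
    have "(+) (nmult (j - i) (- k)) ` H \<inter> H = {}"
      using \<open>i < j\<close> tf by (intro disjoint_multiples[OF H dis]) (auto simp: mult_uminus)
    moreover have "z \<in> (+) (nmult (j - i) (- k)) ` H"
      using z(2) by (simp only: mult_uminus mem_translate minus_minus)
    ultimately show False using z by blast
  qed
  then show ?thesis by (auto simp: card_le_Suc0_iff_eq intro: linorder_neqE_nat)
qed

lemma commute_uminus: "- a + b = b + - a \<longleftrightarrow> a + b = b + a" for a :: "'b::group_add"
proof
  assume "- a + b = b + - a"
  then have "a + (- a + b) + a = a + (b + - a) + a" by simp
  then show "a + b = b + a" by (simp add: add.assoc del: add_uminus_conv_diff)
next
  assume "a + b = b + a"
  then have "- a + (a + b) + - a = - a + (b + a) + - a" by simp
  then show "- a + b = b + - a" by (simp add: add.assoc del: add_uminus_conv_diff)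
qed

text \<open>Here \<open>e u\<close> plays the role of the mass of \<open>- \<theta> u + H\<close> for a finitely additive probability
  \<open>e\<close>; the assumption \<open>pos\<close> is the positivity of \<open>e\<close>. If \<open>\<theta> a\<close> or \<open>\<theta> b\<close> maps \<open>H\<close> or its
  complement off itself, then the multiples produce many disjoint sets of almost the same
  mass; otherwise \<open>H\<close> is nested with its translates by both, and two products produce disjoint
  subsets of \<open>H\<close> of almost the same mass as \<open>H\<close>.\<close>

lemma dichotomy:
  fixes e :: "'b::group_add \<Rightarrow> real" and \<theta> :: "'b \<Rightarrow> 'a fg"
  assumes H: "half_tree H" and N: "N > 0"
    and add: "\<And>u v. u \<in> U \<Longrightarrow> v \<in> U \<Longrightarrow> \<theta> (u + v) = \<theta> u + \<theta> v" and inj: "inj_on \<theta> U"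
    and U: "0 \<in> U" "a \<in> U" "b \<in> U" "\<And>u v. u \<in> U \<Longrightarrow> v \<in> U \<Longrightarrow> u + v \<in> U" "\<And>u. u \<in> U \<Longrightarrow> - u \<in> U"
    and tfa: "\<And>j. j > 0 \<Longrightarrow> nmult j a \<noteq> 0" and tfb: "\<And>j. j > 0 \<Longrightarrow> nmult j b \<noteq> 0"
    and ne: "a + b \<noteq> b + a"
    and pos: "\<And>J c C. J \<subseteq> probes N a b \<Longrightarrow> (\<And>y. (\<Sum>u\<in>J. c u * indicator H (\<theta> u + y)) \<le> C) \<Longrightarrow>
      (\<Sum>u\<in>J. c u * e u) \<le> C"
    and near: "\<And>u. u \<in> probes N a b \<Longrightarrow> \<bar>e u - e 0\<bar> \<le> \<epsilon>"
  shows "e 0 \<le> 1 / N + 2 * \<epsilon> \<or>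
    (1 - 1 / N - \<epsilon> \<le> e 0 \<and> (\<exists>u\<in>{a, b}. H \<union> (+) (- \<theta> u) ` H = UNIV))"
proof -
  let ?goal = ?thesis
  have \<theta>0: "\<theta> 0 = 0" using add[of 0 0] U(1) by (metis add_0_left add_right_imp_eq)
  have \<theta>m: "\<theta> (- u) = - \<theta> u" if "u \<in> U" for u
    using add[of "- u" u] U(5)[of u] that \<theta>0 by (metis left_minus add_eq_0_iff2 minus_unique minus_minus)
  have multU: "nmult j u \<in> U" "\<theta> (nmult j u) = nmult j (\<theta> u)" if "u \<in> U" for j u
    using that by (induction j) (auto simp: U \<theta>0 add)
  have \<epsilon>0: "\<epsilon> \<ge> 0" using near[of 0] by (simp add: probes_def)
  have one: "?goal \<or> (\<exists>s\<in>{g, - g}. (+) (\<theta> s) ` H \<subseteq> H)"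
    if g: "g \<in> {a, b}" for g
  proof -
    have gU: "g \<in> U" and tf: "\<And>j. j > 0 \<Longrightarrow> nmult j g \<noteq> 0" using g U tfa tfb by auto
    have tf\<theta>: "nmult j (\<theta> g) \<noteq> 0" if "j > 0" for j
      using inj_onD[OF inj _ multU(1)[OF gU] U(1), of j] multU[OF gU] tf[OF that] \<theta>0 by auto
    let ?J = "(\<lambda>j. nmult j g) ` {..<N}"
    have J: "?J \<subseteq> probes N a b" using g by (auto simp: probes_def)
    have injm: "inj_on (\<lambda>j. nmult j g) A" for A by (rule inj_on_subset[OF inj_mult[OF tf] subset_UNIV])
    have sumJ: "(\<Sum>u\<in>?J. f u) = (\<Sum>j<N. f (nmult j g))" for f :: "'b \<Rightarrow> real"
      by (simp add: sum.reindex[OF injm])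
    have nearJ: "\<bar>e (nmult j g) - e 0\<bar> \<le> \<epsilon>" if "j < N" for j
      using that J by (intro near) auto
    consider "(+) (- \<theta> g) ` H \<subseteq> H" | "H \<subseteq> (+) (- \<theta> g) ` H" | "(+) (- \<theta> g) ` H \<inter> H = {}"
      | "(+) (- \<theta> g) ` H \<union> H = UNIV"
      using half_tree_cases[OF half_tree_translate[OF H, of "- \<theta> g"] H] by blast
    then show ?thesis
    proof cases
      case 1
      then show ?thesis using \<theta>m[OF gU] by auto
    next
      case 2
      then have "(+) (\<theta> g) ` H \<subseteq> (+) (\<theta> g) ` (+) (- \<theta> g) ` H" by blast
      then have "(+) (\<theta> g) ` H \<subseteq> H" by (simp only: translate_translate) simp
      then show ?thesis by auto
    next
      case 3
      have "(\<Sum>u\<in>?J. 1 * e u) \<le> 1"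
      proof (rule pos[OF J])
        fix y show "(\<Sum>u\<in>?J. 1 * indicator H (\<theta> u + y)) \<le> (1::real)"
          using card_multiples_le_1[OF H 3 tf\<theta>, of N y]
          by (simp add: sumJ multU(2)[OF gU] sum_indicator_card)
      qed
      moreover have "(\<Sum>j<N. e 0 - \<epsilon>) \<le> (\<Sum>j<N. e (nmult j g))"
      proof (rule sum_mono)
        fix j assume "j \<in> {..<N}"
        with nearJ[of j] show "e 0 - \<epsilon> \<le> e (nmult j g)" by (simp add: abs_le_iff)
      qed
      ultimately have "N * (e 0 - \<epsilon>) \<le> 1" unfolding sumJ by simp
      then have "e 0 - \<epsilon> \<le> 1 / N" using N by (simp add: field_simps)
      then show ?thesis using \<epsilon>0 by auto
    next
      case 4
      \<comment> \<open>Now the complement is moved off itself, so every point lies in all but at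
        most one of the \<open>N\<close> sets; hence the coefficients \<open>- 1\<close>
        below.\<close>
      have dis: "(+) (- \<theta> g) ` (- H) \<inter> (- H) = {}" using 4 by (simp only: translate_Compl) blast
      have "(\<Sum>u\<in>?J. (- 1) * e u) \<le> 1 - real N"
      proof (rule pos[OF J])
        fix y
        have "(\<Sum>j<N. indicator H (nmult j (\<theta> g) + y)) =
            (\<Sum>j<N. 1 - indicator (- H) (nmult j (\<theta> g) + y) :: real)"
          by (intro sum.cong) (auto simp: indicator_def)
        also have "\<dots> \<ge> real N - 1"
          using card_multiples_le_1[OF _ dis tf\<theta>, of N y] H
          by (simp add: sum_subtractf sum_indicator_card)
        finally show "(\<Sum>u\<in>?J. (- 1) * indicator H (\<theta> u + y)) \<le> 1 - real N"
          by (simp add: sumJ multU(2)[OF gU] sum_negf)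
      qed
      moreover have "(\<Sum>j<N. e (nmult j g)) \<le> (\<Sum>j<N. e 0 + \<epsilon>)"
      proof (rule sum_mono)
        fix j assume "j \<in> {..<N}"
        with nearJ[of j] show "e (nmult j g) \<le> e 0 + \<epsilon>" by (simp add: abs_le_iff)
      qed
      ultimately have "real N - 1 \<le> real N * (e 0 + \<epsilon>)" unfolding sumJ by (simp add: sum_negf)
      then have "1 - 1 / N \<le> e 0 + \<epsilon>" using N by (simp add: field_simps)
      then show ?thesis using 4 g by (auto simp: Un_commute)
    qed
  qed
  show ?thesis
  proof (rule ccontr)
    assume neg: "\<not> ?thesis"
    obtain s where s: "s \<in> {a, - a}" "(+) (\<theta> s) ` H \<subseteq> H" using one[of a] neg by blast
    obtain t where t: "t \<in> {b, - b}" "(+) (\<theta> t) ` H \<subseteq> H" using one[of b] neg by blast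
    have sU: "s \<in> U" "t \<in> U" "- s \<in> U" "- t \<in> U" using s t U by auto
    have "s + t \<noteq> t + s"
      using s(1) t(1) ne commute_uminus[of a b] commute_uminus[of b a] commute_uminus[of b "- a"]
      by (auto simp del: add_uminus_conv_diff)
    then have ne': "\<theta> s + \<theta> t \<noteq> \<theta> t + \<theta> s"
      using inj_onD[OF inj, of "s + t" "t + s"] U(4) sU by (auto simp: add)
    note D = nested_translates_disjoint[OF H s(2) t(2) ne']
    \<comment> \<open>Inverses are taken because \<open>e u\<close> stands for the mass of the
      translate by \<open>- \<theta> u\<close>: thus \<open>p\<close> and \<open>q\<close> belong to
      the two disjoint subsets of \<open>H\<close>.\<close>
    define p q where "p = - t + - s" and "q = - s + - t"
    have p: "- \<theta> p = \<theta> s + \<theta> t" and q: "- \<theta> q = \<theta> t + \<theta> s"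
      using sU by (simp_all add: p_def q_def add \<theta>m minus_add del: add_uminus_conv_diff)
    have in_p: "\<theta> p + y \<in> H \<longleftrightarrow> y \<in> (+) (\<theta> s + \<theta> t) ` H"
      and in_q: "\<theta> q + y \<in> H \<longleftrightarrow> y \<in> (+) (\<theta> t + \<theta> s) ` H" for y
      unfolding mem_translate p[symmetric] q[symmetric] by simp_all
    have "- s \<in> {a, - a}" "- t \<in> {b, - b}" using s t by auto
    then have K: "p \<in> probes N a b" "q \<in> probes N a b" "0 \<in> probes N a b"
      unfolding p_def q_def probes_def by blast+
    have neq: "p \<noteq> q" using p q ne' by auto
    have p0: "p \<noteq> 0"
    proof
      assume "p = 0"
      then have "\<theta> s + \<theta> t = 0" using p \<theta>0 by simp
      then show False using ne' by (metis add_eq_0_iff2 minus_unique left_minus right_minus)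
    qed
    have q0: "q \<noteq> 0"
    proof
      assume "q = 0"
      then have "\<theta> t + \<theta> s = 0" using q \<theta>0 by simp
      then show False using ne' by (metis add_eq_0_iff2 minus_unique left_minus right_minus)
    qed
    \<comment> \<open>The test function is the sum of the indicators of the two disjoint subsets
      minus that of \<open>H\<close>. It is nowhere positive, so \<open>e p + e q \<le> e 0\<close>,
      and replacing \<open>e p\<close> and \<open>e q\<close> by \<open>e 0\<close> costs
      \<open>2 * \<epsilon>\<close>.\<close>
    define c where "c u = (if u = 0 then - 1 else 1 :: real)" for u :: 'b
    have "(\<Sum>u\<in>{p, q, 0}. c u * e u) \<le> 0"
    proof (rule pos)
      show "{p, q, 0} \<subseteq> probes N a b" using K by auto
      fix y
      show "(\<Sum>u\<in>{p, q, 0}. c u * indicator H (\<theta> u + y)) \<le> 0"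
      proof -
        have "(\<Sum>u\<in>{p, q, 0}. c u * indicator H (\<theta> u + y)) =
            indicator H (\<theta> p + y) + indicator H (\<theta> q + y) - indicator H y"
        proof -
          have "(\<Sum>u\<in>{p, q, 0}. f u) = f p + (f q + f 0)" for f :: "'b \<Rightarrow> real"
            using neq p0 q0 by simp
          then show ?thesis using p0 q0 by (simp only: c_def \<theta>0) simp
        qed
        moreover have "\<not> (\<theta> p + y \<in> H \<and> \<theta> q + y \<in> H)" "\<theta> p + y \<in> H \<or> \<theta> q + y \<in> H \<Longrightarrow> y \<in> H"
          unfolding in_p in_q using D by blast+
        ultimately show ?thesis by (auto simp: indicator_def)
      qed
    qed
    then have "e p + e q - e 0 \<le> 0" using neq p0 q0 by (simp add: c_def)
    then have "e 0 \<le> 2 * \<epsilon>" using near[OF K(1)] near[OF K(2)] by (simp add: abs_le_iff)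
    then have "e 0 \<le> 1 / N + 2 * \<epsilon>" by (simp add: add_increasing)
    with neg show False by blast
  qed
qed

section \<open>Axes of conjugates and periodicity of words\<close>

lemma prefix_periodic:
  assumes "prefix v (c @ y)" "prefix v y" "c \<noteq> []" "i < length v"
  shows "v ! i = c ! (i mod length c)"
  using \<open>i < length v\<close>
proof (induction i rule: less_induct)
  case (less i)
  show ?case
  proof (cases "i < length c")
    case True
    then show ?thesis using assms(1) less.prems by (metis mod_less nth_append prefix_def)
  next
    case False
    have "v ! i = (c @ y) ! i" using assms(1) less.prems by (metis nth_append prefix_def)
    also have "\<dots> = y ! (i - length c)" using False by (simp add: nth_append)
    also have "\<dots> = v ! (i - length c)"
      using assms(2) less.prems by (auto simp: prefix_def nth_append)
    also have "\<dots> = c ! ((i - length c) mod length c)" using less False assms(3) by (metis diff_less length_greater_0_conv less_imp_diff_less not_less order_less_le_trans)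
    finally show ?thesis using False by (simp add: le_mod_geq)
  qed
qed

text \<open>Geometrically: a half-tree avoiding the unit that meets its translate by a cyclically reduced \<open>c\<close>
  is crossed by the axis of \<open>c\<close>.\<close>

lemma axis_crossing:
  assumes c: "word c \<noteq> []" "hd (word c) \<noteq> flip (last (word c))"
    and D: "prefix v (word D)" "prefix v (word (c + D))"
  shows "\<exists>w\<in>{word c, inv_word (word c)}. \<forall>i<length v. v ! i = w ! (i mod length w)"
proof (cases "v = []")
  case False
  then have D0: "word D \<noteq> []" "word (c + D) \<noteq> []" using D by auto
  have hdv: "hd (word D) = hd v" "hd (word (c + D)) = hd v" using False D by (auto simp: prefix_def)
  show ?thesis
  proof (cases "hd v = flip (last (word c))")
    case False
    then have "reduced (word c @ word D)" using hdv by (simp add: reduced_append)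
    then have "word (c + D) = word c @ word D" by (rule word_plus_reduced)
    with D c(1) show ?thesis by (auto intro!: prefix_periodic)
  next
    case True
    \<comment> \<open>A letter that cancels against the end of \<open>c\<close> cannot cancel
      against the end of \<open>- c\<close>, as \<open>c\<close> is cyclically reduced. So
      \<open>c + D\<close> can be used in place of \<open>D\<close>, and \<open>- c\<close> in place
      of \<open>c\<close>.\<close>
    then have "hd (word (c + D)) \<noteq> flip (last (word (- c)))"
      using c hdv by (simp add: word_uminus last_inv_word)
    then have "reduced (word (- c) @ word (c + D))" by (simp add: reduced_append)
    then have "word (- c + (c + D)) = word (- c) @ word (c + D)" by (rule word_plus_reduced)
    then have "word D = inv_word (word c) @ word (c + D)"
      by (simp add: word_uminus add.assoc[symmetric])
    then have "\<forall>i<length v. v ! i = inv_word (word c) ! (i mod length (inv_word (word c)))"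
      using D c(1) by (auto intro!: prefix_periodic simp del: length_inv_word)
    then show ?thesis by blast
  qed
qed auto

lemma longest_common_prefix_split:
  assumes "\<not> prefix w a"
  shows "\<exists>p w' a'. w = p @ w' \<and> a = p @ a' \<and> w' \<noteq> [] \<and> (a' = [] \<or> hd a' \<noteq> hd w')"
  using assms
proof (induction w arbitrary: a)
  case (Cons x w)
  show ?case
  proof (cases "a \<noteq> [] \<and> hd a = x")
    case True
    then have "\<not> prefix w (tl a)" using Cons.prems by (cases a) auto
    from Cons.IH[OF this] obtain p w' a' where
      *: "w = p @ w'" "tl a = p @ a'" "w' \<noteq> []" "a' = [] \<or> hd a' \<noteq> hd w'" by blast
    then have "x # w = (x # p) @ w'" "a = (x # p) @ a'" using True by (auto simp: neq_Nil_conv)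
    then show ?thesis using * by blast
  next
    case False
    then show ?thesis by (intro exI[of _ "[]"] exI[of _ "x # w"] exI[of _ a]) auto
  qed
qed simp

lemma word_left_translate:
  assumes "word a = p @ a'" "word y = p @ y'" "y' \<noteq> []" "a' = [] \<or> hd a' \<noteq> hd y'"
  shows "word (- a + y) = inv_word a' @ y'"
proof -
  have r: "reduced a'" "reduced y'" using assms(1,2) reduced_word[of a] reduced_word[of y]
    by (auto simp: reduced_append)
  have "a = of_word p + of_word a'" "y = of_word p + of_word y'"
    by (metis assms(1,2) of_word_append of_word_word)+
  then have "- a + y = of_word (inv_word a' @ y')"
    by (simp add: of_word_append of_word_inv_word minus_add add.assoc del: add_uminus_conv_diff)
  moreover have "reduced (inv_word a' @ y')"
    using r assms(3,4) by (auto simp: reduced_append last_inv_word)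
  ultimately show ?thesis by (simp add: word_of_word)
qed

text \<open>Translation by \<open>- a\<close> turns the conjugate into \<open>c\<close> itself.
  Since \<open>a\<close> is outside \<open>cyl u\<close>, the path from \<open>a\<close> into
  \<open>cyl (u @ v)\<close> still ends with all of \<open>v\<close>, and
  \<open>axis_crossing\<close> applies to it; the phase \<open>s\<close> is the length of the path
  before \<open>v\<close>.\<close>

lemma conjugate_crossing:
  assumes c: "word c \<noteq> []" "hd (word c) \<noteq> flip (last (word c))"
    and a: "a \<notin> cyl u"
    and y: "y \<in> cyl (u @ v)" "a + c - a + y \<in> cyl (u @ v)"
  shows "\<exists>w\<in>{word c, inv_word (word c)}. \<exists>s. \<forall>i<length v. v ! i = w ! ((s + i) mod length w)"
proof -
  obtain p u' a' where *: "u = p @ u'" "word a = p @ a'" "u' \<noteq> []" "a' = [] \<or> hd a' \<noteq> hd u'"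
    using longest_common_prefix_split[of u "word a"] a by (auto simp: cyl_def)
  have tr: "prefix (inv_word a' @ u' @ v) (word (- a + x))" if "x \<in> cyl (u @ v)" for x
  proof -
    obtain z where "word x = p @ u' @ v @ z" using \<open>x \<in> cyl (u @ v)\<close> * by (auto simp: cyl_def prefix_def)
    from word_left_translate[OF *(2) this] * show ?thesis by (simp add: prefix_def)
  qed
  define D where "D = - a + y"
  have "- a + (a + c - a + y) = c + D"
    by (simp add: D_def add.assoc[symmetric] del: add_uminus_conv_diff
        flip: add_uminus_conv_diff)
  then have "prefix (inv_word a' @ u' @ v) (word (c + D))" using tr[OF y(2)] by simp
  moreover have "prefix (inv_word a' @ u' @ v) (word D)" using tr[OF y(1)] by (simp add: D_def)
  ultimately obtain w where w: "w \<in> {word c, inv_word (word c)}"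
    "\<forall>i<length (inv_word a' @ u' @ v). (inv_word a' @ u' @ v) ! i = w ! (i mod length w)"
    using axis_crossing[OF c] by metis
  let ?s = "length (inv_word a' @ u')"
  have "v ! i = w ! ((?s + i) mod length w)" if "i < length v" for i
    using w(2)[rule_format, of "?s + i"] that by (simp add: nth_append)
  with w(1) show ?thesis by blast
qed

section \<open>Random walks and harmonic functions\<close>

lemma expectation_bind_pmf:
  fixes f :: "'a \<Rightarrow> real"
  assumes f: "\<And>x. 0 \<le> f x" "\<And>x. f x \<le> 1"
  shows "measure_pmf.expectation (bind_pmf M N) f =
    measure_pmf.expectation M (\<lambda>x. measure_pmf.expectation (N x) f)"
proof -
  have int: "integrable (measure_pmf p) f" for p
    by (rule measure_pmf.integrable_const_bound[where B = 1]) (use f in auto)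
  have nn: "(\<integral>\<^sup>+x. f x \<partial>measure_pmf p) = ennreal (measure_pmf.expectation p f)" for p
    by (rule nn_integral_eq_integral[OF int]) (use f in auto)
  have e0: "0 \<le> measure_pmf.expectation p f" for p
    by (rule integral_nonneg_AE) (use f in auto)
  have e1: "measure_pmf.expectation p f \<le> 1" for p
    using integral_mono[OF int, of p "\<lambda>_. 1"] f by simp
  have "ennreal (measure_pmf.expectation (bind_pmf M N) f) =
      (\<integral>\<^sup>+x. ennreal (measure_pmf.expectation (N x) f) \<partial>measure_pmf M)"
    by (simp only: nn[symmetric] nn_integral_bind_pmf)
  also have "\<dots> = ennreal (measure_pmf.expectation M (\<lambda>x. measure_pmf.expectation (N x) f))"
    by (rule nn_integral_eq_integral)
      (auto intro!: measure_pmf.integrable_const_bound[where B = 1] simp: e0 e1)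
  finally show ?thesis
    by (subst (asm) ennreal_inj) (auto intro!: integral_nonneg_AE simp: e0)
qed

locale group_walk = group G for G :: "('g, 'm) monoid_scheme" (structure) +
  fixes \<mu> :: "'g pmf" and M :: "(nat \<Rightarrow> 'g) measure"
  assumes cnt: "countable (carrier G)" and supp: "set_pmf \<mu> \<subseteq> carrier G"
    and nondeg: "nondegenerate G \<mu>" and walk: "random_walk_measure G \<mu> M"
begin

sublocale prob_space M
  using walk by (simp add: random_walk_measure_def markov_measure_def)

lemma sets_M: "sets M = sets (\<Pi>\<^sub>M i\<in>UNIV. count_space (carrier G))"
  using walk by (simp add: random_walk_measure_def markov_measure_def)

lemma space_M: "space M = (UNIV \<rightarrow> carrier G)"
  using sets_eq_imp_space_eq[OF sets_M] by (simp add: space_PiM PiE_UNIV_domain)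

lemma measurable_step: "(\<lambda>\<tau>. \<tau> i) \<in> measurable M (count_space (carrier G))"
  unfolding measurable_cong_sets[OF sets_M HOL.refl] by (rule measurable_component_singleton) simp

lemma measurable_step_fun: "(\<lambda>\<tau>. f (\<tau> i)) \<in> measurable M (count_space UNIV)"
  by (rule measurable_compose[OF measurable_step]) simp

text \<open>The measure \<open>M\<close> is only specified on cylinders; these discrete laws of
  initial segments carry the computations instead.\<close>

primrec paths :: "nat \<Rightarrow> 'g list pmf" where
  "paths 0 = return_pmf [\<one>]"
| "paths (Suc k) = bind_pmf (paths k) (\<lambda>l. map_pmf (\<lambda>x. l @ [last l \<otimes> x]) \<mu>)"

lemma paths_lists:
  "l \<in> set_pmf (paths k) \<Longrightarrow> length l = Suc k \<and> set l \<subseteq> carrier G"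
proof (induction k arbitrary: l)
  case (Suc k)
  then obtain l' x where l: "l' \<in> set_pmf (paths k)" "x \<in> set_pmf \<mu>" "l = l' @ [last l' \<otimes> x]" by auto
  then have "length l' = Suc k" "set l' \<subseteq> carrier G" using Suc.IH by auto
  moreover from this have "last l' \<in> carrier G"
    by (metis last_in_set length_0_conv nat.distinct(1) subsetD)
  ultimately show ?case using l supp by auto
qed simp

lemma pmf_paths:
  assumes "length l = Suc k" "set l \<subseteq> carrier G"
  shows "pmf (paths k) l = (if l ! 0 = \<one> then \<Prod>i<k. pmf \<mu> (inv (l ! i) \<otimes> l ! Suc i) else 0)"
  using assms
proof (induction k arbitrary: l)
  case 0
  then show ?case by (cases l) auto
next
  case (Suc k)
  obtain l' h where l: "l = l' @ [h]" "length l' = Suc k" "set l' \<subseteq> carrier G" "h \<in> carrier G"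
    using Suc.prems by (cases l rule: rev_cases) auto
  have "l' \<noteq> []" using l by auto
  then have lc: "last l' \<in> carrier G" "last l' = l' ! k"
    using l last_in_set[of l'] by (auto simp: last_conv_nth)
  have *: "pmf (map_pmf (\<lambda>x. l'' @ [last l'' \<otimes> x]) \<mu>) l =
      indicator {l'} l'' * pmf \<mu> (inv (last l') \<otimes> h)" for l''
  proof (cases "l'' = l'")
    case True
    have "pmf (map_pmf (\<lambda>x. l' @ [last l' \<otimes> x]) \<mu>) l = measure (measure_pmf \<mu>) {x. last l' \<otimes> x = h}"
      by (simp add: pmf_map l vimage_def)
    also have "\<dots> = measure (measure_pmf \<mu>) {inv (last l') \<otimes> h}"
    proof (intro measure_pmf.finite_measure_eq_AE, unfold AE_measure_pmf_iff, intro ballI)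
      fix x assume "x \<in> set_pmf \<mu>"
      then have "x \<in> carrier G" using supp by auto
      then have "last l' \<otimes> x = h \<longleftrightarrow> x = inv (last l') \<otimes> h"
        using inv_solve_left[OF _ lc(1) l(4), of x] by auto
      then show "x \<in> {x. last l' \<otimes> x = h} \<longleftrightarrow> x \<in> {inv (last l') \<otimes> h}" by simp
    qed auto
    finally show ?thesis using True by (simp add: measure_pmf_single)
  next
    case False
    then show ?thesis by (simp add: pmf_map l vimage_def)
  qed
  have "pmf (paths (Suc k)) l =
      measure_pmf.expectation (paths k) (\<lambda>l''. indicator {l'} l'' * pmf \<mu> (inv (last l') \<otimes> h))"
    by (simp only: paths.simps pmf_bind *)
  also have "\<dots> = pmf (paths k) l' * pmf \<mu> (inv (last l') \<otimes> h)"
    by (simp add: measure_pmf_single)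
  also have "\<dots> = (if l ! 0 = \<one> then \<Prod>i<Suc k. pmf \<mu> (inv (l ! i) \<otimes> l ! Suc i) else 0)"
    using Suc.IH[OF l(2,3)] l(1,2) by (simp add: nth_append lc(2))
  finally show ?case .
qed

lemma path_cylinder:
  "length l = Suc k \<Longrightarrow>
    (\<lambda>\<tau>. map \<tau> [0..<Suc k]) -` {l} \<inter> space M = {\<tau>\<in>space M. \<forall>i\<le>k. \<tau> i = l ! i}"
proof -
  assume "length l = Suc k"
  then have "map \<tau> [0..<Suc k] = l \<longleftrightarrow> (\<forall>i\<le>k. \<tau> i = l ! i)" for \<tau>
    by (auto simp: list_eq_iff_nth_eq less_Suc_eq_le simp del: upt_Suc)
  then show ?thesis by blast
qed

lemma countable_paths: "countable {l. set l \<subseteq> carrier G \<and> length l = k}"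
  by (rule countable_subset[OF _ countable_lists[OF cnt]]) (auto simp: lists_eq_set)

lemma path_mem: "\<tau> \<in> space M \<Longrightarrow> map \<tau> [0..<k] \<in> {l. set l \<subseteq> carrier G \<and> length l = k}"
  by (auto simp: space_M Pi_iff)

lemma measurable_path: "(\<lambda>\<tau>. map \<tau> [0..<Suc k]) \<in> measurable M (count_space UNIV)"
proof (rule measurable_compose)
  let ?L = "{l. set l \<subseteq> carrier G \<and> length l = Suc k}"
  have 1: "{\<tau>\<in>space M. \<tau> i = g} \<in> sets M" for g i
    using measurable_sets[OF measurable_step_fun[of id i], of "{g}"]
    by (auto simp: vimage_def Int_def conj_commute)
  have 2: "(\<lambda>\<tau>. map \<tau> [0..<Suc k]) -` {l} \<inter> space M \<in> sets M" if l: "l \<in> ?L" for l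
  proof -
    have "length l = Suc k" using l by simp
    from path_cylinder[OF this]
    have "(\<lambda>\<tau>. map \<tau> [0..<Suc k]) -` {l} \<inter> space M = (\<Inter>i\<in>{..k}. {\<tau>\<in>space M. \<tau> i = l ! i})"
      by (rule HOL.trans) auto
    moreover have "(\<Inter>i\<in>{..k}. {\<tau>\<in>space M. \<tau> i = l ! i}) \<in> sets M"
      using 1 by (intro sets.finite_INT) auto
    ultimately show ?thesis by (simp only:)
  qed
  show "(\<lambda>\<tau>. map \<tau> [0..<Suc k]) \<in> measurable M (count_space ?L)"
    unfolding measurable_count_space_eq_countable[OF countable_paths]
  proof (intro conjI ballI Pi_I)
    show "map \<tau> [0..<Suc k] \<in> ?L" if "\<tau> \<in> space M" for \<tau> using that by (rule path_mem)
  qed (rule 2)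
qed simp

text \<open>There are countably many segments of a given length, so agreement on single segments,
  which are cylinders of \<open>M\<close>, identifies the image measure.\<close>

lemma distr_path:
  "distr M (count_space UNIV) (\<lambda>\<tau>. map \<tau> [0..<Suc k]) = measure_pmf (paths k)"
proof -
  let ?L = "{l. set l \<subseteq> carrier G \<and> length l = Suc k}"
  let ?f = "\<lambda>\<tau>::nat \<Rightarrow> 'g. map \<tau> [0..<Suc k]"
  show ?thesis
  proof (rule measure_eqI_countable_AE[of _ _ ?L])
    show "AE x in distr M (count_space UNIV) ?f. x \<in> ?L"
      using path_mem by (subst AE_distr_iff[OF measurable_path]) (simp_all del: upt_Suc)
    show "AE x in measure_pmf (paths k). x \<in> ?L"
      using paths_lists by (auto simp: AE_measure_pmf_iff)
    fix l assume l: "l \<in> ?L"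
    have "emeasure (distr M (count_space UNIV) ?f) {l} = emeasure M {\<tau>\<in>space M. \<forall>i\<le>k. \<tau> i = l ! i}"
      using l by (subst emeasure_distr[OF measurable_path]) (simp_all add: path_cylinder del: upt_Suc)
    also have "\<dots> = ennreal (pmf (paths k) l)"
    proof -
      have "(\<lambda>i. l ! i) \<in> {..k} \<rightarrow> carrier G" using l by (auto simp: less_Suc_eq_le intro: nth_mem)
      then have "measure M {\<tau>\<in>space M. \<forall>i\<le>k. \<tau> i = l ! i} =
          (if l ! 0 = \<one> then \<Prod>i<k. pmf \<mu> (inv (l ! i) \<otimes> l ! Suc i) else 0)"
        using walk unfolding random_walk_measure_def markov_measure_def by blast
      then show ?thesis using pmf_paths l by (simp add: emeasure_eq_measure)
    qed
    finally show "emeasure (distr M (count_space UNIV) ?f) {l} = emeasure (measure_pmf (paths k)) {l}"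
      by (simp add: emeasure_pmf_single)
  qed (use countable_paths in auto)
qed

definition step_law :: "nat \<Rightarrow> 'g pmf" where
  "step_law k = map_pmf last (paths k)"

lemma step_law_0: "step_law 0 = return_pmf \<one>"
  by (simp add: step_law_def)

lemma step_law_Suc: "step_law (Suc k) = bind_pmf (step_law k) (\<lambda>g. map_pmf (\<lambda>x. g \<otimes> x) \<mu>)"
  by (simp add: step_law_def map_bind_pmf bind_map_pmf map_pmf_comp)

lemma step_law_carrier: "set_pmf (step_law k) \<subseteq> carrier G"
proof
  fix g assume "g \<in> set_pmf (step_law k)"
  then obtain l where l: "l \<in> set_pmf (paths k)" "g = last l" by (auto simp: step_law_def)
  then show "g \<in> carrier G" using paths_lists[OF l(1)]
    by (metis last_in_set length_0_conv nat.distinct(1) subsetD)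
qed

lemma nn_integral_steps:
  fixes f :: "'g \<Rightarrow> 'g \<Rightarrow> ennreal"
  shows "(\<integral>\<^sup>+\<tau>. f (\<tau> k) (\<tau> (Suc k)) \<partial>M) = (\<integral>\<^sup>+g. (\<integral>\<^sup>+x. f g (g \<otimes> x) \<partial>\<mu>) \<partial>step_law k)"
proof -
  let ?f = "\<lambda>\<tau>::nat \<Rightarrow> 'g. map \<tau> [0..<Suc (Suc k)]"
  have "(\<integral>\<^sup>+\<tau>. f (\<tau> k) (\<tau> (Suc k)) \<partial>M) = (\<integral>\<^sup>+l. f (l ! k) (l ! Suc k) \<partial>distr M (count_space UNIV) ?f)"
    by (subst nn_integral_distr[OF measurable_path]) (auto simp: nth_append)
  also have "\<dots> = (\<integral>\<^sup>+l. (\<integral>\<^sup>+x. f ((l @ [last l \<otimes> x]) ! k) ((l @ [last l \<otimes> x]) ! Suc k) \<partial>\<mu>) \<partial>paths k)"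
    by (simp add: distr_path del: upt_Suc)
  also have "\<dots> = (\<integral>\<^sup>+l. (\<integral>\<^sup>+x. f (last l) (last l \<otimes> x) \<partial>\<mu>) \<partial>paths k)"
  proof (rule nn_integral_cong_AE, unfold AE_measure_pmf_iff, intro ballI)
    fix l assume "l \<in> set_pmf (paths k)"
    then have "length l = Suc k" using paths_lists by blast
    then have "l \<noteq> []" by auto
    with \<open>length l = Suc k\<close> have "l ! k = last l" by (simp add: last_conv_nth)
    then show "(\<integral>\<^sup>+x. f ((l @ [last l \<otimes> x]) ! k) ((l @ [last l \<otimes> x]) ! Suc k) \<partial>\<mu>) =
        (\<integral>\<^sup>+x. f (last l) (last l \<otimes> x) \<partial>\<mu>)" using \<open>length l = Suc k\<close> by (simp add: nth_append)
  qed
  finally show ?thesis by (simp add: step_law_def)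
qed

lemma nn_integral_step:
  fixes f :: "'g \<Rightarrow> ennreal"
  shows "(\<integral>\<^sup>+\<tau>. f (\<tau> k) \<partial>M) = (\<integral>\<^sup>+g. f g \<partial>step_law k)"
  using nn_integral_steps[of "\<lambda>g _. f g" k] by (simp add: measure_pmf.emeasure_space_1)

lemma nn_integral_step_law_Suc:
  fixes f :: "'g \<Rightarrow> ennreal"
  shows "(\<integral>\<^sup>+g. f g \<partial>step_law (Suc k)) = (\<integral>\<^sup>+g. (\<integral>\<^sup>+x. f (g \<otimes> x) \<partial>\<mu>) \<partial>step_law k)"
  by (simp add: step_law_Suc)

text \<open>Splitting off the first increment instead of the last. This form makes the averaged step
  laws almost stationary under left translation by a \<mu>-distributed element.\<close>

lemma step_law_Suc': "step_law (Suc k) = bind_pmf \<mu> (\<lambda>x. map_pmf (\<lambda>g. x \<otimes> g) (step_law k))"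
proof (induction k)
  case 0
  have "map_pmf (\<lambda>x. \<one> \<otimes> x) \<mu> = map_pmf (\<lambda>x. x \<otimes> \<one>) \<mu>"
    using supp by (intro map_pmf_cong) auto
  then show ?case by (simp add: step_law_Suc step_law_0 bind_return_pmf map_pmf_def)
next
  case (Suc k)
  have "step_law (Suc (Suc k)) =
      bind_pmf \<mu> (\<lambda>x. bind_pmf (step_law k) (\<lambda>g. map_pmf (\<lambda>y. (x \<otimes> g) \<otimes> y) \<mu>))"
    by (subst step_law_Suc, subst Suc) (simp add: bind_assoc_pmf bind_map_pmf)
  also have "\<dots> = bind_pmf \<mu> (\<lambda>x. bind_pmf (step_law k) (\<lambda>g. map_pmf (\<lambda>y. x \<otimes> (g \<otimes> y)) \<mu>))"
    using supp step_law_carrier by (intro bind_pmf_cong map_pmf_cong HOL.refl m_assoc) auto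
  also have "\<dots> = bind_pmf \<mu> (\<lambda>x. map_pmf (\<lambda>g. x \<otimes> g) (step_law (Suc k)))"
    by (simp add: step_law_Suc map_bind_pmf map_pmf_comp)
  finally show ?case .
qed

end

section \<open>Harmonic functions and their square summable increments\<close>

context group_walk
begin

text \<open>The bounds also hold outside the carrier, so integrability against a \<open>pmf\<close>
  never depends on its support.\<close>

definition harmonic :: "('g \<Rightarrow> real) \<Rightarrow> bool" where
  "harmonic u \<longleftrightarrow> (\<forall>g. 0 \<le> u g \<and> u g \<le> 1) \<and>
     (\<forall>g\<in>carrier G. u g = measure_pmf.expectation \<mu> (\<lambda>x. u (g \<otimes> x)))"

lemma harmonic_bounds: "harmonic u \<Longrightarrow> 0 \<le> u g" "harmonic u \<Longrightarrow> u g \<le> 1"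
  by (simp_all add: harmonic_def)

lemma harmonic_expectation:
  assumes "harmonic u"
  shows "measure_pmf.expectation (step_law k) u = u \<one>"
proof (induction k)
  case (Suc k)
  have "measure_pmf.expectation (step_law (Suc k)) u =
      measure_pmf.expectation (step_law k) (\<lambda>g. measure_pmf.expectation \<mu> (\<lambda>x. u (g \<otimes> x)))"
    using assms by (simp add: step_law_Suc expectation_bind_pmf harmonic_def)
  also have "\<dots> = measure_pmf.expectation (step_law k) u"
    using assms step_law_carrier[of k]
    by (intro integral_cong_AE) (auto simp: AE_measure_pmf_iff harmonic_def)
  finally show ?case using Suc by simp
qed (simp add: step_law_0)

lemma borel_measurable_step: "(\<lambda>\<tau>. f (\<tau> k) :: real) \<in> borel_measurable M"
  using measurable_compose[OF measurable_step_fun[of "\<lambda>g. g" k], of f borel] by simp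

lemma expectation_step:
  fixes f :: "'g \<Rightarrow> real"
  assumes "\<And>g. 0 \<le> f g" "\<And>g. f g \<le> 1"
  shows "expectation (\<lambda>\<tau>. f (\<tau> k)) = measure_pmf.expectation (step_law k) f"
proof -
  have "expectation (\<lambda>\<tau>. f (\<tau> k)) = enn2real (\<integral>\<^sup>+\<tau>. f (\<tau> k) \<partial>M)"
    using assms borel_measurable_step by (intro integral_eq_nn_integral) auto
  also have "\<dots> = enn2real (\<integral>\<^sup>+g. f g \<partial>step_law k)" by (simp only: nn_integral_step[of "\<lambda>g. ennreal (f g)" k])
  also have "\<dots> = measure_pmf.expectation (step_law k) f"
    using assms by (intro integral_eq_nn_integral[symmetric]) auto
  finally show ?thesis .
qed

text \<open>The conditional variance of the next increment of the martingale
  \<open>u (\<tau> k)\<close> when the walk is at \<open>g\<close>.\<close>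

definition energy :: "('g \<Rightarrow> real) \<Rightarrow> 'g \<Rightarrow> ennreal" where
  "energy u g = (\<integral>\<^sup>+x. ennreal ((u (g \<otimes> x) - u g)\<^sup>2) \<partial>\<mu>)"

text \<open>Second moment equals squared mean plus variance; harmonicity says that the mean is
  \<open>u g\<close>.\<close>

lemma energy_eq:
  assumes u: "harmonic u" and g: "g \<in> carrier G"
  shows "(\<integral>\<^sup>+x. ennreal ((u (g \<otimes> x))\<^sup>2) \<partial>\<mu>) = ennreal ((u g)\<^sup>2) + energy u g"
proof -
  note b = harmonic_bounds[OF u]
  have int: "integrable (measure_pmf \<mu>) f" if "\<And>x. \<bar>f x\<bar> \<le> 1" for f :: "'g \<Rightarrow> real"
    by (rule measure_pmf.integrable_const_bound[where B = 1]) (use that in auto)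
  have sq: "\<bar>(u h)\<^sup>2\<bar> \<le> 1" "\<bar>(u h - u g)\<^sup>2\<bar> \<le> 1" "\<bar>u h\<bar> \<le> 1" for h
    using b[of h] b[of g] by (auto simp: abs_square_le_1 abs_le_iff power_le_one)
  have ints: "integrable (measure_pmf \<mu>) (\<lambda>x. (u (g \<otimes> x))\<^sup>2)"
    "integrable (measure_pmf \<mu>) (\<lambda>x. (u (g \<otimes> x) - u g)\<^sup>2)" "integrable (measure_pmf \<mu>) (\<lambda>x. u (g \<otimes> x))"
    by (rule int, rule sq)+
  have ug: "measure_pmf.expectation \<mu> (\<lambda>x. u (g \<otimes> x)) = u g" using u g by (simp add: harmonic_def)
  have "measure_pmf.expectation \<mu> (\<lambda>x. (u (g \<otimes> x) - u g)\<^sup>2) =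
      measure_pmf.expectation \<mu> (\<lambda>x. (u (g \<otimes> x))\<^sup>2 - 2 * u g * u (g \<otimes> x) + (u g)\<^sup>2)"
    by (simp add: power2_diff algebra_simps)
  also have "\<dots> = measure_pmf.expectation \<mu> (\<lambda>x. (u (g \<otimes> x))\<^sup>2) - (u g)\<^sup>2"
    using ints by (simp add: ug power2_eq_square)
  finally have "measure_pmf.expectation \<mu> (\<lambda>x. (u (g \<otimes> x))\<^sup>2) =
      (u g)\<^sup>2 + measure_pmf.expectation \<mu> (\<lambda>x. (u (g \<otimes> x) - u g)\<^sup>2)" by simp
  then show ?thesis
    unfolding energy_def using ints
    by (simp add: nn_integral_eq_integral ennreal_plus[symmetric] integral_nonneg_AE del: ennreal_plus)
qed

text \<open>By \<open>energy_eq\<close> the partial sums telescope to differences of second moments,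
  all of which are at most 1.\<close>

lemma energy_sum_le_1:
  assumes u: "harmonic u"
  shows "(\<Sum>k. \<integral>\<^sup>+g. energy u g \<partial>step_law k) \<le> 1"
proof (rule suminf_le_const)
  fix n
  have "(\<integral>\<^sup>+g. ennreal ((u g)\<^sup>2) \<partial>step_law n) =
      ennreal ((u \<one>)\<^sup>2) + (\<Sum>k<n. \<integral>\<^sup>+g. energy u g \<partial>step_law k)"
  proof (induction n)
    case (Suc n)
    have "(\<integral>\<^sup>+g. ennreal ((u g)\<^sup>2) \<partial>step_law (Suc n)) =
        (\<integral>\<^sup>+g. ennreal ((u g)\<^sup>2) + energy u g \<partial>step_law n)"
      unfolding nn_integral_step_law_Suc using step_law_carrier[of n]
      by (intro nn_integral_cong_AE) (auto simp: AE_measure_pmf_iff energy_eq[OF u])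
    then show ?case using Suc by (simp add: nn_integral_add add.assoc)
  qed (simp add: step_law_0)
  then have "(\<Sum>k<n. \<integral>\<^sup>+g. energy u g \<partial>step_law k) \<le> (\<integral>\<^sup>+g. ennreal ((u g)\<^sup>2) \<partial>step_law n)" by simp
  also have "(\<integral>\<^sup>+g. ennreal ((u g)\<^sup>2) \<partial>step_law n) \<le> (\<integral>\<^sup>+g. 1 \<partial>step_law n)"
    using harmonic_bounds[OF u] by (intro nn_integral_mono) (auto simp: power_le_one ennreal_le_1)
  finally show "(\<Sum>k<n. \<integral>\<^sup>+g. energy u g \<partial>step_law k) \<le> 1"
    by (simp add: measure_pmf.emeasure_space_1)
qed simp

text \<open>For \<open>x\<close> in the support, moving by \<open>x\<close> is one of the possible
  next steps, at the price of the factor \<open>1 / pmf \<mu> x\<close>; for products the constants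
  multiply and the delays add. This controls increments that start from a shifted position
  \<open>g \<otimes> x\<close>.\<close>

lemma shift_dominated:
  assumes "x \<in> carrier G"
  shows "\<exists>C m. C < \<top> \<and> (\<forall>k. \<forall>f::'g \<Rightarrow> ennreal.
    (\<integral>\<^sup>+g. f (g \<otimes> x) \<partial>step_law k) \<le> C * (\<integral>\<^sup>+g. f g \<partial>step_law (k + m)))"
proof -
  have "x \<in> semigroup_span G (set_pmf \<mu>)" using assms nondeg by (simp add: nondegenerate_def)
  then show ?thesis
  proof induction
    case (incl x)
    then have px: "pmf \<mu> x > 0" by (simp add: pmf_positive)
    have "(\<integral>\<^sup>+g. f (g \<otimes> x) \<partial>step_law k) \<le> ennreal (1 / pmf \<mu> x) * (\<integral>\<^sup>+g. f g \<partial>step_law (k + 1))"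
      for k and f :: "'g \<Rightarrow> ennreal"
    proof -
      have "f (g \<otimes> x) * ennreal (pmf \<mu> x) \<le> (\<integral>\<^sup>+y. f (g \<otimes> y) \<partial>\<mu>)" for g
      proof -
        have "(\<integral>\<^sup>+y. f (g \<otimes> x) * indicator {x} y \<partial>\<mu>) \<le> (\<integral>\<^sup>+y. f (g \<otimes> y) \<partial>\<mu>)"
          by (intro nn_integral_mono) (auto simp: indicator_def)
        then show ?thesis by (simp add: nn_integral_cmult_indicator emeasure_pmf_single)
      qed
      then have "(\<integral>\<^sup>+g. f (g \<otimes> x) * ennreal (pmf \<mu> x) \<partial>step_law k) \<le> (\<integral>\<^sup>+g. f g \<partial>step_law (k + 1))"
        by (simp add: nn_integral_step_law_Suc nn_integral_mono del: nn_integral_const)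
      then have "ennreal (1 / pmf \<mu> x) * ((\<integral>\<^sup>+g. f (g \<otimes> x) \<partial>step_law k) * ennreal (pmf \<mu> x)) \<le>
          ennreal (1 / pmf \<mu> x) * (\<integral>\<^sup>+g. f g \<partial>step_law (k + 1))"
        by (intro mult_left_mono) (simp_all add: nn_integral_multc)
      moreover have "ennreal (1 / pmf \<mu> x) * (c * ennreal (pmf \<mu> x)) = c" for c
      proof -
        have "ennreal (1 / pmf \<mu> x) * ennreal (pmf \<mu> x) = 1"
          using px by (simp add: ennreal_mult[symmetric])
        then show ?thesis by (metis mult.commute mult.left_commute mult.right_neutral)
      qed
      ultimately show ?thesis by simp
    qed
    then show ?case by (intro exI[of _ "ennreal (1 / pmf \<mu> x)"] exI[of _ 1]) auto
  next
    case (mult x y)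
    have c: "x \<in> carrier G" "y \<in> carrier G" using mult.hyps nondeg by (simp_all add: nondegenerate_def)
    obtain C m where x: "C < \<top>" "\<And>k (f::'g \<Rightarrow> ennreal).
        (\<integral>\<^sup>+g. f (g \<otimes> x) \<partial>step_law k) \<le> C * (\<integral>\<^sup>+g. f g \<partial>step_law (k + m))" using mult.IH(1) by blast
    obtain D l where y: "D < \<top>" "\<And>k (f::'g \<Rightarrow> ennreal).
        (\<integral>\<^sup>+g. f (g \<otimes> y) \<partial>step_law k) \<le> D * (\<integral>\<^sup>+g. f g \<partial>step_law (k + l))" using mult.IH(2) by blast
    have "(\<integral>\<^sup>+g. f (g \<otimes> (x \<otimes> y)) \<partial>step_law k) \<le> C * D * (\<integral>\<^sup>+g. f g \<partial>step_law (k + (m + l)))"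
      for k and f :: "'g \<Rightarrow> ennreal"
    proof -
      have "(\<integral>\<^sup>+g. f (g \<otimes> (x \<otimes> y)) \<partial>step_law k) = (\<integral>\<^sup>+g. f (g \<otimes> x \<otimes> y) \<partial>step_law k)"
        using step_law_carrier[of k] c
        by (intro nn_integral_cong_AE) (auto simp: AE_measure_pmf_iff m_assoc subset_iff)
      also have "\<dots> \<le> C * (\<integral>\<^sup>+g. f (g \<otimes> y) \<partial>step_law (k + m))" by (rule x(2))
      also have "\<dots> \<le> C * (D * (\<integral>\<^sup>+g. f g \<partial>step_law (k + m + l)))" by (intro mult_left_mono y(2)) simp
      finally show ?thesis by (simp add: mult.assoc add.assoc)
    qed
    moreover have "C * D < \<top>" using x(1) y(1) by (simp add: ennreal_mult_less_top)
    ultimately show ?case by blast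
  qed
qed

lemma sum_shift_le:
  fixes F :: "nat \<Rightarrow> ennreal"
  shows "(\<Sum>k. F (k + m)) \<le> (\<Sum>k. F k)"
proof -
  have "(\<Sum>k. F k) = (\<Sum>k. F (k + m)) + (\<Sum>k<m. F k)" by (rule suminf_offset) simp
  then show ?thesis by simp
qed

text \<open>For \<open>x\<close> in the support the squared increment is at most
  \<open>energy u g\<close> divided by \<open>pmf \<mu> x\<close>. For a product the increment is
  cut at the intermediate position, whose law is handled by \<open>shift_dominated\<close>.
  Nondegeneracy makes this reach every group element.\<close>

lemma increments_summable:
  assumes u: "harmonic u" and "x \<in> carrier G"
  shows "(\<Sum>k. \<integral>\<^sup>+g. ennreal ((u (g \<otimes> x) - u g)\<^sup>2) \<partial>step_law k) < \<top>"
proof -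
  have "x \<in> semigroup_span G (set_pmf \<mu>)" using assms nondeg by (simp add: nondegenerate_def)
  then show ?thesis
  proof induction
    case (incl x)
    then have px: "pmf \<mu> x > 0" by (simp add: pmf_positive)
    have le: "ennreal ((u (g \<otimes> x) - u g)\<^sup>2) \<le> ennreal (1 / pmf \<mu> x) * energy u g" for g
    proof -
      have "(\<integral>\<^sup>+y. ennreal ((u (g \<otimes> x) - u g)\<^sup>2) * indicator {x} y \<partial>\<mu>) \<le> energy u g"
        unfolding energy_def by (intro nn_integral_mono) (auto simp: indicator_def)
      then have "ennreal ((u (g \<otimes> x) - u g)\<^sup>2) * ennreal (pmf \<mu> x) \<le> energy u g"
        by (simp add: nn_integral_cmult_indicator emeasure_pmf_single)
      then have "ennreal (1 / pmf \<mu> x) * (ennreal ((u (g \<otimes> x) - u g)\<^sup>2) * ennreal (pmf \<mu> x)) \<le>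
          ennreal (1 / pmf \<mu> x) * energy u g" by (rule mult_left_mono) simp
      moreover have "ennreal (1 / pmf \<mu> x) * (ennreal ((u (g \<otimes> x) - u g)\<^sup>2) * ennreal (pmf \<mu> x)) =
          ennreal ((u (g \<otimes> x) - u g)\<^sup>2)"
        using px by (simp add: ennreal_mult[symmetric])
      ultimately show ?thesis by simp
    qed
    have "(\<Sum>k. \<integral>\<^sup>+g. ennreal ((u (g \<otimes> x) - u g)\<^sup>2) \<partial>step_law k) \<le>
        (\<Sum>k. \<integral>\<^sup>+g. ennreal (1 / pmf \<mu> x) * energy u g \<partial>step_law k)"
      by (intro suminf_le nn_integral_mono le) simp_all
    also have "\<dots> = ennreal (1 / pmf \<mu> x) * (\<Sum>k. \<integral>\<^sup>+g. energy u g \<partial>step_law k)"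
      by (simp add: nn_integral_cmult)
    also have "\<dots> \<le> ennreal (1 / pmf \<mu> x) * 1" by (intro mult_left_mono energy_sum_le_1[OF u]) simp
    also have "\<dots> < \<top>" by simp
    finally show ?case .
  next
    case (mult x y)
    have c: "x \<in> carrier G" "y \<in> carrier G" using mult.hyps nondeg by (simp_all add: nondegenerate_def)
    let ?s = "\<lambda>x g. ennreal ((u (g \<otimes> x) - u g)\<^sup>2)"
    obtain C m where x: "C < \<top>" "\<And>k (f::'g \<Rightarrow> ennreal).
        (\<integral>\<^sup>+g. f (g \<otimes> x) \<partial>step_law k) \<le> C * (\<integral>\<^sup>+g. f g \<partial>step_law (k + m))"
      using shift_dominated[OF c(1)] by blast
    have "(\<integral>\<^sup>+g. ?s (x \<otimes> y) g \<partial>step_law k) \<le>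
        2 * (C * (\<integral>\<^sup>+g. ?s y g \<partial>step_law (k + m))) + 2 * (\<integral>\<^sup>+g. ?s x g \<partial>step_law k)" for k
    proof -
      have "(\<integral>\<^sup>+g. ?s (x \<otimes> y) g \<partial>step_law k) \<le> (\<integral>\<^sup>+g. 2 * ?s y (g \<otimes> x) + 2 * ?s x g \<partial>step_law k)"
      proof (rule nn_integral_mono_AE, unfold AE_measure_pmf_iff, intro ballI)
        fix g assume "g \<in> set_pmf (step_law k)"
        then have g: "g \<in> carrier G" using step_law_carrier[of k] by auto
        have "(a + b)\<^sup>2 \<le> 2 * a\<^sup>2 + 2 * b\<^sup>2" for a b :: real
          using sum_squares_ge_zero[of "a - b" 0] by (simp add: power2_eq_square algebra_simps)
        from this[of "u (g \<otimes> x \<otimes> y) - u (g \<otimes> x)" "u (g \<otimes> x) - u g"]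
        have "(u (g \<otimes> (x \<otimes> y)) - u g)\<^sup>2 \<le> 2 * (u (g \<otimes> x \<otimes> y) - u (g \<otimes> x))\<^sup>2 + 2 * (u (g \<otimes> x) - u g)\<^sup>2"
          using g c by (simp add: m_assoc)
        then have "?s (x \<otimes> y) g \<le> ennreal (2 * (u (g \<otimes> x \<otimes> y) - u (g \<otimes> x))\<^sup>2 + 2 * (u (g \<otimes> x) - u g)\<^sup>2)"
          by (rule ennreal_leI)
        then show "?s (x \<otimes> y) g \<le> 2 * ?s y (g \<otimes> x) + 2 * ?s x g" by (simp add: ennreal_mult)
      qed
      also have "\<dots> = 2 * (\<integral>\<^sup>+g. ?s y (g \<otimes> x) \<partial>step_law k) + 2 * (\<integral>\<^sup>+g. ?s x g \<partial>step_law k)"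
        by (simp add: nn_integral_add nn_integral_cmult)
      also have "\<dots> \<le> 2 * (C * (\<integral>\<^sup>+g. ?s y g \<partial>step_law (k + m))) + 2 * (\<integral>\<^sup>+g. ?s x g \<partial>step_law k)"
        by (intro add_mono mult_left_mono x(2)[of k "?s y"]) simp_all
      finally show ?thesis .
    qed
    then have "(\<Sum>k. \<integral>\<^sup>+g. ?s (x \<otimes> y) g \<partial>step_law k) \<le>
        (\<Sum>k. 2 * (C * (\<integral>\<^sup>+g. ?s y g \<partial>step_law (k + m))) + 2 * (\<integral>\<^sup>+g. ?s x g \<partial>step_law k))"
      by (intro suminf_le) simp_all
    also have "\<dots> = 2 * (C * (\<Sum>k. \<integral>\<^sup>+g. ?s y g \<partial>step_law (k + m))) + 2 * (\<Sum>k. \<integral>\<^sup>+g. ?s x g \<partial>step_law k)"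
      by (simp add: suminf_add[symmetric])
    also have "\<dots> \<le> 2 * (C * (\<Sum>k. \<integral>\<^sup>+g. ?s y g \<partial>step_law k)) + 2 * (\<Sum>k. \<integral>\<^sup>+g. ?s x g \<partial>step_law k)"
      by (intro add_mono mult_left_mono sum_shift_le) simp_all
    also have "\<dots> < \<top>" using mult.IH x(1) by (simp add: ennreal_mult_less_top)
    finally show ?case .
  qed
qed

lemma AE_square_summable_tendsto_0:
  fixes f :: "nat \<Rightarrow> (nat \<Rightarrow> 'g) \<Rightarrow> real"
  assumes [measurable]: "\<And>k. f k \<in> borel_measurable M"
    and fin: "(\<Sum>k. \<integral>\<^sup>+\<tau>. ennreal ((f k \<tau>)\<^sup>2) \<partial>M) < \<top>"
  shows "AE \<tau> in M. (\<lambda>k. f k \<tau>) \<longlonglongrightarrow> 0"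
proof -
  have "(\<integral>\<^sup>+\<tau>. (\<Sum>k. ennreal ((f k \<tau>)\<^sup>2)) \<partial>M) \<noteq> \<infinity>"
    using fin by (subst nn_integral_suminf) auto
  then have "AE \<tau> in M. (\<Sum>k. ennreal ((f k \<tau>)\<^sup>2)) \<noteq> \<infinity>"
    by (intro nn_integral_noteq_infinite) measurable
  then show ?thesis
  proof eventually_elim
    case (elim \<tau>)
    then have "summable (\<lambda>k. (f k \<tau>)\<^sup>2)" by (intro summable_suminf_not_top) auto
    then have "(\<lambda>k. sqrt ((f k \<tau>)\<^sup>2)) \<longlonglongrightarrow> sqrt 0" by (intro tendsto_real_sqrt summable_LIMSEQ_zero)
    then show ?case by (simp add: tendsto_rabs_zero_iff)
  qed
qed

lemma AE_carrier: "AE \<tau> in M. \<forall>k. \<tau> k \<in> carrier G"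
  by (rule AE_I2) (auto simp: space_M)

lemma harmonic_shift_AE:
  assumes u: "harmonic u"
  shows "AE \<tau> in M. \<forall>x\<in>carrier G. (\<lambda>k. u (\<tau> k \<otimes> x) - u (\<tau> k)) \<longlonglongrightarrow> 0"
  unfolding AE_ball_countable[OF cnt]
proof
  fix x assume x: "x \<in> carrier G"
  show "AE \<tau> in M. (\<lambda>k. u (\<tau> k \<otimes> x) - u (\<tau> k)) \<longlonglongrightarrow> 0"
  proof (rule AE_square_summable_tendsto_0)
    show "(\<lambda>\<tau>. u (\<tau> k \<otimes> x) - u (\<tau> k)) \<in> borel_measurable M" for k
      by (rule borel_measurable_step)
    have "(\<integral>\<^sup>+\<tau>. ennreal ((u (\<tau> k \<otimes> x) - u (\<tau> k))\<^sup>2) \<partial>M) =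
        (\<integral>\<^sup>+g. ennreal ((u (g \<otimes> x) - u g)\<^sup>2) \<partial>step_law k)" for k
      by (rule nn_integral_step)
    then show "(\<Sum>k. \<integral>\<^sup>+\<tau>. ennreal ((u (\<tau> k \<otimes> x) - u (\<tau> k))\<^sup>2) \<partial>M) < \<top>"
      using increments_summable[OF u x] by simp
  qed
qed

lemma harmonic_step_AE:
  assumes u: "harmonic u"
  shows "AE \<tau> in M. (\<lambda>k. u (\<tau> (Suc k)) - u (\<tau> k)) \<longlonglongrightarrow> 0"
proof (rule AE_square_summable_tendsto_0)
  show "(\<lambda>\<tau>. u (\<tau> (Suc k)) - u (\<tau> k)) \<in> borel_measurable M" for k
    by (intro borel_measurable_diff borel_measurable_step)
  have "(\<integral>\<^sup>+\<tau>. ennreal ((u (\<tau> (Suc k)) - u (\<tau> k))\<^sup>2) \<partial>M) = (\<integral>\<^sup>+g. energy u g \<partial>step_law k)" for k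
    unfolding energy_def by (rule nn_integral_steps)
  then show "(\<Sum>k. \<integral>\<^sup>+\<tau>. ennreal ((u (\<tau> (Suc k)) - u (\<tau> k))\<^sup>2) \<partial>M) < \<top>"
    using energy_sum_le_1[OF u] by (simp add: order.strict_trans1[OF _ ennreal_one_less_top])
qed

text \<open>One further step of \<mu> shifts the index of the step laws, so Cesaro averages change
  by at most \<open>1 / (k + 1)\<close>. A diagonal subsequence makes the countably many
  probabilities converge, and dominated convergence passes the mean value property to the
  limits.\<close>

lemma stationary_limit:
  assumes "countable \<S>"
  obtains N :: "nat \<Rightarrow> 'g pmf" and h :: "'g set \<Rightarrow> 'g \<Rightarrow> real"
  where "\<And>k. set_pmf (N k) \<subseteq> carrier G" "\<And>S. S \<in> \<S> \<Longrightarrow> harmonic (h S)"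
    "\<And>S g. S \<in> \<S> \<Longrightarrow> g \<in> carrier G \<Longrightarrow> (\<lambda>k. measure_pmf.prob (N k) {x. g \<otimes> x \<in> S}) \<longlonglongrightarrow> h S g"
proof -
  define A where "A k = bind_pmf (pmf_of_set {..k}) step_law" for k
  define F where "F k = (\<lambda>(S, g). measure_pmf.prob (A k) {x. g \<otimes> x \<in> S})" for k
  have "countable (\<S> \<times> carrier G)" using assms cnt by simp
  moreover have "norm (F k i) \<le> 1" for k i by (auto simp: F_def split: prod.splits)
  ultimately obtain r where r: "strict_mono (r::nat \<Rightarrow> nat)"
    "\<And>i. i \<in> \<S> \<times> carrier G \<Longrightarrow> \<exists>l. (\<lambda>k. F (r k) i) \<longlonglongrightarrow> l"
    using function_convergent_subsequence[of "\<S> \<times> carrier G" F 1] by blast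
  \<comment> \<open>The value 0 elsewhere keeps the bounds that \<open>harmonic\<close> demands off
    the carrier.\<close>
  define h where "h S g = (if S \<in> \<S> \<and> g \<in> carrier G then lim (\<lambda>k. F (r k) (S, g)) else 0)" for S g
  have h: "(\<lambda>k. F (r k) (S, g)) \<longlonglongrightarrow> h S g" if "S \<in> \<S>" "g \<in> carrier G" for S g
    using r(2)[of "(S, g)"] that by (auto simp: h_def dest: limI)
  have F01: "0 \<le> F k i" "F k i \<le> 1" for k i by (auto simp: F_def split: prod.splits)
  have A_carrier: "set_pmf (A k) \<subseteq> carrier G" for k using step_law_carrier by (auto simp: A_def)
  have prob_A: "measure_pmf.prob (A k) B = (\<Sum>j\<le>k. measure_pmf.prob (step_law j) B) / (k + 1)" for k B
  proof -
    have "measure_pmf.prob (A k) B = measure_pmf.expectation (A k) (indicator B)" by simp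
    also have "\<dots> = measure_pmf.expectation (pmf_of_set {..k}) (\<lambda>j. measure_pmf.prob (step_law j) B)"
      unfolding A_def by (subst expectation_bind_pmf) (auto simp: indicator_def)
    also have "\<dots> = (\<Sum>j\<le>k. measure_pmf.prob (step_law j) B) / (k + 1)"
      by (subst integral_pmf_of_set) auto
    finally show ?thesis .
  qed
  have prob_Suc: "measure_pmf.expectation \<mu> (\<lambda>y. measure_pmf.prob (step_law j) {x. g \<otimes> y \<otimes> x \<in> S}) =
      measure_pmf.prob (step_law (Suc j)) {x. g \<otimes> x \<in> S}" if g: "g \<in> carrier G" for j g S
  proof -
    have "measure_pmf.prob (step_law (Suc j)) {x. g \<otimes> x \<in> S} =
        measure_pmf.expectation (step_law (Suc j)) (indicator {x. g \<otimes> x \<in> S})" by simp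
    also have "\<dots> = measure_pmf.expectation \<mu>
        (\<lambda>y. measure_pmf.expectation (map_pmf (\<lambda>x. y \<otimes> x) (step_law j)) (indicator {x. g \<otimes> x \<in> S}))"
      unfolding step_law_Suc' by (rule expectation_bind_pmf) (auto simp: indicator_def)
    also have "\<dots> = measure_pmf.expectation \<mu> (\<lambda>y. measure_pmf.prob (step_law j) {x. g \<otimes> y \<otimes> x \<in> S})"
    proof (intro integral_cong_AE, simp_all add: AE_measure_pmf_iff vimage_def, intro ballI)
      fix y assume "y \<in> set_pmf \<mu>"
      then have "y \<in> carrier G" using supp by auto
      then show "measure_pmf.prob (step_law j) {x. g \<otimes> (y \<otimes> x) \<in> S} =
          measure_pmf.prob (step_law j) {x. g \<otimes> y \<otimes> x \<in> S}"
        using g step_law_carrier[of j]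
        by (intro measure_pmf.finite_measure_eq_AE) (auto simp: AE_measure_pmf_iff m_assoc subset_iff)
    qed
    finally show ?thesis by simp
  qed
  have almost: "\<bar>measure_pmf.expectation \<mu> (\<lambda>y. F k (S, g \<otimes> y)) - F k (S, g)\<bar> \<le> 1 / (k + 1)"
    if g: "g \<in> carrier G" for k S g
  proof -
    let ?P = "\<lambda>j. measure_pmf.prob (step_law j) {x. g \<otimes> x \<in> S}"
    have "measure_pmf.expectation \<mu> (\<lambda>y. F k (S, g \<otimes> y)) =
        (\<Sum>j\<le>k. measure_pmf.expectation \<mu> (\<lambda>y. measure_pmf.prob (step_law j) {x. g \<otimes> y \<otimes> x \<in> S})) / (k + 1)"
      unfolding F_def prod.case prob_A
      by (subst Bochner_Integration.integral_divide_zero, subst Bochner_Integration.integral_sum)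
        (auto intro!: measure_pmf.integrable_const_bound[where B = 1])
    also have "\<dots> = (\<Sum>j\<le>k. ?P (Suc j)) / (k + 1)" by (simp only: prob_Suc[OF g])
    finally have "measure_pmf.expectation \<mu> (\<lambda>y. F k (S, g \<otimes> y)) - F k (S, g) =
        ((\<Sum>j\<le>k. ?P (Suc j)) - (\<Sum>j\<le>k. ?P j)) / (k + 1)"
      by (simp add: F_def prob_A diff_divide_distrib)
    also have "(\<Sum>j\<le>k. ?P (Suc j)) - (\<Sum>j\<le>k. ?P j) = ?P (Suc k) - ?P 0"
      by (simp add: sum_subtractf[symmetric] sum_telescope[of "\<lambda>j. - ?P j" k, simplified] del: sum_subtractf)
    finally have eq: "measure_pmf.expectation \<mu> (\<lambda>y. F k (S, g \<otimes> y)) - F k (S, g) =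
        (?P (Suc k) - ?P 0) / (k + 1)" .
    have "0 \<le> ?P j" "?P j \<le> 1" for j by simp_all
    from this[of "Suc k"] this[of 0] have "\<bar>?P (Suc k) - ?P 0\<bar> \<le> 1" by linarith
    then show ?thesis unfolding eq by (simp add: abs_divide divide_right_mono add.commute)
  qed
  show ?thesis
  proof (rule that[of "\<lambda>k. A (r k)" h])
    show "set_pmf (A (r k)) \<subseteq> carrier G" for k by (rule A_carrier)
    show "(\<lambda>k. measure_pmf.prob (A (r k)) {x. g \<otimes> x \<in> S}) \<longlonglongrightarrow> h S g"
      if "S \<in> \<S>" "g \<in> carrier G" for S g
      using h[OF that] by (simp add: F_def)
    fix S assume S: "S \<in> \<S>"
    have h01: "0 \<le> h S g \<and> h S g \<le> 1" for g
    proof (cases "g \<in> carrier G")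
      case True
      show ?thesis
        using LIMSEQ_le_const[OF h[OF S True], of 0] LIMSEQ_le_const2[OF h[OF S True], of 1] F01 by auto
    qed (simp add: h_def)
    have "h S g = measure_pmf.expectation \<mu> (\<lambda>x. h S (g \<otimes> x))" if g: "g \<in> carrier G" for g
    proof (rule LIMSEQ_unique)
      show "(\<lambda>k. measure_pmf.expectation \<mu> (\<lambda>y. F (r k) (S, g \<otimes> y))) \<longlonglongrightarrow>
          measure_pmf.expectation \<mu> (\<lambda>x. h S (g \<otimes> x))"
      proof (rule integral_dominated_convergence[where w = "\<lambda>_. 1"])
        show "AE y in measure_pmf \<mu>. (\<lambda>k. F (r k) (S, g \<otimes> y)) \<longlonglongrightarrow> h S (g \<otimes> y)"
          using supp g by (auto simp: AE_measure_pmf_iff intro!: h S)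
      qed (auto simp: F01)
      have "(\<lambda>k. measure_pmf.expectation \<mu> (\<lambda>y. F (r k) (S, g \<otimes> y)) - F (r k) (S, g)) \<longlonglongrightarrow> 0"
      proof (rule Lim_null_comparison)
        show "\<forall>\<^sub>F k in sequentially. norm (measure_pmf.expectation \<mu> (\<lambda>y. F (r k) (S, g \<otimes> y)) - F (r k) (S, g)) \<le>
            1 / (real (r k) + 1)"
          unfolding real_norm_def by (intro always_eventually allI almost[OF g])
        have "(\<lambda>k. 1 / (real k + 1)) \<longlonglongrightarrow> 0" using LIMSEQ_inverse_real_of_nat by (simp add: field_simps)
        from LIMSEQ_subseq_LIMSEQ[OF this r(1)] show "(\<lambda>k. 1 / (real (r k) + 1)) \<longlonglongrightarrow> 0"
          by (simp add: o_def)
      qed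
      from tendsto_add[OF this h[OF S g]]
      show "(\<lambda>k. measure_pmf.expectation \<mu> (\<lambda>y. F (r k) (S, g \<otimes> y))) \<longlonglongrightarrow> h S g" by simp
    qed
    with h01 show "harmonic (h S)" by (auto simp: harmonic_def)
  qed
qed

end

section \<open>Convergence of the free component\<close>

text \<open>Eventually the values avoid the interval from 1/4 to 3/4 while the steps are shorter
  than 1/4, so the sequence cannot change sides.\<close>

lemma oscillation_free_limit:
  fixes x :: "nat \<Rightarrow> real"
  assumes x01: "\<And>k. 0 \<le> x k" "\<And>k. x k \<le> 1" and step: "(\<lambda>k. x (Suc k) - x k) \<longlonglongrightarrow> 0"
    and ends: "\<And>\<delta>. \<delta> > 0 \<Longrightarrow> eventually (\<lambda>k. x k \<le> \<delta> \<or> 1 - \<delta> \<le> x k) sequentially"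
  shows "x \<longlonglongrightarrow> 0 \<or> x \<longlonglongrightarrow> 1"
proof -
  have "eventually (\<lambda>k. \<bar>x (Suc k) - x k\<bar> < 1/4) sequentially"
    using tendstoD[OF step, of "1/4"] by simp
  with ends[of "1/4"] have "eventually (\<lambda>k. (x k \<le> 1/4 \<or> 3/4 \<le> x k) \<and> \<bar>x (Suc k) - x k\<bar> < 1/4) sequentially"
    by (auto intro: eventually_elim2)
  then obtain K where K: "\<And>k. k \<ge> K \<Longrightarrow> (x k \<le> 1/4 \<or> 3/4 \<le> x k) \<and> \<bar>x (Suc k) - x k\<bar> < 1/4"
    by (auto simp: eventually_sequentially)
  have stay: "x (K + k) \<le> 1/4 \<longleftrightarrow> x K \<le> 1/4" for k
  proof (induction k)
    case (Suc k)
    show ?case using K[of "K + k"] K[of "K + Suc k"] Suc by auto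
  qed simp
  show ?thesis
  proof (cases "x K \<le> 1/4")
    case True
    have "x \<longlonglongrightarrow> 0"
    proof (rule tendstoI)
      fix e :: real assume "e > 0"
      then have "eventually (\<lambda>k. x k \<le> min (e/2) (1/4) \<or> 1 - min (e/2) (1/4) \<le> x k) sequentially"
        by (intro ends) simp
      moreover have "eventually (\<lambda>k. k \<ge> K) sequentially" by (rule eventually_ge_at_top)
      ultimately show "eventually (\<lambda>k. dist (x k) 0 < e) sequentially"
      proof eventually_elim
        case (elim k)
        then show ?case using stay[of "k - K"] True x01(1)[of k] \<open>e > 0\<close> by (auto simp: min_def split: if_splits)
      qed
    qed
    then show ?thesis ..
  next
    case False
    have "x \<longlonglongrightarrow> 1"
    proof (rule tendstoI)
      fix e :: real assume "e > 0"
      then have "eventually (\<lambda>k. x k \<le> min (e/2) (1/4) \<or> 1 - min (e/2) (1/4) \<le> x k) sequentially"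
        by (intro ends) simp
      moreover have "eventually (\<lambda>k. k \<ge> K) sequentially" by (rule eventually_ge_at_top)
      ultimately show "eventually (\<lambda>k. dist (x k) 1 < e) sequentially"
      proof eventually_elim
        case (elim k)
        then show ?case using stay[of "k - K"] False x01(2)[of k] \<open>e > 0\<close>
          by (auto simp: min_def dist_real_def abs_if split: if_splits)
      qed
    qed
    then show ?thesis ..
  qed
qed

text \<open>An infinite word that follows \<open>v\<close> and then repeats \<open>w\<close> from
  phase \<open>s\<close>. Encoding it by three finite data is what makes such words
  countable.\<close>

definition periodic_tail :: "'a list \<Rightarrow> 'a list \<Rightarrow> nat \<Rightarrow> nat \<Rightarrow> 'a" where
  "periodic_tail v w s i = (if i < length v then v ! i else w ! ((s + (i - length v)) mod length w))"

text \<open>The setting abstracts from the pure braid group acting on its free normal subgroup: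
  \<open>A\<close> reads off the free component, and the conjugate by \<open>g\<close> of the element \<open>\<kappa> (p g) u\<close> is
  the element \<open>\<theta> g u\<close> of the free group. No relation between \<open>\<theta> g\<close> and \<open>A g\<close> is
  required except that \<open>\<theta> g\<close> sends the single element \<open>c\<close> to its conjugate by \<open>A g\<close>.\<close>

locale free_component_walk = group_walk G \<mu> M
  for G :: "('g, 'm) monoid_scheme" (structure) and \<mu> M +
  fixes A :: "'g \<Rightarrow> 'a::countable fg" and p :: "'g \<Rightarrow> 't" and \<kappa> :: "'t \<Rightarrow> 'a fg \<Rightarrow> 'g"
    and \<theta> :: "'g \<Rightarrow> 'a fg \<Rightarrow> 'a fg" and U :: "'a fg set" and a b c :: "'a fg" and X :: "('a \<times> bool) set"
  assumes letters: "finite X" "\<And>g. g \<in> carrier G \<Longrightarrow> set (word (A g)) \<subseteq> X"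
    and finite_p: "finite (p ` carrier G)"
    and \<kappa>_carrier: "\<And>g u. g \<in> carrier G \<Longrightarrow> u \<in> U \<Longrightarrow> \<kappa> (p g) u \<in> carrier G"
    and A_shift: "\<And>g u x. g \<in> carrier G \<Longrightarrow> u \<in> U \<Longrightarrow> x \<in> carrier G \<Longrightarrow>
      A (g \<otimes> \<kappa> (p g) u \<otimes> x) = \<theta> g u + A (g \<otimes> x)"
    and \<theta>_add: "\<And>g u v. g \<in> carrier G \<Longrightarrow> u \<in> U \<Longrightarrow> v \<in> U \<Longrightarrow> \<theta> g (u + v) = \<theta> g u + \<theta> g v"
    and \<theta>_inj: "\<And>g. g \<in> carrier G \<Longrightarrow> inj_on (\<theta> g) U"
    and U: "0 \<in> U" "\<And>u v. u \<in> U \<Longrightarrow> v \<in> U \<Longrightarrow> u + v \<in> U" "\<And>u. u \<in> U \<Longrightarrow> - u \<in> U"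
    and ab: "a \<in> U" "b \<in> U" "\<And>j. j > 0 \<Longrightarrow> nmult j a \<noteq> 0" "\<And>j. j > 0 \<Longrightarrow> nmult j b \<noteq> 0" "a + b \<noteq> b + a"
    and c: "c \<in> U" "word c \<noteq> []" "hd (word c) \<noteq> flip (last (word c))"
    and \<theta>_c: "\<And>g. g \<in> carrier G \<Longrightarrow> \<theta> g c = A g + c - A g"
begin

definition pt :: "('a \<times> bool) list \<Rightarrow> 'a fg set" where
  "pt w = {u. word u = w}"

text \<open>Cylinders record the direction of an element. Single points are needed as well, because
  \<open>cyl w\<close> exceeds the union of its one-letter extensions by the point
  \<open>w\<close>.\<close>

definition tests :: "'a fg set set" where
  "tests = range cyl \<union> range pt"

lemma countable_tests: "countable tests"
  by (simp add: tests_def)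

lemma cyl_tests [simp]: "cyl w \<in> tests" and pt_tests [simp]: "pt w \<in> tests"
  by (auto simp: tests_def)

lemma \<theta>_0: "g \<in> carrier G \<Longrightarrow> \<theta> g 0 = 0"
  using \<theta>_add[of g 0 0] U(1) by (metis add_0_left add_right_imp_eq)

lemma probes_U: "probes n a b \<subseteq> U"
  by (rule probes_subset) (use U ab in auto)

end

text \<open>Here \<open>m S g\<close> is the limiting probability that
  \<open>A (g \<otimes> x)\<close> lies in \<open>S\<close>, with \<open>x\<close> drawn from
  \<open>\<nu> k\<close>: the mass called \<open>\<nu>\<^sub>\<tau>\<close> in the overview, for
  \<tau> at position \<open>g\<close>.\<close>

locale free_component_limit = free_component_walk G \<mu> M A p \<kappa> \<theta> U a b c X
  for G :: "('g, 'm) monoid_scheme" (structure) and \<mu> M and A :: "'g \<Rightarrow> 'a::countable fg"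
    and p :: "'g \<Rightarrow> 't" and \<kappa> \<theta> U a b c X +
  fixes \<nu> :: "nat \<Rightarrow> 'g pmf" and m :: "'a fg set \<Rightarrow> 'g \<Rightarrow> real"
  assumes \<nu>_carrier: "\<And>k. set_pmf (\<nu> k) \<subseteq> carrier G"
    and m_harmonic: "\<And>S. S \<in> tests \<Longrightarrow> harmonic (m S)"
    and m_limit: "\<And>S g. S \<in> tests \<Longrightarrow> g \<in> carrier G \<Longrightarrow>
      (\<lambda>k. measure_pmf.prob (\<nu> k) {x. A (g \<otimes> x) \<in> S}) \<longlonglongrightarrow> m S g"
begin

lemma m_bounds [simp]: "S \<in> tests \<Longrightarrow> 0 \<le> m S g" "S \<in> tests \<Longrightarrow> m S g \<le> 1"
  using harmonic_bounds[OF m_harmonic] by auto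

text \<open>A pointwise linear inequality between indicators holds for each probability
  \<open>\<nu> i\<close> and survives the limit. This one statement supplies monotonicity,
  additivity and disjointness arguments for the finitely additive masses.\<close>

lemma m_positive:
  fixes k :: "'j \<Rightarrow> real"
  assumes J: "finite J" "\<And>j. j \<in> J \<Longrightarrow> S j \<in> tests" "\<And>j. j \<in> J \<Longrightarrow> g j \<in> carrier G"
    and le: "\<And>x. x \<in> carrier G \<Longrightarrow> (\<Sum>j\<in>J. k j * indicator (S j) (A (g j \<otimes> x))) \<le> C"
  shows "(\<Sum>j\<in>J. k j * m (S j) (g j)) \<le> C"
proof (rule LIMSEQ_le_const2)
  show "(\<lambda>i. \<Sum>j\<in>J. k j * measure_pmf.prob (\<nu> i) {x. A (g j \<otimes> x) \<in> S j}) \<longlonglongrightarrow>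
      (\<Sum>j\<in>J. k j * m (S j) (g j))"
    using J by (intro tendsto_sum tendsto_mult tendsto_const m_limit) auto
  have "(\<Sum>j\<in>J. k j * measure_pmf.prob (\<nu> i) {x. A (g j \<otimes> x) \<in> S j}) \<le> C" for i
  proof -
    have int: "integrable (measure_pmf (\<nu> i)) (\<lambda>x. k j * indicator (S j) (A (g j \<otimes> x)))" for j
      by (rule measure_pmf.integrable_const_bound[where B = "\<bar>k j\<bar>"]) (auto simp: indicator_def)
    have "measure_pmf.prob (\<nu> i) {x. A (g j \<otimes> x) \<in> S j} =
        measure_pmf.expectation (\<nu> i) (\<lambda>x. indicator (S j) (A (g j \<otimes> x)))" for j
    proof -
      have "measure_pmf.prob (\<nu> i) {x. A (g j \<otimes> x) \<in> S j} =
          measure_pmf.expectation (\<nu> i) (indicator {x. A (g j \<otimes> x) \<in> S j})" by simp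
      then show ?thesis by (simp only: indicator_def[abs_def] mem_Collect_eq)
    qed
    then have "(\<Sum>j\<in>J. k j * measure_pmf.prob (\<nu> i) {x. A (g j \<otimes> x) \<in> S j}) =
        measure_pmf.expectation (\<nu> i) (\<lambda>x. \<Sum>j\<in>J. k j * indicator (S j) (A (g j \<otimes> x)))"
      using int by (subst Bochner_Integration.integral_sum) auto
    also have "\<dots> \<le> measure_pmf.expectation (\<nu> i) (\<lambda>_. C)"
      using int \<nu>_carrier[of i] le
      by (intro integral_mono_AE Bochner_Integration.integrable_sum) (auto simp: AE_measure_pmf_iff)
    finally show ?thesis by simp
  qed
  then show "\<exists>N. \<forall>i\<ge>N. (\<Sum>j\<in>J. k j * measure_pmf.prob (\<nu> i) {x. A (g j \<otimes> x) \<in> S j}) \<le> C" by blast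
qed

text \<open>By \<open>A_shift\<close>, the mass at the shifted position is that of the translate of
  \<open>S\<close> by \<open>- \<theta> g u\<close>; this is the hypothesis \<open>pos\<close> of
  \<open>dichotomy\<close>.\<close>

lemma m_shift_positive:
  assumes g: "g \<in> carrier G" and S: "S \<in> tests" and J: "finite J" "J \<subseteq> U"
    and le: "\<And>y. (\<Sum>u\<in>J. k u * indicator S (\<theta> g u + y)) \<le> C"
  shows "(\<Sum>u\<in>J. k u * m S (g \<otimes> \<kappa> (p g) u)) \<le> C"
  using J g S le by (intro m_positive) (auto simp: A_shift subset_iff intro!: \<kappa>_carrier)

text \<open>The locale does not say that \<open>\<kappa> (p g) 0\<close> is the unit; but
  \<open>\<theta> g 0 = 0\<close>, so \<open>A\<close> cannot see this shift.\<close>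

lemma m_shift_0:
  assumes g: "g \<in> carrier G" and S: "S \<in> tests"
  shows "m S (g \<otimes> \<kappa> (p g) 0) = m S g"
proof (rule LIMSEQ_unique)
  have "measure_pmf.prob (\<nu> k) {x. A (g \<otimes> \<kappa> (p g) 0 \<otimes> x) \<in> S} = measure_pmf.prob (\<nu> k) {x. A (g \<otimes> x) \<in> S}" for k
    using \<nu>_carrier[of k] g U(1)
    by (intro measure_pmf.finite_measure_eq_AE) (auto simp: AE_measure_pmf_iff A_shift \<theta>_0 subset_iff)
  then show "(\<lambda>k. measure_pmf.prob (\<nu> k) {x. A (g \<otimes> x) \<in> S}) \<longlonglongrightarrow> m S (g \<otimes> \<kappa> (p g) 0)"
    using m_limit[OF S, of "g \<otimes> \<kappa> (p g) 0"] g U(1) \<kappa>_carrier by simp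
qed (rule m_limit[OF S g])

lemma m_mono:
  assumes "S \<in> tests" "T \<in> tests" "S \<subseteq> T" "g \<in> carrier G"
  shows "m S g \<le> m T g"
proof -
  have sum2: "(\<Sum>j\<in>{True, False}. f j) = f True + f False" for f :: "bool \<Rightarrow> real" by simp
  have "(\<Sum>j\<in>{True, False}. (if j then 1 else - 1) * m (if j then S else T) g) \<le> 0"
  proof (rule m_positive)
    fix x
    show "(\<Sum>j\<in>{True, False}. (if j then 1 else - 1) * indicator (if j then S else T) (A (g \<otimes> x))) \<le> (0::real)"
      unfolding sum2 using assms(3) by (auto simp: indicator_def)
  qed (use assms in auto)
  then show ?thesis by simp
qed

lemma m_empty: assumes "{} \<in> tests" "g \<in> carrier G" shows "m {} g = 0"
proof -
  have "(\<Sum>j\<in>{True}. 1 * m {} g) \<le> 0" using assms by (intro m_positive) auto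
  then show ?thesis using m_bounds(1)[OF assms(1), of g] by simp
qed

lemma m_cyl_Nil: assumes "g \<in> carrier G" shows "m (cyl []) g = 1"
proof -
  have "u \<in> cyl []" for u :: "'a fg" by (simp add: cyl_def)
  then have "(\<Sum>j\<in>{True}. - 1 * m (cyl []) g) \<le> - 1" using assms by (intro m_positive) auto
  then show ?thesis using m_bounds(2)[OF cyl_tests, of "[]" g] by simp
qed

lemma cyl_not_reduced: "\<not> reduced w \<Longrightarrow> cyl w = {}"
  by (auto simp: cyl_def prefix_def) (metis reduced_append reduced_word)

lemma m_cyl_not_reduced: "\<not> reduced w \<Longrightarrow> g \<in> carrier G \<Longrightarrow> m (cyl w) g = 0"
  using m_empty[of g] cyl_tests[of w] by (simp add: cyl_not_reduced)

lemma m_dichotomy: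
  assumes g: "g \<in> carrier G" and w: "w \<noteq> []" and n: "n > 0"
    and near: "\<And>u. u \<in> probes n a b \<Longrightarrow> \<bar>m (cyl w) (g \<otimes> \<kappa> (p g) u) - m (cyl w) g\<bar> \<le> \<epsilon>"
  shows "m (cyl w) g \<le> 1 / n + 2 * \<epsilon> \<or> (1 - 1 / n - \<epsilon> \<le> m (cyl w) g \<and>
    (\<exists>u\<in>{a, b}. cyl w \<union> (+) (- \<theta> g u) ` cyl w = UNIV))"
proof (cases "reduced w")
  case True
  let ?e = "\<lambda>u. m (cyl w) (g \<otimes> \<kappa> (p g) u)"
  have e0: "?e 0 = m (cyl w) g" by (rule m_shift_0[OF g cyl_tests])
  have "?e 0 \<le> 1 / n + 2 * \<epsilon> \<or> (1 - 1 / n - \<epsilon> \<le> ?e 0 \<and>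
      (\<exists>u\<in>{a, b}. cyl w \<union> (+) (- \<theta> g u) ` cyl w = UNIV))"
  proof (rule dichotomy[where U = U and e = ?e])
    show "half_tree (cyl w)" using w True by (rule half_tree_cyl)
    show "(\<Sum>u\<in>J. k u * ?e u) \<le> C"
      if "J \<subseteq> probes n a b" "\<And>y. (\<Sum>u\<in>J. k u * indicator (cyl w) (\<theta> g u + y)) \<le> C" for J k C
      using that probes_U by (intro m_shift_positive g cyl_tests) (auto intro: finite_subset)
    show "\<bar>?e u - ?e 0\<bar> \<le> \<epsilon>" if "u \<in> probes n a b" for u using near[OF that] by (simp only: e0)
  qed (use g n U ab \<theta>_add \<theta>_inj in auto)
  then show ?thesis by (simp only: e0)
next
  case False
  have "\<epsilon> \<ge> 0" using near[of 0] by (simp add: probes_def)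
  then show ?thesis using m_cyl_not_reduced[OF False g] by simp
qed

text \<open>The almost sure input; all statements about a \<open>good\<close> path are
  deterministic.\<close>

definition good :: "(nat \<Rightarrow> 'g) \<Rightarrow> bool" where
  "good \<tau> \<longleftrightarrow> (\<forall>k. \<tau> k \<in> carrier G) \<and> (\<forall>S\<in>tests. (\<lambda>k. m S (\<tau> (Suc k)) - m S (\<tau> k)) \<longlonglongrightarrow> 0) \<and>
     (\<forall>S\<in>tests. \<forall>x\<in>carrier G. (\<lambda>k. m S (\<tau> k \<otimes> x) - m S (\<tau> k)) \<longlonglongrightarrow> 0)"

lemma AE_good: "AE \<tau> in M. good \<tau>"
proof -
  have "AE \<tau> in M. \<forall>S\<in>tests. (\<lambda>k. m S (\<tau> (Suc k)) - m S (\<tau> k)) \<longlonglongrightarrow> 0"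
    unfolding AE_ball_countable[OF countable_tests] using harmonic_step_AE m_harmonic by blast
  moreover have "AE \<tau> in M. \<forall>S\<in>tests. \<forall>x\<in>carrier G. (\<lambda>k. m S (\<tau> k \<otimes> x) - m S (\<tau> k)) \<longlonglongrightarrow> 0"
    unfolding AE_ball_countable[OF countable_tests] using harmonic_shift_AE m_harmonic by blast
  ultimately show ?thesis using AE_carrier by eventually_elim (simp add: good_def)
qed

text \<open>The shift \<open>\<kappa> (p g) u\<close> depends on \<open>g\<close> only through the finitely many values of \<open>p\<close>.\<close>

lemma eventually_near:
  fixes f :: "'g \<Rightarrow> real"
  assumes \<tau>: "\<And>k. \<tau> k \<in> carrier G" and f: "\<And>x. x \<in> carrier G \<Longrightarrow> (\<lambda>k. f (\<tau> k \<otimes> x) - f (\<tau> k)) \<longlonglongrightarrow> 0"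
    and K: "finite K" "K \<subseteq> U" and "\<epsilon> > 0"
  shows "eventually (\<lambda>k. \<forall>u\<in>K. \<bar>f (\<tau> k \<otimes> \<kappa> (p (\<tau> k)) u) - f (\<tau> k)\<bar> < \<epsilon>) sequentially"
proof -
  have "eventually (\<lambda>k. \<forall>t\<in>p ` carrier G. \<forall>u\<in>K. \<bar>f (\<tau> k \<otimes> \<kappa> t u) - f (\<tau> k)\<bar> < \<epsilon>) sequentially"
  proof (intro eventually_ball_finite ballI finite_p K)
    fix t u assume "t \<in> p ` carrier G" "u \<in> K"
    then have "\<kappa> t u \<in> carrier G" using K \<kappa>_carrier by auto
    from tendstoD[OF f[OF this] \<open>\<epsilon> > 0\<close>]
    show "eventually (\<lambda>k. \<bar>f (\<tau> k \<otimes> \<kappa> t u) - f (\<tau> k)\<bar> < \<epsilon>) sequentially" by simp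
  qed
  then show ?thesis by eventually_elim (use \<tau> in blast)
qed

lemma good_near:
  assumes "good \<tau>" "S \<in> tests" "finite K" "K \<subseteq> U" "\<epsilon> > 0"
  shows "eventually (\<lambda>k. \<forall>u\<in>K. \<bar>m S (\<tau> k \<otimes> \<kappa> (p (\<tau> k)) u) - m S (\<tau> k)\<bar> < \<epsilon>) sequentially"
  using assms by (intro eventually_near) (auto simp: good_def)

text \<open>Translates of a point by the \<open>n\<close> different elements
  \<open>\<theta> g (nmult j a)\<close> are distinct and asymptotically of equal mass, so that mass
  is at most about \<open>1 / n\<close>.\<close>

lemma m_pt_tendsto_0:
  assumes "good \<tau>"
  shows "(\<lambda>k. m (pt w) (\<tau> k)) \<longlonglongrightarrow> 0"
proof (rule tendstoI)
  fix e :: real assume e: "e > 0"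
  obtain n :: nat where n: "1 / real n < e / 2" "n > 0"
    using reals_Archimedean[of "e / 2"] e by (metis half_gt_zero inverse_eq_divide zero_less_Suc)
  let ?J = "(\<lambda>j. nmult j a) ` {..<n}"
  have J: "finite ?J" "?J \<subseteq> U" using probes_U[of n] by (auto simp: probes_def)
  have card: "card ?J = n" by (simp add: card_image inj_on_subset[OF inj_mult[OF ab(3)]])
  have "eventually (\<lambda>k. \<forall>u\<in>?J. \<bar>m (pt w) (\<tau> k \<otimes> \<kappa> (p (\<tau> k)) u) - m (pt w) (\<tau> k)\<bar> < e / 2) sequentially"
    using assms J e by (intro good_near) auto
  then show "eventually (\<lambda>k. dist (m (pt w) (\<tau> k)) 0 < e) sequentially"
  proof eventually_elim
    case (elim k)
    have g: "\<tau> k \<in> carrier G" using assms by (simp add: good_def)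
    have "(\<Sum>u\<in>?J. 1 * m (pt w) (\<tau> k \<otimes> \<kappa> (p (\<tau> k)) u)) \<le> 1"
    proof (rule m_shift_positive[OF g pt_tests J])
      fix y
      have "u = v" if "u \<in> ?J" "v \<in> ?J" "\<theta> (\<tau> k) u + y \<in> pt w" "\<theta> (\<tau> k) v + y \<in> pt w" for u v
      proof (rule inj_onD[OF \<theta>_inj[OF g]])
        show "\<theta> (\<tau> k) u = \<theta> (\<tau> k) v"
        proof -
          have "\<theta> (\<tau> k) u + y = \<theta> (\<tau> k) v + y" using that(3,4) by (simp add: pt_def flip: word_inject)
          then show ?thesis by (rule add_right_imp_eq)
        qed
      qed (use that J in auto)
      then have "card {u\<in>?J. \<theta> (\<tau> k) u + y \<in> pt w} \<le> 1"
        using J by (subst card_le_Suc0_iff_eq[unfolded One_nat_def[symmetric]]) auto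
      then show "(\<Sum>u\<in>?J. 1 * indicator (pt w) (\<theta> (\<tau> k) u + y)) \<le> (1::real)"
        using J by (simp add: sum_indicator_card)
    qed
    moreover have "(\<Sum>u\<in>?J. m (pt w) (\<tau> k) - e / 2) \<le> (\<Sum>u\<in>?J. 1 * m (pt w) (\<tau> k \<otimes> \<kappa> (p (\<tau> k)) u))"
    proof (rule sum_mono)
      fix u assume "u \<in> ?J"
      with elim have "\<bar>m (pt w) (\<tau> k \<otimes> \<kappa> (p (\<tau> k)) u) - m (pt w) (\<tau> k)\<bar> < e / 2" by blast
      then show "m (pt w) (\<tau> k) - e / 2 \<le> 1 * m (pt w) (\<tau> k \<otimes> \<kappa> (p (\<tau> k)) u)" by linarith
    qed
    ultimately have "n * (m (pt w) (\<tau> k) - e / 2) \<le> 1" using card by simp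
    then have "m (pt w) (\<tau> k) - e / 2 \<le> 1 / n" using n(2) by (simp add: field_simps)
    then show ?case using n(1) by simp
  qed
qed

lemma m_cyl_limit:
  assumes \<tau>: "good \<tau>"
  shows "(\<lambda>k. m (cyl w) (\<tau> k)) \<longlonglongrightarrow> 0 \<or> (\<lambda>k. m (cyl w) (\<tau> k)) \<longlonglongrightarrow> 1"
proof (cases "w = []")
  case True
  have "(\<lambda>k. m (cyl w) (\<tau> k)) = (\<lambda>k. 1)" using \<tau> True by (simp add: good_def m_cyl_Nil)
  then show ?thesis by simp
next
  case False
  show ?thesis
  proof (rule oscillation_free_limit)
    fix \<delta> :: real assume \<delta>: "\<delta> > 0"
    obtain n :: nat where n: "1 / real n < \<delta> / 2" "n > 0"
      using reals_Archimedean[of "\<delta> / 2"] \<delta> by (metis half_gt_zero inverse_eq_divide zero_less_Suc)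
    \<comment> \<open>The dichotomy loses at most \<open>1 / n\<close> and twice the tolerance,
      which with \<open>\<delta> / 4\<close> stays below \<delta>.\<close>
    have "eventually (\<lambda>k. \<forall>u\<in>probes n a b.
        \<bar>m (cyl w) (\<tau> k \<otimes> \<kappa> (p (\<tau> k)) u) - m (cyl w) (\<tau> k)\<bar> < \<delta> / 4) sequentially"
      using \<tau> \<delta> probes_U by (intro good_near) auto
    then show "eventually (\<lambda>k. m (cyl w) (\<tau> k) \<le> \<delta> \<or> 1 - \<delta> \<le> m (cyl w) (\<tau> k)) sequentially"
    proof eventually_elim
      case (elim k)
      have "\<tau> k \<in> carrier G" using \<tau> by (simp add: good_def)
      from m_dichotomy[OF this False n(2), of "\<delta> / 4"] elim n(1) \<delta> show ?case by fastforce
    qed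
  qed (use \<tau> in \<open>auto simp: good_def\<close>)
qed

text \<open>Every value of \<open>A\<close> in \<open>cyl w\<close> is the point \<open>w\<close> or
  continues by a letter of \<open>X\<close>. Finiteness of \<open>X\<close> prevents mass from
  escaping through infinitely many continuations.\<close>

lemma m_cyl_split:
  assumes g: "g \<in> carrier G"
  shows "m (cyl w) g \<le> m (pt w) g + (\<Sum>x\<in>X. m (cyl (w @ [x])) g)"
proof -
  \<comment> \<open>The flag tells \<open>cyl v\<close> from \<open>pt v\<close>, because
    \<open>m_positive\<close> takes a single indexed family; only \<open>(w, True)\<close> has
    coefficient 1.\<close>
  let ?J = "insert (w, True) (insert (w, False) ((\<lambda>x. (w @ [x], True)) ` X))"
  let ?k = "\<lambda>j. if j = (w, True) then 1 else - 1 :: real"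
  let ?S = "\<lambda>(v, t). if t then cyl v else pt v"
  have sumJ: "(\<Sum>j\<in>?J. ?k j * f j) = f (w, True) - f (w, False) - (\<Sum>x\<in>X. f (w @ [x], True))" for f
  proof -
    let ?R = "(\<lambda>x. (w @ [x], True)) ` X"
    have inj: "inj_on (\<lambda>x. (w @ [x], True)) X" by (auto simp: inj_on_def)
    have R: "finite ?R" "(w, True) \<notin> ?R" "(w, False) \<notin> ?R" using letters(1) by auto
    have "(\<Sum>j\<in>?R. ?k j * f j) = (\<Sum>j\<in>?R. - f j)" using R(2) by (intro sum.cong) auto
    then have "(\<Sum>j\<in>?R. ?k j * f j) = - (\<Sum>x\<in>X. f (w @ [x], True))"
      by (simp add: sum.reindex[OF inj] sum_negf)
    moreover have "(\<Sum>j\<in>?J. F j) = F (w, True) + (F (w, False) + (\<Sum>j\<in>?R. F j))"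
      for F :: "('a \<times> bool) list \<times> bool \<Rightarrow> real"
      using R by (subst sum.insert, simp, simp, subst sum.insert, simp_all)
    ultimately show ?thesis by simp
  qed
  have "(\<Sum>j\<in>?J. ?k j * m (?S j) g) \<le> 0"
  proof (rule m_positive)
    fix x assume x: "x \<in> carrier G"
    define y where "y = A (g \<otimes> x)"
    have yX: "set (word y) \<subseteq> X" using letters(2) g x by (simp add: y_def)
    have "indicator (cyl w) y \<le> (indicator (pt w) y + (\<Sum>l\<in>X. indicator (cyl (w @ [l])) y) :: real)"
    proof (cases "y \<in> cyl w \<and> y \<notin> pt w")
      case True
      then obtain l v where "word y = w @ l # v"
        by (auto simp: cyl_def pt_def prefix_def neq_Nil_conv)
      then have "y \<in> cyl (w @ [l])" "l \<in> X" using yX by (auto simp: cyl_def prefix_def)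
      then have "1 \<le> (\<Sum>l\<in>X. indicator (cyl (w @ [l])) y :: real)"
        using letters(1) member_le_sum[of l X "\<lambda>l. indicator (cyl (w @ [l])) y :: real"] by simp
      then show ?thesis using True by simp
    qed (auto simp: indicator_def intro!: add_nonneg_nonneg sum_nonneg)
    then show "(\<Sum>j\<in>?J. ?k j * indicator (?S j) (A (g \<otimes> x))) \<le> 0"
      unfolding sumJ by (simp add: y_def)
  qed (use letters(1) g in auto)
  then show ?thesis unfolding sumJ by simp
qed

text \<open>Otherwise all terms on the right of \<open>m_cyl_split\<close> tend to 0, by
  \<open>m_cyl_limit\<close> for the finitely many extensions.\<close>

lemma m_cyl_extend:
  assumes \<tau>: "good \<tau>" and w: "(\<lambda>k. m (cyl w) (\<tau> k)) \<longlonglongrightarrow> 1"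
  shows "\<exists>x. (\<lambda>k. m (cyl (w @ [x])) (\<tau> k)) \<longlonglongrightarrow> 1"
proof (rule ccontr)
  assume "\<nexists>x. (\<lambda>k. m (cyl (w @ [x])) (\<tau> k)) \<longlonglongrightarrow> 1"
  then have "(\<lambda>k. m (cyl (w @ [x])) (\<tau> k)) \<longlonglongrightarrow> 0" for x using m_cyl_limit[OF \<tau>] by blast
  then have "(\<lambda>k. m (pt w) (\<tau> k) + (\<Sum>x\<in>X. m (cyl (w @ [x])) (\<tau> k))) \<longlonglongrightarrow> 0 + (\<Sum>x\<in>X. 0)"
    by (intro tendsto_add tendsto_sum m_pt_tendsto_0[OF \<tau>])
  moreover have "m (cyl w) (\<tau> k) \<le> m (pt w) (\<tau> k) + (\<Sum>x\<in>X. m (cyl (w @ [x])) (\<tau> k))" for k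
    using \<tau> by (intro m_cyl_split) (simp add: good_def)
  ultimately have "1 \<le> (0 + (\<Sum>x\<in>X. 0) :: real)" using w by (intro LIMSEQ_le[OF w]) auto
  then show False by simp
qed

lemma m_cyl_ray:
  assumes \<tau>: "good \<tau>"
  shows "\<exists>z. \<forall>r. (\<lambda>k. m (cyl (map z [0..<r])) (\<tau> k)) \<longlonglongrightarrow> 1"
proof -
  let ?P = "\<lambda>w. (\<lambda>k. m (cyl w) (\<tau> k)) \<longlonglongrightarrow> 1"
  have P0: "?P []" using \<tau> by (simp add: good_def m_cyl_Nil)
  have "\<exists>W. \<forall>r. ?P (W r) \<and> length (W r) = r \<and> (\<exists>x. W (Suc r) = W r @ [x])"
  proof -
    have "\<exists>W. \<forall>r. (?P (W r) \<and> length (W r) = r) \<and> (\<exists>x. W (Suc r) = W r @ [x])"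
    proof (rule dependent_nat_choice)
      show "\<exists>w. ?P w \<and> length w = 0" using P0 by auto
      fix w r assume w: "?P w \<and> length w = r"
      then obtain x where "?P (w @ [x])" using m_cyl_extend[OF \<tau>] by blast
      then show "\<exists>w'. (?P w' \<and> length w' = Suc r) \<and> (\<exists>x. w' = w @ [x])"
        using w by (intro exI[of _ "w @ [x]"]) auto
    qed
    then show ?thesis by blast
  qed
  then obtain W where W: "\<And>r. ?P (W r)" "\<And>r. length (W r) = r" "\<And>r. \<exists>x. W (Suc r) = W r @ [x]" by blast
  define z where "z r = last (W (Suc r))" for r
  have "map z [0..<r] = W r" for r
  proof (induction r)
    case 0
    then show ?case using W(2)[of 0] by simp
  next
    case (Suc r)
    then show ?case using W(3)[of r] by (auto simp: z_def)
  qed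
  then show ?thesis using W(1) by metis
qed

section \<open>Eventually periodic words and the mass of a single end\<close>

definition tails :: "(nat \<Rightarrow> 'a \<times> bool) set" where
  "tails = (\<lambda>(v, w, s). periodic_tail v w s) ` (UNIV \<times> {word c, inv_word (word c)} \<times> UNIV)"

lemma countable_tails: "countable tails"
  unfolding tails_def by (intro countable_image countable_SIGMA) auto

text \<open>At a late time with \<open>A (\<tau> k)\<close> outside the cylinder of length
  \<open>r\<close>, the cylinder of length \<open>r + R\<close> still meets its translate by the
  conjugate of \<open>c\<close>. By \<open>conjugate_crossing\<close> the \<open>R\<close> letters
  of \<open>z\<close> after position \<open>r\<close> are then periodic, for every
  \<open>R\<close>.\<close>

lemma ray_periodic:
  assumes \<tau>: "good \<tau>" and z: "\<And>r. (\<lambda>k. m (cyl (map z [0..<r])) (\<tau> k)) \<longlonglongrightarrow> 1"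
    and bad: "\<not> eventually (\<lambda>k. A (\<tau> k) \<in> cyl (map z [0..<r])) sequentially"
  shows "z \<in> tails"
proof -
  let ?W = "{word c, inv_word (word c)}"
  let ?agree = "\<lambda>w s i. z (r + i) = w ! ((s + i) mod length w)"
  let ?l = "length (word c)"
  have l: "?l > 0" using c(2) by simp
  have ex: "\<exists>w\<in>?W. \<exists>s<?l. \<forall>i<R. ?agree w s i" for R
  proof -
    let ?S = "cyl (map z [0..<r + R])"
    have "eventually (\<lambda>k. \<forall>u\<in>{c}. \<bar>m ?S (\<tau> k \<otimes> \<kappa> (p (\<tau> k)) u) - m ?S (\<tau> k)\<bar> < 1/4) sequentially"
      using \<tau> c(1) by (intro good_near) auto
    moreover have "eventually (\<lambda>k. dist (m ?S (\<tau> k)) 1 < 1/4) sequentially"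
      by (rule tendstoD[OF z]) simp
    ultimately have "eventually (\<lambda>k. m ?S (\<tau> k) > 3/4 \<and> m ?S (\<tau> k \<otimes> \<kappa> (p (\<tau> k)) c) > 1/2) sequentially"
    proof eventually_elim
      case (elim k)
      then have "\<bar>m ?S (\<tau> k \<otimes> \<kappa> (p (\<tau> k)) c) - m ?S (\<tau> k)\<bar> < 1/4" "\<bar>m ?S (\<tau> k) - 1\<bar> < 1/4"
        by (simp_all add: dist_real_def)
      then show ?case by linarith
    qed
    note ev = this
    have "\<exists>k. A (\<tau> k) \<notin> cyl (map z [0..<r]) \<and>
        m ?S (\<tau> k) > 3/4 \<and> m ?S (\<tau> k \<otimes> \<kappa> (p (\<tau> k)) c) > 1/2"
    proof (rule ccontr)
      assume n: "\<not> ?thesis"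
      from ev have "eventually (\<lambda>k. A (\<tau> k) \<in> cyl (map z [0..<r])) sequentially"
        by (rule eventually_mono) (use n in blast)
      with bad show False ..
    qed
    then obtain k where k: "A (\<tau> k) \<notin> cyl (map z [0..<r])" "m ?S (\<tau> k) > 3/4"
      "m ?S (\<tau> k \<otimes> \<kappa> (p (\<tau> k)) c) > 1/2" by blast
    have g: "\<tau> k \<in> carrier G" using \<tau> by (simp add: good_def)
    have c0: "c \<noteq> 0" using c(2) by auto
    \<comment> \<open>The masses of \<open>?S\<close> and of its translate add up to more than 1, so
      the two sets cannot be disjoint.\<close>
    have "\<exists>y. y \<in> ?S \<and> \<theta> (\<tau> k) c + y \<in> ?S"
    proof (rule ccontr)
      assume n: "\<nexists>y. y \<in> ?S \<and> \<theta> (\<tau> k) c + y \<in> ?S"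
      have "(\<Sum>u\<in>{0, c}. 1 * m ?S (\<tau> k \<otimes> \<kappa> (p (\<tau> k)) u)) \<le> 1"
      proof (rule m_shift_positive[OF g cyl_tests])
        have sum2: "(\<Sum>u\<in>{0, c}. F u) = F 0 + F c" for F :: "'a fg \<Rightarrow> real" using c0 by simp
        show "(\<Sum>u\<in>{0, c}. 1 * indicator ?S (\<theta> (\<tau> k) u + y)) \<le> (1::real)" for y
          unfolding sum2 \<theta>_0[OF g] using n by (auto simp: indicator_def)
      qed (use c(1) U(1) in auto)
      then show False using k c0 by (simp add: m_shift_0[OF g])
    qed
    then obtain y where y: "y \<in> ?S" "\<theta> (\<tau> k) c + y \<in> ?S" by blast
    have split: "map z [0..<r + R] = map z [0..<r] @ map z [r..<r + R]"
      by (subst upt_add_eq_append) simp_all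
    obtain w s where w: "w \<in> ?W" "\<forall>i<length (map z [r..<r + R]). map z [r..<r + R] ! i = w ! ((s + i) mod length w)"
      using conjugate_crossing[OF c(2,3) k(1), of y "map z [r..<r + R]"] y
      unfolding split \<theta>_c[OF g] by blast
    then have "length w = ?l" by auto
    then have "\<forall>i<R. ?agree w (s mod ?l) i" using w(2) by (simp add: mod_add_left_eq)
    moreover have "s mod ?l < ?l" using l by simp
    ultimately show ?thesis using w(1) by blast
  qed
  \<comment> \<open>There are finitely many pairs of a period and a phase; if each failed at some
    index, a length beyond all these indices would contradict \<open>ex\<close>.\<close>
  have "\<exists>w\<in>?W. \<exists>s<?l. \<forall>i. ?agree w s i"
  proof (rule ccontr)
    assume "\<not> ?thesis"
    then have "\<forall>w\<in>?W. \<forall>s<?l. \<exists>i. \<not> ?agree w s i" by blast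
    then obtain f where f: "\<And>w s. w \<in> ?W \<Longrightarrow> s < ?l \<Longrightarrow> \<not> ?agree w s (f w s)" by metis
    let ?F = "(\<lambda>(w, s). f w s) ` (?W \<times> {..<?l})"
    have "f w s < Suc (Max ?F)" if "w \<in> ?W" "s < ?l" for w s
      using that by (intro le_imp_less_Suc Max_ge) auto
    then show False using ex[of "Suc (Max ?F)"] f by blast
  qed
  then obtain w s where w: "w \<in> ?W" "\<And>i. ?agree w s i" by blast
  have "z = periodic_tail (map z [0..<r]) w s"
  proof
    fix i
    show "z i = periodic_tail (map z [0..<r]) w s i"
      using w(2)[of "i - r"] by (auto simp: periodic_tail_def)
  qed
  then show ?thesis using w(1) unfolding tails_def by (intro image_eqI[of _ _ "(map z [0..<r], w, s)"]) auto
qed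

lemma cyl_antimono: "r \<le> r' \<Longrightarrow> cyl (map z [0..<r']) \<subseteq> cyl (map z [0..<r])"
proof -
  assume "r \<le> r'"
  then have "map z [0..<r'] = map z [0..<r] @ map z [r..<r']"
    by (metis le_add_diff_inverse map_append upt_add_eq_append zero_le)
  then show ?thesis by (auto simp: cyl_def prefix_def)
qed

text \<open>The mass at the end \<open>z\<close> of the tree, defined through the cylinders
  shrinking to it; for a finitely additive mass it can be positive only as such a limit.\<close>

definition point_mass :: "(nat \<Rightarrow> 'a \<times> bool) \<Rightarrow> 'g \<Rightarrow> real" where
  "point_mass z g = (INF r. m (cyl (map z [0..<r])) g)"

lemma point_mass_le: "point_mass z g \<le> m (cyl (map z [0..<r])) g"
  unfolding point_mass_def by (rule cINF_lower) (auto intro!: bdd_belowI[of _ 0])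

lemma point_mass_limit:
  assumes "g \<in> carrier G"
  shows "(\<lambda>r. m (cyl (map z [0..<r])) g) \<longlonglongrightarrow> point_mass z g"
  unfolding point_mass_def
  by (rule LIMSEQ_decseq_INF) (auto intro!: bdd_belowI[of _ 0] decseq_SucI m_mono cyl_antimono assms)

lemma harmonic_point_mass: "harmonic (point_mass z)"
  unfolding harmonic_def
proof (intro conjI allI ballI)
  show "0 \<le> point_mass z g" for g
    unfolding point_mass_def by (rule cINF_greatest) auto
  show "point_mass z g \<le> 1" for g
    by (rule order.trans[OF point_mass_le[of z g 0]]) simp
  fix g assume g: "g \<in> carrier G"
  let ?u = "\<lambda>r. m (cyl (map z [0..<r]))"
  show "point_mass z g = measure_pmf.expectation \<mu> (\<lambda>x. point_mass z (g \<otimes> x))"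
  proof (rule LIMSEQ_unique)
    show "(\<lambda>r. ?u r g) \<longlonglongrightarrow> point_mass z g" by (rule point_mass_limit[OF g])
    have "(\<lambda>r. measure_pmf.expectation \<mu> (\<lambda>x. ?u r (g \<otimes> x))) \<longlonglongrightarrow>
        measure_pmf.expectation \<mu> (\<lambda>x. point_mass z (g \<otimes> x))"
    proof (rule integral_dominated_convergence[where w = "\<lambda>_. 1"])
      show "AE x in measure_pmf \<mu>. (\<lambda>r. ?u r (g \<otimes> x)) \<longlonglongrightarrow> point_mass z (g \<otimes> x)"
        using supp g by (auto simp: AE_measure_pmf_iff intro!: point_mass_limit)
    qed auto
    then show "(\<lambda>r. ?u r g) \<longlonglongrightarrow> measure_pmf.expectation \<mu> (\<lambda>x. point_mass z (g \<otimes> x))"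
      using m_harmonic[OF cyl_tests] g by (simp add: harmonic_def)
  qed
qed

text \<open>For long \<open>w\<close> the set \<open>cyl w\<close> and its translates miss the unit, so the dichotomy only
  leaves the case of small mass.\<close>

lemma point_mass_small:
  assumes g: "g \<in> carrier G" and n: "n > 0"
    and near: "\<And>u. u \<in> probes n a b \<Longrightarrow> \<bar>point_mass z (g \<otimes> \<kappa> (p g) u) - point_mass z g\<bar> < \<epsilon>"
  shows "point_mass z g \<le> 1 / n + 2 * \<epsilon>"
proof -
  let ?w = "\<lambda>r. map z [0..<r]"
  have "eventually (\<lambda>r. \<forall>u\<in>probes n a b. \<bar>m (cyl (?w r)) (g \<otimes> \<kappa> (p g) u) - m (cyl (?w r)) g\<bar> < \<epsilon>) sequentially"
  proof (intro eventually_ball_finite ballI finite_probes)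
    fix u assume u: "u \<in> probes n a b"
    then have "g \<otimes> \<kappa> (p g) u \<in> carrier G" 
      using probes_U by (intro m_closed g \<kappa>_carrier) auto
    then have "(\<lambda>r. \<bar>m (cyl (?w r)) (g \<otimes> \<kappa> (p g) u) - m (cyl (?w r)) g\<bar>) \<longlonglongrightarrow>
        \<bar>point_mass z (g \<otimes> \<kappa> (p g) u) - point_mass z g\<bar>"
      using g by (intro tendsto_rabs tendsto_diff point_mass_limit)
    from order_tendstoD(2)[OF this near[OF u]]
    show "eventually (\<lambda>r. \<bar>m (cyl (?w r)) (g \<otimes> \<kappa> (p g) u) - m (cyl (?w r)) g\<bar> < \<epsilon>) sequentially" .
  qed
  moreover have "eventually (\<lambda>r. r > length (word (\<theta> g a)) + length (word (\<theta> g b))) sequentially"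
    by (rule eventually_gt_at_top)
  ultimately have "eventually (\<lambda>r. (\<forall>u\<in>probes n a b. \<bar>m (cyl (?w r)) (g \<otimes> \<kappa> (p g) u) - m (cyl (?w r)) g\<bar> < \<epsilon>) \<and>
      r > length (word (\<theta> g a)) + length (word (\<theta> g b))) sequentially" by eventually_elim simp
  from eventually_happens'[OF sequentially_bot this]
  obtain r where r: "\<And>u. u \<in> probes n a b \<Longrightarrow> \<bar>m (cyl (?w r)) (g \<otimes> \<kappa> (p g) u) - m (cyl (?w r)) g\<bar> < \<epsilon>"
    "r > length (word (\<theta> g a)) + length (word (\<theta> g b))" by blast
  have "0 \<notin> cyl (?w r) \<union> (+) (- \<theta> g u) ` cyl (?w r)" if "u \<in> {a, b}" for u
  proof -
    have "v \<notin> cyl (?w r)" if "length (word v) < r" for v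
      using that prefix_length_le[of "?w r" "word v"] by (auto simp: cyl_def)
    moreover have "length (word (\<theta> g u)) < r" using r(2) that by auto
    ultimately show ?thesis using r(2) by (simp only: Un_iff mem_translate) auto
  qed
  moreover have "?w r \<noteq> []" using r(2) by auto
  ultimately have "m (cyl (?w r)) g \<le> 1 / n + 2 * \<epsilon>"
    using m_dichotomy[OF g _ n less_imp_le[OF r(1)]] by (metis UNIV_I)
  then show ?thesis using point_mass_le[of z g r] by linarith
qed

text \<open>The expectation of a bounded harmonic function along the walk is constant, while by
  \<open>point_mass_small\<close> this one tends to 0 along almost every path.\<close>

lemma point_mass_one: "point_mass z \<one> = 0"
proof -
  note b = harmonic_bounds[OF harmonic_point_mass]
  have "AE \<tau> in M. (\<lambda>k. point_mass z (\<tau> k)) \<longlonglongrightarrow> 0"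
    using harmonic_shift_AE[OF harmonic_point_mass[of z]] AE_carrier
  proof eventually_elim
    case (elim \<tau>)
    show ?case
    proof (rule tendstoI)
      fix e :: real assume e: "e > 0"
      obtain n :: nat where n: "1 / real n < e / 2" "n > 0"
        using reals_Archimedean[of "e / 2"] e by (metis half_gt_zero inverse_eq_divide zero_less_Suc)
      have "eventually (\<lambda>k. \<forall>u\<in>probes n a b.
          \<bar>point_mass z (\<tau> k \<otimes> \<kappa> (p (\<tau> k)) u) - point_mass z (\<tau> k)\<bar> < e / 4) sequentially"
        using elim e probes_U by (intro eventually_near) auto
      then show "eventually (\<lambda>k. dist (point_mass z (\<tau> k)) 0 < e) sequentially"
      proof eventually_elim
        case (elim k)
        have "point_mass z (\<tau> k) \<le> 1 / n + 2 * (e / 4)"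
          using elim \<open>\<forall>k. \<tau> k \<in> carrier G\<close> n by (intro point_mass_small) auto
        then show ?case using n(1) b(1)[of z "\<tau> k"] by (simp add: abs_less_iff)
      qed
    qed
  qed
  then have "(\<lambda>k. expectation (\<lambda>\<tau>. point_mass z (\<tau> k))) \<longlonglongrightarrow> expectation (\<lambda>_. 0)"
    using b by (intro integral_dominated_convergence[where w = "\<lambda>_. 1"] borel_measurable_step) auto
  moreover have "expectation (\<lambda>\<tau>. point_mass z (\<tau> k)) = point_mass z \<one>" for k
    using b by (simp add: expectation_step harmonic_expectation[OF harmonic_point_mass])
  ultimately show ?thesis by (simp add: LIMSEQ_const_iff)
qed

text \<open>On the excluded event the lower limit \<open>v r\<close> equals 1 for every
  \<open>r\<close>. By Fatou its expectation is at most the mass of the cylinder at the unit, and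
  this tends to \<open>point_mass z \<one> = 0\<close>.\<close>

lemma AE_not_ray: "AE \<tau> in M. \<not> (\<forall>r. (\<lambda>k. m (cyl (map z [0..<r])) (\<tau> k)) \<longlonglongrightarrow> 1)"
proof -
  let ?u = "\<lambda>r. m (cyl (map z [0..<r]))"
  define v where "v r \<tau> = liminf (\<lambda>k. ennreal (?u r (\<tau> k)))" for r \<tau>
  have meas [measurable]: "(\<lambda>\<tau>. ennreal (?u r (\<tau> k))) \<in> borel_measurable M" for r k
    using borel_measurable_step[of "?u r" k] by simp
  then have [measurable]: "v r \<in> borel_measurable M" for r
    unfolding v_def[abs_def] by measurable
  have "(\<integral>\<^sup>+\<tau>. v r \<tau> \<partial>M) \<le> ennreal (?u r \<one>)" for r
  proof -
    have "(\<integral>\<^sup>+\<tau>. ennreal (?u r (\<tau> k)) \<partial>M) = ennreal (?u r \<one>)" for k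
    proof -
      have "(\<integral>\<^sup>+\<tau>. ennreal (?u r (\<tau> k)) \<partial>M) = ennreal (expectation (\<lambda>\<tau>. ?u r (\<tau> k)))"
        by (intro nn_integral_eq_integral integrable_const_bound[where B = 1] borel_measurable_step) auto
      also have "expectation (\<lambda>\<tau>. ?u r (\<tau> k)) = ?u r \<one>"
        by (simp add: expectation_step harmonic_expectation[OF m_harmonic])
      finally show ?thesis .
    qed
    then show ?thesis
      using nn_integral_liminf[OF meas[of r]] by (simp add: v_def Liminf_const)
  qed
  then have "(\<integral>\<^sup>+\<tau>. (INF r. v r \<tau>) \<partial>M) \<le> ennreal (?u r \<one>)" for r
    by (rule order.trans[rotated]) (intro nn_integral_mono INF_lower UNIV_I)
  moreover have "(\<lambda>r. ennreal (?u r \<one>)) \<longlonglongrightarrow> ennreal 0"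
    using point_mass_limit[OF one_closed, of z] by (intro tendsto_ennrealI) (simp add: point_mass_one)
  ultimately have "(\<integral>\<^sup>+\<tau>. (INF r. v r \<tau>) \<partial>M) \<le> ennreal 0"
    by (intro LIMSEQ_le_const) auto
  then have "(\<integral>\<^sup>+\<tau>. (INF r. v r \<tau>) \<partial>M) = 0" by simp
  then have "AE \<tau> in M. (INF r. v r \<tau>) = 0" by (subst (asm) nn_integral_0_iff_AE) auto
  then show ?thesis
  proof eventually_elim
    case (elim \<tau>)
    show ?case
    proof
      assume "\<forall>r. (\<lambda>k. ?u r (\<tau> k)) \<longlonglongrightarrow> 1"
      then have "(\<lambda>k. ennreal (?u r (\<tau> k))) \<longlonglongrightarrow> ennreal 1" for r by (intro tendsto_ennrealI) auto
      then have "v r \<tau> = 1" for r unfolding v_def by (simp add: lim_imp_Liminf[OF sequentially_bot])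
      then show False using elim by simp
    qed
  qed
qed

lemma AE_converges: "AE \<tau> in M. converges_at_infinity (\<lambda>k. word (A (\<tau> k)))"
proof -
  have "AE \<tau> in M. \<forall>z\<in>tails. \<not> (\<forall>r. (\<lambda>k. m (cyl (map z [0..<r])) (\<tau> k)) \<longlonglongrightarrow> 1)"
    unfolding AE_ball_countable[OF countable_tails] using AE_not_ray by blast
  with AE_good show ?thesis
  proof eventually_elim
    case (elim \<tau>)
    obtain z where z: "\<And>r. (\<lambda>k. m (cyl (map z [0..<r])) (\<tau> k)) \<longlonglongrightarrow> 1"
      using m_cyl_ray[OF elim(1)] by blast
    with elim have "z \<notin> tails" by blast
    with ray_periodic[OF elim(1) z]
    have ev: "eventually (\<lambda>k. A (\<tau> k) \<in> cyl (map z [0..<r])) sequentially" for r by blast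
    show ?case
      unfolding converges_at_infinity_def
    proof
      fix k
      \<comment> \<open>\<open>Suc k\<close> letters make the length exceed \<open>k\<close>; the
        bound includes \<open>N\<close> itself, whose word serves as the reference for the later
        ones.\<close>
      obtain N where N: "\<And>j. j \<ge> N \<Longrightarrow> prefix (map z [0..<Suc k]) (word (A (\<tau> j)))"
        using ev[of "Suc k"] unfolding eventually_sequentially cyl_def mem_Collect_eq by blast
      have "length (word (A (\<tau> j))) > k \<and> take k (word (A (\<tau> j))) = map z [0..<k]" if "j \<ge> N" for j
        using N[OF that] prefix_length_le[OF N[OF that]]
        by (auto simp: prefix_def)
      then show "\<exists>N. \<forall>j>N. length (word (A (\<tau> j))) > k \<and> take k (word (A (\<tau> j))) = take k (word (A (\<tau> N)))"
        by (intro exI[of _ N]) auto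
    qed
  qed
qed

end

context free_component_walk
begin

theorem free_component_converges: "AE \<tau> in M. converges_at_infinity (\<lambda>k. word (A (\<tau> k)))"
proof -
  let ?S = "\<lambda>S. A -` S"
  obtain N h where N: "\<And>k. set_pmf (N k) \<subseteq> carrier G"
    and h: "\<And>S. S \<in> ?S ` tests \<Longrightarrow> harmonic (h S)"
      "\<And>S g. S \<in> ?S ` tests \<Longrightarrow> g \<in> carrier G \<Longrightarrow> (\<lambda>k. measure_pmf.prob (N k) {x. g \<otimes> x \<in> S}) \<longlonglongrightarrow> h S g"
    using stationary_limit[of "?S ` tests"] countable_tests by auto
  interpret L: free_component_limit G \<mu> M A p \<kappa> \<theta> U a b c X N "\<lambda>S. h (A -` S)"
  proof unfold_locales
    show "(\<lambda>k. measure_pmf.prob (N k) {x. A (g \<otimes> x) \<in> S}) \<longlonglongrightarrow> h (A -` S) g"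
      if "S \<in> tests" "g \<in> carrier G" for S g
      using h(2)[OF imageI[OF that(1)] that(2)] by simp
  qed (use N h(1) in auto)
  show ?thesis by (rule L.AE_converges)
qed

end

section \<open>Braid relations and pure braids\<close>

context group
begin

definition conj_by :: "'a \<Rightarrow> 'a \<Rightarrow> 'a" where
  "conj_by g x = g \<otimes> x \<otimes> inv g"

lemma conj_by_closed [simp]: "g \<in> carrier G \<Longrightarrow> x \<in> carrier G \<Longrightarrow> conj_by g x \<in> carrier G"
  by (simp add: conj_by_def)

lemma conj_by_mult:
  "g \<in> carrier G \<Longrightarrow> x \<in> carrier G \<Longrightarrow> y \<in> carrier G \<Longrightarrow> conj_by g (x \<otimes> y) = conj_by g x \<otimes> conj_by g y"
  by (simp add: conj_by_def m_assoc) (simp add: m_assoc[symmetric])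

lemma conj_by_one [simp]: "g \<in> carrier G \<Longrightarrow> conj_by g \<one> = \<one>"
  by (simp add: conj_by_def)

lemma conj_by_inv: "g \<in> carrier G \<Longrightarrow> x \<in> carrier G \<Longrightarrow> conj_by g (inv x) = inv (conj_by g x)"
  by (simp add: conj_by_def inv_mult_group m_assoc)

lemma conj_by_conj_by:
  "g \<in> carrier G \<Longrightarrow> h \<in> carrier G \<Longrightarrow> x \<in> carrier G \<Longrightarrow> conj_by g (conj_by h x) = conj_by (g \<otimes> h) x"
  by (simp add: conj_by_def inv_mult_group m_assoc)

lemma conj_by_unit [simp]: "x \<in> carrier G \<Longrightarrow> conj_by \<one> x = x"
  by (simp add: conj_by_def)

lemma conj_by_inv_cancel [simp]:
  "g \<in> carrier G \<Longrightarrow> x \<in> carrier G \<Longrightarrow> conj_by (inv g) (conj_by g x) = x"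
  "g \<in> carrier G \<Longrightarrow> x \<in> carrier G \<Longrightarrow> conj_by g (conj_by (inv g) x) = x"
  by (simp_all add: conj_by_conj_by)

lemma conj_by_swap: "g \<in> carrier G \<Longrightarrow> x \<in> carrier G \<Longrightarrow> g \<otimes> x = conj_by g x \<otimes> g"
  by (simp add: conj_by_def m_assoc)

lemma conj_by_eqI:
  "g \<in> carrier G \<Longrightarrow> x \<in> carrier G \<Longrightarrow> y \<in> carrier G \<Longrightarrow> g \<otimes> x = y \<otimes> g \<Longrightarrow> conj_by g x = y"
  by (simp add: conj_by_def m_assoc)

lemma conj_by_fixed_inv:
  "g \<in> carrier G \<Longrightarrow> x \<in> carrier G \<Longrightarrow> conj_by g x = x \<Longrightarrow> conj_by (inv g) x = x"
  by (metis conj_by_inv_cancel(1))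

lemma conj_by_generate:
  assumes S: "S \<subseteq> carrier G" and H: "subgroup H G" and g: "g \<in> carrier G"
    and gen: "\<And>x. x \<in> S \<Longrightarrow> conj_by g x \<in> H" and x: "x \<in> generate G S"
  shows "conj_by g x \<in> H"
  using x
proof induction
  case one
  then show ?case using g subgroup.one_closed[OF H] by simp
next
  case (incl h)
  then show ?case by (rule gen)
next
  case (inv h)
  then show ?case using gen[of h] g S subgroup.m_inv_closed[OF H] by (auto simp: conj_by_inv)
next
  case (eng h1 h2)
  then have "h1 \<in> carrier G" "h2 \<in> carrier G" using generate_in_carrier[OF S] by auto
  then show ?case using eng subgroup.m_closed[OF H] g by (simp add: conj_by_mult)
qed

text \<open>Inverses of generators are treated separately, because conjugation could map
  \<open>H\<close> properly into itself.\<close>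

lemma generate_conj_closed:
  assumes S: "S \<subseteq> carrier G" and H: "subgroup H G"
    and gen: "\<And>g x. g \<in> S \<Longrightarrow> x \<in> H \<Longrightarrow> conj_by g x \<in> H \<and> conj_by (inv g) x \<in> H"
    and g: "g \<in> generate G S" and x: "x \<in> H"
  shows "conj_by g x \<in> H"
  using g x
proof (induction arbitrary: x)
  case one
  then show ?case using subgroup.mem_carrier[OF H] by simp
next
  case (incl h)
  then show ?case using gen by blast
next
  case (inv h)
  then show ?case using gen by blast
next
  case (eng h1 h2)
  then have "h1 \<in> carrier G" "h2 \<in> carrier G" "x \<in> carrier G"
    using generate_in_carrier[OF S] subgroup.mem_carrier[OF H] by auto
  then show ?case using eng by (simp flip: conj_by_conj_by)
qed

end

text \<open>What follows uses only the relations and so holds in any group with such elements;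
  freeness will require an action in addition.\<close>

locale braid_generators = group G for G :: "('g, 'm) monoid_scheme" (structure) +
  fixes n :: nat and \<sigma> :: "nat \<Rightarrow> 'g"
  assumes \<sigma>_carrier: "\<And>i. 1 \<le> i \<Longrightarrow> i < n \<Longrightarrow> \<sigma> i \<in> carrier G"
    and far: "\<And>i j. 1 \<le> i \<Longrightarrow> i < n \<Longrightarrow> 1 \<le> j \<Longrightarrow> j < n \<Longrightarrow> i + 2 \<le> j \<or> j + 2 \<le> i \<Longrightarrow> \<sigma> i \<otimes> \<sigma> j = \<sigma> j \<otimes> \<sigma> i"
    and braid: "\<And>i. 1 \<le> i \<Longrightarrow> i + 1 < n \<Longrightarrow> \<sigma> i \<otimes> \<sigma> (i + 1) \<otimes> \<sigma> i = \<sigma> (i + 1) \<otimes> \<sigma> i \<otimes> \<sigma> (i + 1)"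
begin

primrec strand :: "nat \<Rightarrow> nat \<Rightarrow> 'g" where
  "strand i 0 = \<sigma> i \<otimes> \<sigma> i"
| "strand i (Suc d) = conj_by (\<sigma> (i + Suc d)) (strand i d)"

definition s :: "nat \<Rightarrow> nat \<Rightarrow> 'g" where
  "s j i = strand i (j - Suc i)"

lemma s_adjacent: "s (Suc i) i = \<sigma> i \<otimes> \<sigma> i"
  by (simp add: s_def)

lemma s_Suc: "i < j \<Longrightarrow> s (Suc j) i = conj_by (\<sigma> j) (s j i)"
proof -
  assume "i < j"
  then obtain d where "j = Suc (i + d)" using less_iff_Suc_add by auto
  then show ?thesis by (simp add: s_def Suc_diff_le)
qed

lemma s_carrier: "1 \<le> i \<Longrightarrow> i < j \<Longrightarrow> j \<le> n \<Longrightarrow> s j i \<in> carrier G"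
proof (induction j)
  case (Suc j)
  show ?case
  proof (cases "i = j")
    case True
    then show ?thesis using Suc.prems \<sigma>_carrier by (simp add: s_adjacent)
  next
    case False
    then show ?thesis using Suc \<sigma>_carrier[of j] by (simp add: s_Suc)
  qed
qed simp

lemma conj_far:
  assumes "1 \<le> i" "i < n" "1 \<le> j" "j < n" "i + 2 \<le> j \<or> j + 2 \<le> i" "x \<in> carrier G"
  shows "conj_by (\<sigma> i) (conj_by (\<sigma> j) x) = conj_by (\<sigma> j) (conj_by (\<sigma> i) x)"
  using assms far[of i j] \<sigma>_carrier by (simp add: conj_by_conj_by)

lemma conj_far_\<sigma>:
  assumes "1 \<le> i" "i < n" "1 \<le> j" "j < n" "i + 2 \<le> j \<or> j + 2 \<le> i"
  shows "conj_by (\<sigma> i) (\<sigma> j) = \<sigma> j"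
  using assms far[of i j] \<sigma>_carrier by (intro conj_by_eqI) auto

lemma conj_braid:
  assumes "1 \<le> i" "i + 1 < n"
  shows "conj_by (\<sigma> i) (conj_by (\<sigma> (i + 1)) (\<sigma> i)) = \<sigma> (i + 1)"
    "conj_by (\<sigma> (i + 1)) (conj_by (\<sigma> i) (\<sigma> (i + 1))) = \<sigma> i"
proof -
  have c: "\<sigma> i \<in> carrier G" "\<sigma> (i + 1) \<in> carrier G" using assms \<sigma>_carrier by auto
  show "conj_by (\<sigma> i) (conj_by (\<sigma> (i + 1)) (\<sigma> i)) = \<sigma> (i + 1)"
    unfolding conj_by_conj_by[OF c(1,2,1)] using c braid[OF assms]
    by (intro conj_by_eqI) (simp_all add: m_assoc)
  show "conj_by (\<sigma> (i + 1)) (conj_by (\<sigma> i) (\<sigma> (i + 1))) = \<sigma> i"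
    unfolding conj_by_conj_by[OF c(2,1,2)] using c braid[OF assms]
    by (intro conj_by_eqI) (simp_all add: m_assoc)
qed

lemma conj_s_above:
  assumes "1 \<le> i" "i < j" "j < k" "k < n"
  shows "conj_by (\<sigma> k) (s j i) = s j i"
  using assms
proof (induction j)
  case (Suc j)
  have c: "\<sigma> k \<in> carrier G" "\<sigma> i \<in> carrier G" using Suc.prems \<sigma>_carrier by auto
  show ?case
  proof (cases "i = j")
    case True
    then show ?thesis using Suc.prems c conj_far_\<sigma>[of k i] by (simp add: s_adjacent conj_by_mult)
  next
    case False
    then have sc: "s j i \<in> carrier G" using Suc.prems by (intro s_carrier) auto
    have "conj_by (\<sigma> k) (s (Suc j) i) = conj_by (\<sigma> j) (conj_by (\<sigma> k) (s j i))"
      using False Suc.prems sc by (simp add: s_Suc conj_far)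
    then show ?thesis using False Suc by (simp add: s_Suc)
  qed
qed simp

lemma conj_s_below:
  assumes "1 \<le> k" "k + 1 < i" "i < j" "j \<le> n"
  shows "conj_by (\<sigma> k) (s j i) = s j i"
  using assms
proof (induction j)
  case (Suc j)
  have c: "\<sigma> k \<in> carrier G" "\<sigma> i \<in> carrier G" using Suc.prems \<sigma>_carrier by auto
  show ?case
  proof (cases "i = j")
    case True
    then show ?thesis using Suc.prems c conj_far_\<sigma>[of k i] by (simp add: s_adjacent conj_by_mult)
  next
    case False
    then have sc: "s j i \<in> carrier G" using Suc.prems by (intro s_carrier) auto
    have "conj_by (\<sigma> k) (s (Suc j) i) = conj_by (\<sigma> j) (conj_by (\<sigma> k) (s j i))"
      using False Suc.prems sc by (simp add: s_Suc conj_far)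
    then show ?thesis using False Suc by (simp add: s_Suc)
  qed
qed simp

text \<open>Conjugation by \<open>\<sigma> k\<close> commutes with passing from \<open>s j\<close> to \<open>s (Suc j)\<close> when
  \<open>k + 2 \<le> j\<close>, so the following identities only need to be checked for \<open>j = k + 2\<close>.\<close>

lemma conj_s_between:
  assumes "1 \<le> i" "i < k" "k + 1 < j" "j \<le> n"
  shows "conj_by (\<sigma> k) (s j i) = s j i"
  using assms
proof (induction j)
  case (Suc j)
  have c: "\<sigma> k \<in> carrier G" "\<sigma> j \<in> carrier G" using Suc.prems \<sigma>_carrier by auto
  show ?case
  proof (cases "j = k + 1")
    case True
    have sc: "s k i \<in> carrier G" using Suc.prems by (intro s_carrier) auto
    have k: "1 \<le> k" "k + 1 < n" using Suc.prems by auto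
    have sj: "s (Suc j) i = conj_by (\<sigma> (k + 1)) (conj_by (\<sigma> k) (s k i))"
      using Suc.prems True by (simp add: s_Suc)
    \<comment> \<open>The braid relation turns the new conjugation by \<open>\<sigma> k\<close> into
      an innermost one by \<open>\<sigma> (k + 1)\<close>, which fixes \<open>s k i\<close>.\<close>
    have "conj_by (\<sigma> k) (s (Suc j) i) = conj_by (\<sigma> k \<otimes> \<sigma> (k + 1) \<otimes> \<sigma> k) (s k i)"
      unfolding sj using c sc True by (simp add: conj_by_conj_by m_assoc)
    also have "\<dots> = conj_by (\<sigma> (k + 1)) (conj_by (\<sigma> k) (conj_by (\<sigma> (k + 1)) (s k i)))"
      using c sc True unfolding braid[OF k] by (simp add: conj_by_conj_by m_assoc)
    also have "\<dots> = s (Suc j) i" using Suc.prems conj_s_above[of i k "k + 1"] by (simp add: sj)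
    finally show ?thesis .
  next
    case False
    then have sc: "s j i \<in> carrier G" using Suc.prems by (intro s_carrier) auto
    have "conj_by (\<sigma> k) (s (Suc j) i) = conj_by (\<sigma> j) (conj_by (\<sigma> k) (s j i))"
      using False Suc.prems sc by (simp add: s_Suc conj_far)
    then show ?thesis using False Suc by (simp add: s_Suc)
  qed
qed simp

lemma conj_s_same:
  assumes "1 \<le> i" "i + 1 < j" "j \<le> n"
  shows "conj_by (\<sigma> i) (s j i) = s j (i + 1)"
  using assms
proof (induction j)
  case (Suc j)
  have c: "\<sigma> i \<in> carrier G" "\<sigma> j \<in> carrier G" "\<sigma> (i + 1) \<in> carrier G" using Suc.prems \<sigma>_carrier by auto
  show ?case
  proof (cases "j = i + 1")
    case True
    then show ?thesis using Suc.prems c conj_braid(1)[of i]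
      by (simp add: s_Suc s_adjacent conj_by_mult)
  next
    case False
    then have sc: "s j i \<in> carrier G" using Suc.prems by (intro s_carrier) auto
    have "conj_by (\<sigma> i) (s (Suc j) i) = conj_by (\<sigma> j) (conj_by (\<sigma> i) (s j i))"
      using False Suc.prems sc by (simp add: s_Suc conj_far)
    then show ?thesis using False Suc by (simp add: s_Suc)
  qed
qed simp

lemma conj_s_next:
  assumes "1 \<le> i" "i + 1 < j" "j \<le> n"
  shows "conj_by (\<sigma> i) (s j (i + 1)) = conj_by (inv (s j (i + 1))) (s j i)"
  using assms
proof (induction j)
  case (Suc j)
  have c: "\<sigma> i \<in> carrier G" "\<sigma> j \<in> carrier G" "\<sigma> (i + 1) \<in> carrier G" using Suc.prems \<sigma>_carrier by auto
  show ?case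
  proof (cases "j = i + 1")
    case True
    let ?t = "\<sigma> (i + 1)"
    have "conj_by ?t (conj_by (\<sigma> i) (?t \<otimes> ?t)) = \<sigma> i \<otimes> \<sigma> i"
      using Suc.prems c conj_braid(2)[of i] by (simp add: conj_by_mult)
    then have "conj_by (inv ?t) (conj_by ?t (conj_by (\<sigma> i) (?t \<otimes> ?t))) = conj_by (inv ?t) (\<sigma> i \<otimes> \<sigma> i)"
      by (simp only:)
    then have 1: "conj_by (\<sigma> i) (?t \<otimes> ?t) = conj_by (inv ?t) (\<sigma> i \<otimes> \<sigma> i)" using c by simp
    have "conj_by (inv (?t \<otimes> ?t)) (conj_by ?t (\<sigma> i \<otimes> \<sigma> i)) = conj_by (inv ?t) (\<sigma> i \<otimes> \<sigma> i)"
      using c by (simp add: conj_by_conj_by inv_mult_group m_assoc)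
    then show ?thesis using 1 True by (simp add: s_Suc s_adjacent)
  next
    case False
    then have sc: "s j i \<in> carrier G" "s j (i + 1) \<in> carrier G" using Suc.prems by (auto intro!: s_carrier)
    have "conj_by (\<sigma> i) (s (Suc j) (i + 1)) = conj_by (\<sigma> j) (conj_by (\<sigma> i) (s j (i + 1)))"
      using False Suc.prems sc by (simp add: s_Suc conj_far)
    also have "\<dots> = conj_by (\<sigma> j) (conj_by (inv (s j (i + 1))) (s j i))"
      using False Suc by simp
    also have "\<dots> = conj_by (inv (conj_by (\<sigma> j) (s j (i + 1)))) (conj_by (\<sigma> j) (s j i))"
      using c sc by (simp add: conj_by_def inv_mult_group m_assoc) (simp add: m_assoc[symmetric])
    finally show ?thesis using False Suc.prems by (simp add: s_Suc)
  qed
qed simp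

section \<open>The subgroups \<open>F\<close>, \<open>P\<close>, \<open>B\<close> and their
  normality relations\<close>

definition F :: "nat \<Rightarrow> 'g set" where
  "F k = generate G (s (Suc k) ` {1..k})"

definition P :: "nat \<Rightarrow> 'g set" where
  "P m = generate G {s j i |i j. 1 \<le> i \<and> i < j \<and> j \<le> m}"

definition B :: "nat \<Rightarrow> 'g set" where
  "B m = generate G (\<sigma> ` {1..<m})"

lemma gens_carrier:
  "k < n \<Longrightarrow> s (Suc k) ` {1..k} \<subseteq> carrier G"
  "m \<le> n \<Longrightarrow> {s j i |i j. 1 \<le> i \<and> i < j \<and> j \<le> m} \<subseteq> carrier G"
  "m \<le> n \<Longrightarrow> \<sigma> ` {1..<m} \<subseteq> carrier G"
  using s_carrier \<sigma>_carrier by auto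

lemma subgroup_F: "k < n \<Longrightarrow> subgroup (F k) G"
  unfolding F_def by (intro generate_is_subgroup gens_carrier)

lemma subgroup_P: "m \<le> n \<Longrightarrow> subgroup (P m) G"
  unfolding P_def by (intro generate_is_subgroup gens_carrier)

lemma subgroup_B: "m \<le> n \<Longrightarrow> subgroup (B m) G"
  unfolding B_def by (intro generate_is_subgroup gens_carrier)

lemma F_carrier: "k < n \<Longrightarrow> x \<in> F k \<Longrightarrow> x \<in> carrier G"
  by (rule subgroup.mem_carrier[OF subgroup_F])

lemma P_carrier: "m \<le> n \<Longrightarrow> x \<in> P m \<Longrightarrow> x \<in> carrier G"
  by (rule subgroup.mem_carrier[OF subgroup_P])

lemma s_in_F: "1 \<le> i \<Longrightarrow> i < j \<Longrightarrow> s j i \<in> F (j - 1)"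
  unfolding F_def by (rule generate.incl) auto

lemma s_in_P: "1 \<le> i \<Longrightarrow> i < j \<Longrightarrow> j \<le> m \<Longrightarrow> s j i \<in> P m"
  unfolding P_def by (rule generate.incl) auto

lemma \<sigma>_in_B: "1 \<le> i \<Longrightarrow> i < m \<Longrightarrow> \<sigma> i \<in> B m"
  unfolding B_def by (rule generate.incl) auto

lemma F_subset_P: "k < m \<Longrightarrow> F k \<subseteq> P m"
  unfolding F_def P_def
proof (intro mono_generate image_subsetI CollectI)
  show "\<exists>i j. s (Suc k) x = s j i \<and> 1 \<le> i \<and> i < j \<and> j \<le> m" if "k < m" "x \<in> {1..k}" for x
    using that by (intro exI[of _ x] exI[of _ "Suc k"]) auto
qed

lemma P_mono: "m \<le> m' \<Longrightarrow> P m \<subseteq> P m'"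
  unfolding P_def
proof (intro mono_generate subsetI CollectI)
  fix x assume "m \<le> m'" "x \<in> {s j i |i j. 1 \<le> i \<and> i < j \<and> j \<le> m}"
  then obtain i j where "x = s j i" "1 \<le> i" "i < j" "j \<le> m" "m \<le> m'" by auto
  then show "\<exists>i j. x = s j i \<and> 1 \<le> i \<and> i < j \<and> j \<le> m'"
    by (intro exI[of _ i] exI[of _ j]) auto
qed

lemma B_mono: "m \<le> m' \<Longrightarrow> B m \<subseteq> B m'"
  unfolding B_def by (rule mono_generate) auto

lemma s_in_B: "1 \<le> i \<Longrightarrow> i < j \<Longrightarrow> j \<le> n \<Longrightarrow> s j i \<in> B j"
proof (induction j)
  case (Suc j)
  note B = subgroup_B[OF \<open>Suc j \<le> n\<close>]
  have \<sigma>j: "\<sigma> j \<in> B (Suc j)" using Suc.prems by (intro \<sigma>_in_B) auto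
  show ?case
  proof (cases "i = j")
    case True
    then show ?thesis using \<sigma>j subgroup.m_closed[OF B] by (simp add: s_adjacent)
  next
    case False
    then have "s j i \<in> B (Suc j)" using Suc B_mono[of j "Suc j"] by auto
    then show ?thesis
      using \<sigma>j subgroup.m_closed[OF B] subgroup.m_inv_closed[OF B] False Suc.prems
      by (simp add: s_Suc conj_by_def)
  qed
qed simp

lemma P_subset_B: "m \<le> n \<Longrightarrow> P m \<subseteq> B m"
  unfolding P_def
proof (rule generate_subgroup_incl[OF _ subgroup_B])
  show "{s j i |i j. 1 \<le> i \<and> i < j \<and> j \<le> m} \<subseteq> B m" if "m \<le> n"
    using s_in_B B_mono that by fastforce
qed

lemma conj_\<sigma>_s_in_F:
  assumes "1 \<le> k" "k + 1 < j" "j \<le> n" "1 \<le> i" "i < j"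
  shows "conj_by (\<sigma> k) (s j i) \<in> F (j - 1)" "conj_by (inv (\<sigma> k)) (s j i) \<in> F (j - 1)"
proof -
  have sg: "subgroup (F (j - 1)) G" using assms by (intro subgroup_F) auto
  note cl = subgroup.m_closed[OF sg] subgroup.m_inv_closed[OF sg]
  have c: "\<sigma> k \<in> carrier G" "s j i \<in> carrier G" using assms by (auto intro!: \<sigma>_carrier s_carrier)
  have sF: "s j i \<in> F (j - 1)" if "1 \<le> i" "i < j" for i using that by (rule s_in_F)
  consider "k + 1 < i" | "i < k" | "i = k" | "i = k + 1" using assms by linarith
  then have "conj_by (\<sigma> k) (s j i) \<in> F (j - 1) \<and> conj_by (inv (\<sigma> k)) (s j i) \<in> F (j - 1)"
  proof cases
    case 1
    then have "conj_by (\<sigma> k) (s j i) = s j i" using assms by (intro conj_s_below) auto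
    then show ?thesis using conj_by_fixed_inv[OF c] sF assms by simp
  next
    case 2
    then have "conj_by (\<sigma> k) (s j i) = s j i" using assms by (intro conj_s_between) auto
    then show ?thesis using conj_by_fixed_inv[OF c] sF assms by simp
  next
    case 3
    let ?x = "s j k" and ?y = "s j (k + 1)"
    have xy: "?x \<in> carrier G" "?y \<in> carrier G" using assms by (auto intro!: s_carrier)
    have 1: "conj_by (\<sigma> k) ?x = ?y" using assms by (intro conj_s_same) auto
    \<comment> \<open>Applying the inverse conjugation to this relation, and using that it takes
      \<open>?y\<close> to \<open>?x\<close>, exhibits the image of \<open>?x\<close> as the
      conjugate of \<open>?y\<close> by \<open>?x\<close>.\<close>
    have "conj_by (\<sigma> k) ?y = conj_by (inv ?y) ?x" using assms by (intro conj_s_next) auto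
    then have "conj_by ?y (conj_by (\<sigma> k) ?y) = ?x" using xy by simp
    then have "conj_by (inv (\<sigma> k)) ?x = conj_by (inv (\<sigma> k)) (conj_by ?y (conj_by (\<sigma> k) ?y))" by simp
    also have "\<dots> = conj_by (conj_by (inv (\<sigma> k)) ?y) ?y"
      using c xy by (simp add: conj_by_def inv_mult_group m_assoc)
    also have "conj_by (inv (\<sigma> k)) ?y = ?x" using 1 c xy by (metis conj_by_inv_cancel(1))
    finally have "conj_by (inv (\<sigma> k)) ?x = conj_by ?x ?y" .
    then show ?thesis using 3 1 sF[of k] sF[of "k + 1"] assms cl by (simp add: conj_by_def)
  next
    case 4
    let ?x = "s j k" and ?y = "s j (k + 1)"
    have xy: "?x \<in> carrier G" "?y \<in> carrier G" using assms by (auto intro!: s_carrier)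
    have 1: "conj_by (\<sigma> k) ?x = ?y" using assms by (intro conj_s_same) auto
    have 2: "conj_by (\<sigma> k) ?y = conj_by (inv ?y) ?x" using assms by (intro conj_s_next) auto
    have "conj_by (inv (\<sigma> k)) ?y = ?x" using 1 c xy by (metis conj_by_inv_cancel(1))
    then show ?thesis using 4 2 xy sF[of k] sF[of "k + 1"] assms cl by (simp add: conj_by_def)
  qed
  then show "conj_by (\<sigma> k) (s j i) \<in> F (j - 1)" "conj_by (inv (\<sigma> k)) (s j i) \<in> F (j - 1)" by auto
qed

text \<open>Normality under \<open>P k\<close> is obtained from the larger group \<open>B k\<close>,
  because conjugation by a single \<open>\<sigma> l\<close> is explicit on the generators of
  \<open>F k\<close>.\<close>

lemma F_normal:
  assumes k: "k < n" and g: "g \<in> B k" and x: "x \<in> F k"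
  shows "conj_by g x \<in> F k"
proof (rule generate_conj_closed[OF gens_carrier(3)[of k] subgroup_F[OF k] _ g[unfolded B_def] x])
  fix h x assume h: "h \<in> \<sigma> ` {1..<k}" and x: "x \<in> F k"
  then obtain l where l: "h = \<sigma> l" "1 \<le> l" "l < k" by auto
  have hc: "h \<in> carrier G" using l k by (auto intro!: \<sigma>_carrier)
  show "conj_by h x \<in> F k \<and> conj_by (inv h) x \<in> F k"
  proof
    show "conj_by h x \<in> F k"
      by (rule conj_by_generate[OF gens_carrier(1)[OF k] subgroup_F[OF k] hc _ x[unfolded F_def]])
        (use conj_\<sigma>_s_in_F(1)[of l "Suc k"] l k in auto)
    show "conj_by (inv h) x \<in> F k"
      by (rule conj_by_generate[OF gens_carrier(1)[OF k] subgroup_F[OF k] inv_closed[OF hc] _ x[unfolded F_def]])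
        (use conj_\<sigma>_s_in_F(2)[of l "Suc k"] l k in auto)
  qed
qed (use k in auto)

text \<open>Each generator lies in \<open>F m\<close> or in \<open>P m\<close>, and in a product the
  factor from \<open>P m\<close> moves to the right because it normalizes
  \<open>F m\<close>.\<close>

lemma P_decomposition:
  assumes m: "Suc m \<le> n" and x: "x \<in> P (Suc m)"
  shows "\<exists>f\<in>F m. \<exists>q\<in>P m. x = f \<otimes> q"
proof -
  have sF: "subgroup (F m) G" and sP: "subgroup (P m) G" using m by (auto intro!: subgroup_F subgroup_P)
  note cl = subgroup.m_closed[OF sF] subgroup.m_closed[OF sP] subgroup.one_closed[OF sF]
    subgroup.one_closed[OF sP] subgroup.m_inv_closed[OF sF] subgroup.m_inv_closed[OF sP]
  have car: "y \<in> carrier G" if "y \<in> F m \<or> y \<in> P m" for y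
    using that F_carrier[of m y] P_carrier[of m y] m by auto
  have gen: "y \<in> F m \<or> y \<in> P m" if "y \<in> {s j i |i j. 1 \<le> i \<and> i < j \<and> j \<le> Suc m}" for y
  proof -
    obtain i j where ij: "y = s j i" "1 \<le> i" "i < j" "j \<le> Suc m" using \<open>y \<in> _\<close> by auto
    show ?thesis
    proof (cases "j = Suc m")
      case True
      then show ?thesis using s_in_F[of i j] ij by auto
    next
      case False
      then show ?thesis using s_in_P[of i j m] ij by auto
    qed
  qed
  have single: "\<exists>f\<in>F m. \<exists>q\<in>P m. y = f \<otimes> q" if "y \<in> F m \<or> y \<in> P m" for y
  proof (cases "y \<in> F m")
    case True
    then show ?thesis using cl(4) car by (metis r_one)
  next
    case False
    then have "y \<in> P m" using that by simp
    then show ?thesis using cl(3) car by (metis l_one)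
  qed
  show ?thesis
    using x unfolding P_def[of "Suc m"]
  proof induction
    case one
    then show ?case using cl(3,4) by (metis l_one one_closed)
  next
    case (incl h)
    then show ?case using gen single by blast
  next
    case (inv h)
    then have "inv h \<in> F m \<or> inv h \<in> P m" using gen cl by blast
    then show ?case by (rule single)
  next
    case (eng h1 h2)
    then obtain f q f' q' where d: "f \<in> F m" "q \<in> P m" "h1 = f \<otimes> q" "f' \<in> F m" "q' \<in> P m" "h2 = f' \<otimes> q'"
      by blast
    have c: "f \<in> carrier G" "q \<in> carrier G" "f' \<in> carrier G" "q' \<in> carrier G" using d car by auto
    have "q \<in> B m" using d P_subset_B[of m] m by auto
    then have "conj_by q f' \<in> F m" using F_normal[of m q f'] m d by auto
    moreover have "h1 \<otimes> h2 = (f \<otimes> conj_by q f') \<otimes> (q \<otimes> q')"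
      using c d(3,6) by (simp add: conj_by_def m_assoc) (simp add: m_assoc[symmetric])
    ultimately show ?case using d cl by blast
  qed
qed

lemma \<sigma>_square_in_P: "1 \<le> k \<Longrightarrow> k < n \<Longrightarrow> \<sigma> k \<otimes> \<sigma> k \<in> P n"
  using s_in_P[of k "Suc k" n] by (simp add: s_adjacent)

lemma conj_\<sigma>_s_in_P:
  assumes "1 \<le> k" "k < n" "1 \<le> i" "i < j" "j \<le> n"
  shows "conj_by (\<sigma> k) (s j i) \<in> P n"
proof -
  have sP: "subgroup (P n) G" by (rule subgroup_P) simp
  have c: "\<sigma> k \<in> carrier G" "s j i \<in> carrier G" using assms by (auto intro!: \<sigma>_carrier s_carrier)
  consider "k + 1 < j" | "j < k" | "k = j" | "j = k + 1" "i = k" | "j = k + 1" "i < k" using assms by linarith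
  then show ?thesis
  proof cases
    case 1
    then have "conj_by (\<sigma> k) (s j i) \<in> F (j - 1)" using assms by (intro conj_\<sigma>_s_in_F) auto
    moreover have "j - 1 < n" using assms by linarith
    ultimately show ?thesis using F_subset_P by blast
  next
    case 2
    then show ?thesis using conj_s_above[of i j k] s_in_P[of i j n] assms by simp
  next
    case 3
    then show ?thesis using s_in_P[of i "Suc j" n] assms by (simp add: s_Suc)
  next
    case 4
    have "conj_by (\<sigma> k) (\<sigma> k) = \<sigma> k" using c by (intro conj_by_eqI) auto
    then show ?thesis using 4 c \<sigma>_square_in_P[of k] assms by (simp add: s_adjacent conj_by_mult)
  next
    case 5
    then have "conj_by (\<sigma> k) (s j i) = conj_by (\<sigma> k \<otimes> \<sigma> k) (s k i)"
      using c assms s_carrier[of i k] by (simp add: s_Suc conj_by_conj_by)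
    then show ?thesis
      using \<sigma>_square_in_P[of k] s_in_P[of i k n] assms 5
        subgroup.m_closed[OF sP] subgroup.m_inv_closed[OF sP] by (simp add: conj_by_def)
  qed
qed

text \<open>A generator and its inverse differ by the square
  \<open>\<sigma> l \<otimes> \<sigma> l\<close>, which is pure, so conjugation has to be computed
  for the generator only.\<close>

lemma P_normal:
  assumes g: "g \<in> B n" and x: "x \<in> P n"
  shows "conj_by g x \<in> P n"
proof (rule generate_conj_closed[OF gens_carrier(3)[of n] subgroup_P[of n] _ g[unfolded B_def] x])
  fix h x assume h: "h \<in> \<sigma> ` {1..<n}" and x: "x \<in> P n"
  then obtain l where l: "h = \<sigma> l" "1 \<le> l" "l < n" by auto
  have hc: "h \<in> carrier G" using l by (auto intro!: \<sigma>_carrier)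
  have sP: "subgroup (P n) G" by (rule subgroup_P) simp
  have xc: "x \<in> carrier G" using P_carrier x by blast
  have 1: "conj_by h x \<in> P n"
    by (rule conj_by_generate[OF gens_carrier(2)[of n] sP hc _ x[unfolded P_def]])
      (use conj_\<sigma>_s_in_P l in auto)
  have hh: "h \<otimes> h \<in> P n" using \<sigma>_square_in_P l by simp
  have "conj_by (inv h) x = conj_by (inv (h \<otimes> h)) (conj_by h x)"
    using hc xc by (simp add: conj_by_conj_by inv_mult_group m_assoc)
  also have "\<dots> \<in> P n"
    using 1 hh hc subgroup.m_closed[OF sP] subgroup.m_inv_closed[OF sP] by (simp add: conj_by_def)
  finally show "conj_by h x \<in> P n \<and> conj_by (inv h) x \<in> P n" using 1 by blast
qed auto

end

section \<open>Finiteness of the index of the pure braid group\<close>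

context braid_generators
begin

text \<open>The product \<open>\<sigma> m \<cdots> \<sigma> (m - d + 1)\<close>.\<close>

primrec descent :: "nat \<Rightarrow> nat \<Rightarrow> 'g" where
  "descent m 0 = \<one>"
| "descent m (Suc d) = descent m d \<otimes> \<sigma> (m - d)"

lemma descent_in_B: "d \<le> m \<Longrightarrow> m < n \<Longrightarrow> descent m d \<in> B n"
proof (induction d)
  case 0
  then show ?case using subgroup.one_closed[OF subgroup_B[of n]] by simp
next
  case (Suc d)
  have "descent m d \<in> B n" using Suc.prems by (intro Suc.IH) auto
  moreover have "\<sigma> (m - d) \<in> B n" using Suc.prems by (intro \<sigma>_in_B) auto
  ultimately show ?case using subgroup.m_closed[OF subgroup_B[of n]] by simp
qed

lemma B_carrier: "m \<le> n \<Longrightarrow> x \<in> B m \<Longrightarrow> x \<in> carrier G"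
  by (rule subgroup.mem_carrier[OF subgroup_B])

lemma descent_carrier: "d \<le> m \<Longrightarrow> m < n \<Longrightarrow> descent m d \<in> carrier G"
  by (rule B_carrier[OF le_refl descent_in_B])

lemma descent_low:
  "m < n \<Longrightarrow> 1 \<le> i \<Longrightarrow> i + d < m \<Longrightarrow> descent m d \<otimes> \<sigma> i = \<sigma> i \<otimes> descent m d"
proof (induction d)
  case 0
  then show ?case using \<sigma>_carrier[of i] by simp
next
  case (Suc d)
  have c: "descent m d \<in> carrier G" "\<sigma> i \<in> carrier G" "\<sigma> (m - d) \<in> carrier G"
    using Suc.prems by (auto intro!: descent_carrier \<sigma>_carrier)
  have IH: "descent m d \<otimes> \<sigma> i = \<sigma> i \<otimes> descent m d" using Suc.prems by (intro Suc.IH) auto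
  have f: "\<sigma> (m - d) \<otimes> \<sigma> i = \<sigma> i \<otimes> \<sigma> (m - d)" using Suc.prems by (intro far) auto
  have "descent m (Suc d) \<otimes> \<sigma> i = (descent m d \<otimes> \<sigma> i) \<otimes> \<sigma> (m - d)" using c f by (simp add: m_assoc)
  then show ?case using c by (simp add: IH m_assoc)
qed

text \<open>The braid relation is applied once, at the two adjacent factors with indices
  \<open>i\<close> and \<open>i - 1\<close>; the other factors commute with what passes
  them.\<close>

lemma descent_high:
  "m < n \<Longrightarrow> d \<le> m \<Longrightarrow> m + 1 < i + d \<Longrightarrow> i \<le> m \<Longrightarrow>
    descent m d \<otimes> \<sigma> i = \<sigma> (i - 1) \<otimes> descent m d"
proof (induction d)
  case (Suc d)
  let ?j = "m - d"
  have c: "descent m d \<in> carrier G" "\<sigma> i \<in> carrier G" "\<sigma> ?j \<in> carrier G" "\<sigma> (i - 1) \<in> carrier G"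
    using Suc.prems by (auto intro!: descent_carrier \<sigma>_carrier)
  show ?case
  proof (cases "i = Suc ?j")
    case True
    then obtain e where e: "d = Suc e" using Suc.prems by (cases d) auto
    have i: "i = m - e" "?j + 1 = i" "i - 1 = ?j" using True e Suc.prems by auto
    have c2: "descent m e \<in> carrier G" using Suc.prems e by (intro descent_carrier) auto
    have b: "\<sigma> ?j \<otimes> \<sigma> i \<otimes> \<sigma> ?j = \<sigma> i \<otimes> \<sigma> ?j \<otimes> \<sigma> i"
      using braid[of ?j] Suc.prems unfolding i(2) by auto
    have l: "descent m e \<otimes> \<sigma> ?j = \<sigma> ?j \<otimes> descent m e" using Suc.prems e by (intro descent_low) auto
    have d: "descent m (Suc d) = descent m e \<otimes> \<sigma> i \<otimes> \<sigma> ?j" unfolding descent.simps(2)[of m d] using e i by simp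
    have "descent m (Suc d) \<otimes> \<sigma> i = descent m e \<otimes> (\<sigma> i \<otimes> \<sigma> ?j \<otimes> \<sigma> i)"
      unfolding d using c c2 by (simp add: m_assoc)
    also have "\<dots> = descent m e \<otimes> \<sigma> ?j \<otimes> (\<sigma> i \<otimes> \<sigma> ?j)" unfolding b[symmetric] using c c2 by (simp add: m_assoc)
    also have "\<dots> = \<sigma> ?j \<otimes> descent m (Suc d)" unfolding d l using c c2 by (simp add: m_assoc)
    finally show ?thesis unfolding i(3) .
  next
    case False
    have IH: "descent m d \<otimes> \<sigma> i = \<sigma> (i - 1) \<otimes> descent m d" using Suc.prems False by (intro Suc.IH) auto
    have f: "\<sigma> ?j \<otimes> \<sigma> i = \<sigma> i \<otimes> \<sigma> ?j" using Suc.prems False by (intro far) auto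
    have "descent m (Suc d) \<otimes> \<sigma> i = (descent m d \<otimes> \<sigma> i) \<otimes> \<sigma> ?j" using c f by (simp add: m_assoc)
    then show ?thesis using c by (simp add: IH m_assoc)
  qed
qed simp

text \<open>The set \<open>X\<close> of these products contains the unit and is closed under right
  multiplication by the generators. It absorbs pure factors on the right too, as \<open>P n\<close>
  is normal; this disposes of squares and hence of inverses.\<close>

lemma B_Suc_descents:
  assumes m: "1 \<le> m" "m < n" and x: "x \<in> B (Suc m)"
  shows "\<exists>q\<in>P n. \<exists>b\<in>B m. \<exists>d\<in>{..m}. x = q \<otimes> b \<otimes> descent m d"
proof -
  have sP: "subgroup (P n) G" and sB: "subgroup (B m) G" and sBn: "subgroup (B n) G"
    using m by (auto intro!: subgroup_P subgroup_B)
  note cl = subgroup.m_closed[OF sP] subgroup.m_closed[OF sB] subgroup.one_closed[OF sP]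
    subgroup.one_closed[OF sB] subgroup.m_inv_closed[OF sP] subgroup.m_inv_closed[OF sB]
  have car: "q \<in> carrier G" "b \<in> carrier G" "d \<le> m \<Longrightarrow> descent m d \<in> carrier G"
    if "q \<in> P n" "b \<in> B m" for q b d
    using that m P_carrier[of n q] B_carrier[of m b] descent_carrier[of d m] by auto
  define X where "X = {q \<otimes> b \<otimes> descent m d |q b d. q \<in> P n \<and> b \<in> B m \<and> d \<le> m}"
  have XI: "q \<otimes> b \<otimes> descent m d \<in> X" if "q \<in> P n" "b \<in> B m" "d \<le> m" for q b d
    using that unfolding X_def by blast
  have XE: "\<exists>q b d. q \<in> P n \<and> b \<in> B m \<and> d \<le> m \<and> x = q \<otimes> b \<otimes> descent m d" if "x \<in> X" for x
    using that unfolding X_def by blast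
  have XB: "x \<in> B n" if xX: "x \<in> X" for x
  proof -
    obtain q b d where x: "q \<in> P n" "b \<in> B m" "d \<le> m" "x = q \<otimes> b \<otimes> descent m d" using XE[OF xX] by blast
    have "q \<in> B n" "b \<in> B n" "descent m d \<in> B n"
      using x P_subset_B[of n] B_mono[of m n] descent_in_B[of d m] m by auto
    then show ?thesis unfolding x(4) using subgroup.m_closed[OF sBn] by blast
  qed
  have Xc: "x \<in> carrier G" if "x \<in> X" for x using XB[OF that] B_carrier by blast
  have PX: "q \<otimes> x \<in> X" if q: "q \<in> P n" and xX: "x \<in> X" for q x
  proof -
    obtain q' b d where x: "q' \<in> P n" "b \<in> B m" "d \<le> m" "x = q' \<otimes> b \<otimes> descent m d" using XE[OF xX] by blast
    have "q \<otimes> x = (q \<otimes> q') \<otimes> b \<otimes> descent m d"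
      using car(1)[OF q x(2)] car[OF x(1,2)] x(3) by (simp add: x(4) m_assoc)
    then show ?thesis using XI[OF cl(1)[OF q x(1)] x(2,3)] by simp
  qed
  have XP: "y \<otimes> q \<in> X" if y: "y \<in> X" and q: "q \<in> P n" for y q
  proof -
    have "y \<otimes> q = conj_by y q \<otimes> y" using Xc[OF y] q P_carrier by (intro conj_by_swap) auto
    then show ?thesis using PX[OF P_normal[OF XB[OF y] q] y] by simp
  qed
  have X\<sigma>: "x \<otimes> \<sigma> i \<in> X" if x: "x \<in> X" and i: "1 \<le> i" "i \<le> m" for x i
  proof -
    obtain q b d where x': "q \<in> P n" "b \<in> B m" "d \<le> m" "x = q \<otimes> b \<otimes> descent m d" using XE[OF x] by blast
    have \<sigma>i: "\<sigma> i \<in> carrier G" using i m by (intro \<sigma>_carrier) auto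
    note c = car[OF x'(1,2)] \<sigma>i
    \<comment> \<open>In this order: the generator commutes past the descent into
      \<open>B m\<close>, lengthens it, shortens it by producing a pure square, or passes through it
      with its index lowered by one.\<close>
    consider "i + d < m" | "i + d = m" | "i + d = m + 1" | "m + 1 < i + d" by linarith
    then show ?thesis
    proof cases
      case 1
      have \<sigma>B: "\<sigma> i \<in> B m" using i 1 by (intro \<sigma>_in_B) auto
      have "descent m d \<otimes> \<sigma> i = \<sigma> i \<otimes> descent m d" using m i 1 by (intro descent_low) auto
      then have "x \<otimes> \<sigma> i = q \<otimes> (b \<otimes> \<sigma> i) \<otimes> descent m d" using c x'(3) by (simp add: x'(4) m_assoc)
      then show ?thesis using XI[OF x'(1) cl(2)[OF x'(2) \<sigma>B] x'(3)] by simp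
    next
      case 2
      then have i': "i = m - d" by simp
      have "x \<otimes> \<sigma> i = q \<otimes> b \<otimes> descent m (Suc d)" using c x'(3) by (simp add: x'(4) i' m_assoc)
      moreover have "Suc d \<le> m" using 2 i by simp
      ultimately show ?thesis using XI[OF x'(1,2), of "Suc d"] by (simp only:)
    next
      case 3
      then obtain e where e: "d = Suc e" "i = m - e" "e \<le> m" using i by (cases d) auto
      have ec: "descent m e \<in> carrier G" using e m by (intro descent_carrier) auto
      have "x \<otimes> \<sigma> i = (q \<otimes> b \<otimes> descent m e) \<otimes> (\<sigma> i \<otimes> \<sigma> i)"
        using c ec by (simp add: x'(4) e m_assoc)
      then show ?thesis using XP[OF XI[OF x'(1,2) e(3)] \<sigma>_square_in_P[of i]] i m by simp
    next
      case 4
      have \<sigma>B: "\<sigma> (i - 1) \<in> B m" using i 4 x'(3) by (intro \<sigma>_in_B) auto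
      have \<sigma>c: "\<sigma> (i - 1) \<in> carrier G" using m by (intro B_carrier[OF _ \<sigma>B]) simp
      have "descent m d \<otimes> \<sigma> i = \<sigma> (i - 1) \<otimes> descent m d" using m i 4 x'(3) by (intro descent_high) auto
      then have "x \<otimes> \<sigma> i = q \<otimes> (b \<otimes> \<sigma> (i - 1)) \<otimes> descent m d" using c \<sigma>c x'(3) by (simp add: x'(4) m_assoc)
      then show ?thesis using XI[OF x'(1) cl(2)[OF x'(2) \<sigma>B] x'(3)] by simp
    qed
  qed
  have closed: "\<forall>y\<in>X. y \<otimes> x \<in> X"
    using x unfolding B_def
  proof induction
    case one
    then show ?case using Xc by simp
  next
    case (incl h)
    then show ?case using X\<sigma> by auto
  next
    case (inv h)
    then obtain i where i: "h = \<sigma> i" "1 \<le> i" "i \<le> m" by auto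
    have c: "h \<in> carrier G" using i m \<sigma>_carrier[of i] by simp
    have hP: "inv (h \<otimes> h) \<in> P n" using \<sigma>_square_in_P[of i] i m cl(5) by simp
    show ?case
    proof
      fix y assume y: "y \<in> X"
      have yh: "y \<otimes> h \<in> X" using X\<sigma>[OF y] i by simp
      have "h \<otimes> inv (h \<otimes> h) = inv h" using c by (simp add: inv_mult_group m_assoc[symmetric])
      then have "y \<otimes> inv h = (y \<otimes> h) \<otimes> inv (h \<otimes> h)" using c Xc[OF y] by (simp add: m_assoc)
      then show "y \<otimes> inv h \<in> X" using XP[OF yh hP] by simp
    qed
  next
    case (eng h1 h2)
    have "h1 \<in> carrier G" "h2 \<in> carrier G"
      using eng.hyps generate_in_carrier[OF gens_carrier(3)[of "Suc m"]] m by auto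
    then show ?case using eng.IH Xc by (simp add: m_assoc[symmetric])
  qed
  have "\<one> \<in> X" using XI[OF cl(3,4), of 0] by simp
  moreover have "x \<in> carrier G" using m by (intro B_carrier[OF _ x]) simp
  ultimately have "x \<in> X" using closed by (metis l_one)
  from XE[OF this] show ?thesis by blast
qed

text \<open>Passing from \<open>m\<close> to \<open>m + 1\<close> strands multiplies the
  representatives by the \<open>m + 1\<close> descents.\<close>

lemma finite_P_transversal:
  "1 \<le> m \<Longrightarrow> m \<le> n \<Longrightarrow> \<exists>R. finite R \<and> R \<subseteq> carrier G \<and> (\<forall>x\<in>B m. \<exists>q\<in>P n. \<exists>r\<in>R. x = q \<otimes> r)"
proof (induction m)
  case (Suc m)
  have sP: "subgroup (P n) G" by (rule subgroup_P) simp
  show ?case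
  proof (cases "m = 0")
    case True
    then have "B (Suc m) = {\<one>}" by (simp add: B_def generate_empty)
    then show ?thesis
      using subgroup.one_closed[OF sP] by (intro exI[of _ "{\<one>}"]) (auto intro!: bexI[of _ "\<one>"])
  next
    case False
    then obtain R where R: "finite R" "R \<subseteq> carrier G" "\<forall>x\<in>B m. \<exists>q\<in>P n. \<exists>r\<in>R. x = q \<otimes> r"
      using Suc by auto
    have dc: "descent m d \<in> carrier G" if "d \<le> m" for d
      using that Suc.prems by (intro descent_carrier) auto
    let ?R = "(\<lambda>(r, d). r \<otimes> descent m d) ` (R \<times> {..m})"
    have "\<exists>q\<in>P n. \<exists>r\<in>?R. x = q \<otimes> r" if x: "x \<in> B (Suc m)" for x
    proof -
      obtain q b d where x': "q \<in> P n" "b \<in> B m" "d \<le> m" "x = q \<otimes> b \<otimes> descent m d"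
        using B_Suc_descents[OF _ _ x] False Suc.prems by auto
      obtain q' r where b: "q' \<in> P n" "r \<in> R" "b = q' \<otimes> r" using R(3) x'(2) by blast
      have c: "q \<in> carrier G" "q' \<in> carrier G" "r \<in> carrier G"
        using x' b R(2) by (auto intro: P_carrier)
      have "x = (q \<otimes> q') \<otimes> (r \<otimes> descent m d)" using c dc[OF x'(3)] by (simp add: x'(4) b(3) m_assoc)
      moreover have "r \<otimes> descent m d \<in> ?R" using b(2) x'(3) by force
      ultimately show ?thesis using subgroup.m_closed[OF sP x'(1) b(1)] by blast
    qed
    moreover have "finite ?R" "?R \<subseteq> carrier G" using R(1,2) dc by auto
    ultimately show ?thesis by blast
  qed
qed simp

end

section \<open>Homomorphisms out of the free group\<close>

definition gen :: "'a \<Rightarrow> 'a fg" where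
  "gen a = letter (a, True)"

lemma letter_gen: "letter (a, t) = (if t then gen a else - gen a)"
  using letter_flip[of "(a, True)"] by (simp add: gen_def flip_Pair)

definition image_letter :: "('a \<Rightarrow> 'b::group_add) \<Rightarrow> 'a \<times> bool \<Rightarrow> 'b" where
  "image_letter f x = (if snd x then f (fst x) else - f (fst x))"

lemma image_letter_flip: "image_letter f (flip x) = - image_letter f x"
  by (simp add: image_letter_def flip_def)

definition ext :: "('a \<Rightarrow> 'b::group_add) \<Rightarrow> 'a fg \<Rightarrow> 'b" where
  "ext f u = foldr (\<lambda>x g. image_letter f x + g) (word u) 0"

lemma ext_zero [simp]: "ext f 0 = 0"
  by (simp add: ext_def)

lemma ext_letter_plus: "ext f (letter x + u) = image_letter f x + ext f u"
proof -
  have "foldr (\<lambda>x g. image_letter f x + g) (rcons x w) 0 =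
      image_letter f x + foldr (\<lambda>x g. image_letter f x + g) w 0" for w
    by (cases w) (auto simp: rcons_def image_letter_flip add.assoc[symmetric] simp del: add_uminus_conv_diff)
  then show ?thesis by (simp add: ext_def word_letter_plus)
qed

lemma ext_plus: "ext f (u + v) = ext f u + ext f v"
  by (induction u rule: fg_induct) (simp_all add: ext_letter_plus add.assoc)

definition endo :: "('a fg \<Rightarrow> 'b::group_add) \<Rightarrow> bool" where
  "endo h \<longleftrightarrow> (\<forall>u v. h (u + v) = h u + h v)"

lemma endo_ext [simp]: "endo (ext f)"
  by (simp add: endo_def ext_plus)

lemma endo_plus: "endo h \<Longrightarrow> h (u + v) = h u + h v"
  by (simp add: endo_def)

lemma endo_zero: "endo h \<Longrightarrow> h 0 = 0"
  using endo_plus[of h 0 0] by (metis add_0_left add_right_imp_eq)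

lemma endo_uminus: "endo h \<Longrightarrow> h (- u) = - h u"
  using endo_plus[of h "- u" u] endo_zero[of h] by (metis left_minus minus_unique minus_minus)

lemma endo_diff: "endo h \<Longrightarrow> h (u - v) = h u - h v"
  using endo_plus[of h u "- v"] by (simp add: endo_uminus)

lemma ext_gen [simp]: "ext f (gen a) = f a"
  using ext_letter_plus[of f "(a, True)" 0] by (simp add: gen_def image_letter_def)

lemma endo_eqI:
  assumes "endo h" "endo k" "\<And>a. h (gen a) = k (gen a)"
  shows "h u = k u"
proof (induction u rule: fg_induct)
  case (letter x u)
  have "h (letter x) = k (letter x)"
    using assms by (cases x) (auto simp: letter_gen endo_uminus)
  then show ?case using letter assms by (simp add: endo_plus)
qed (use assms in \<open>simp add: endo_zero\<close>)

text \<open>If the first letter of \<open>w\<close> is not a power of \<open>gen a\<close>,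
  multiplication by \<open>gen a\<close> on the left changes the first letter and on the right it
  does not; otherwise that letter is stripped.\<close>

lemma gen_centralizer:
  assumes "w + gen a = gen a + w"
  shows "set (word w) \<subseteq> {(a, True), (a, False)}"
  using assms
proof (induction "length (word w)" arbitrary: w rule: less_induct)
  case less
  show ?case
  proof (cases "w = 0")
    case False
    then obtain x v where v: "word w = x # v" by (cases "word w") auto
    define u where "u = of_word v"
    have wu: "w = letter x + u" unfolding u_def by (metis v of_word_word of_word_Cons)
    have wv: "word u = v" using v reduced_word[of w] by (simp add: u_def word_of_word reduced_Cons)
    show ?thesis
    proof (cases "fst x = a")
      case True
      then have x: "x = (a, snd x)" by (metis prod.collapse)
      then have comm: "gen a + letter x = letter x + gen a"
        by (metis letter_gen add.right_inverse add.left_inverse add_uminus_conv_diff left_minus)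
      have "letter x + (u + gen a) = letter x + (gen a + u)"
        using less.prems comm by (simp add: wu add.assoc[symmetric])
      then have "u + gen a = gen a + u" by (rule add_left_imp_eq)
      then have "set (word u) \<subseteq> {(a, True), (a, False)}" using v wv by (intro less.hyps) auto
      then show ?thesis using v wv x by (cases "snd x") auto
    next
      case False
      then have "word (gen a + w) = (a, True) # x # v"
        by (simp add: gen_def word_letter_plus rcons_def v flip_def prod_eq_iff)
      then have "word (w + letter (a, True)) = (a, True) # x # v" using less.prems by (simp add: gen_def)
      then show ?thesis using False v
        by (auto simp: word_plus_letter Cons_eq_append_conv split: if_splits)
    qed
  qed simp
qed

section \<open>The Artin action\<close>

text \<open>Artin's automorphism: a half twist acting on the fundamental group of a punctured disk,
  with \<open>gen a\<close> a loop around puncture \<open>a\<close>. It preserves the product of the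
  two loops involved. Infinitely many generators make it independent of \<open>n\<close>.\<close>

definition artin :: "nat \<Rightarrow> nat fg \<Rightarrow> nat fg" where
  "artin i = ext (\<lambda>a. if a = i then gen (i + 1)
     else if a = i + 1 then - gen (i + 1) + gen i + gen (i + 1) else gen a)"

definition artin_inv :: "nat \<Rightarrow> nat fg \<Rightarrow> nat fg" where
  "artin_inv i = ext (\<lambda>a. if a = i + 1 then gen i
     else if a = i then gen i + gen (i + 1) - gen i else gen a)"

lemma endo_artin [simp]: "endo (artin i)" "endo (artin_inv i)"
  by (simp_all add: artin_def artin_inv_def)

lemmas artin_hom = endo_plus[OF endo_artin(1)] endo_diff[OF endo_artin(1)] endo_uminus[OF endo_artin(1)]
  endo_zero[OF endo_artin(1)] endo_plus[OF endo_artin(2)] endo_diff[OF endo_artin(2)]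
  endo_uminus[OF endo_artin(2)] endo_zero[OF endo_artin(2)]

lemma artin_gen: "artin i (gen a) = (if a = i then gen (i + 1)
     else if a = i + 1 then - gen (i + 1) + gen i + gen (i + 1) else gen a)"
  by (simp add: artin_def)

lemma artin_inv_gen: "artin_inv i (gen a) = (if a = i + 1 then gen i
     else if a = i then gen i + gen (i + 1) - gen i else gen a)"
  by (simp add: artin_inv_def)

lemmas fg_normalize = add.assoc minus_add minus_minus diff_conv_add_uminus left_minus right_minus
  add_0_left add_0_right minus_add_cancel add_minus_cancel minus_zero

lemma artin_artin_inv [simp]: "artin i (artin_inv i u) = u"
proof (rule endo_eqI[of "\<lambda>u. artin i (artin_inv i u)" "\<lambda>u. u"])
  fix a
  consider "a = i" | "a = i + 1" | "a \<noteq> i" "a \<noteq> i + 1" by blast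
  then show "artin i (artin_inv i (gen a)) = gen a"
    by cases (simp_all add: artin_hom artin_gen artin_inv_gen, simp only: fg_normalize)
qed (simp_all add: endo_def artin_hom)

lemma artin_inv_artin [simp]: "artin_inv i (artin i u) = u"
proof (rule endo_eqI[of "\<lambda>u. artin_inv i (artin i u)" "\<lambda>u. u"])
  fix a
  consider "a = i" | "a = i + 1" | "a \<noteq> i" "a \<noteq> i + 1" by blast
  then show "artin_inv i (artin i (gen a)) = gen a"
    by cases (simp_all add: artin_hom artin_gen artin_inv_gen, simp only: fg_normalize)
qed (simp_all add: endo_def artin_hom)

lemma artin_far: "i + 2 \<le> j \<or> j + 2 \<le> i \<Longrightarrow> artin i (artin j u) = artin j (artin i u)"
proof (rule endo_eqI[of "\<lambda>u. artin i (artin j u)" "\<lambda>u. artin j (artin i u)"])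
  fix a
  assume "i + 2 \<le> j \<or> j + 2 \<le> i"
  then have ne: "i \<noteq> j" "j \<noteq> i" "Suc i \<noteq> j" "j \<noteq> Suc i" "Suc j \<noteq> i" "i \<noteq> Suc j" by auto
  consider "a = i" | "a = i + 1" | "a = j" | "a = j + 1" | "a \<notin> {i, i + 1, j, j + 1}" by blast
  then show "artin i (artin j (gen a)) = artin j (artin i (gen a))"
    by cases (simp_all add: artin_hom artin_gen ne)
qed (simp_all add: endo_def artin_hom)

lemma artin_braid: "artin i (artin (i + 1) (artin i u)) = artin (i + 1) (artin i (artin (i + 1) u))"
proof (rule endo_eqI[of "\<lambda>u. artin i (artin (i + 1) (artin i u))" "\<lambda>u. artin (i + 1) (artin i (artin (i + 1) u))"])
  fix a
  consider "a = i" | "a = i + 1" | "a = i + 2" | "a \<notin> {i, i + 1, i + 2}" by blast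
  then show "artin i (artin (i + 1) (artin i (gen a))) = artin (i + 1) (artin i (artin (i + 1) (gen a)))"
    by cases (simp_all add: artin_hom artin_gen, simp_all only: fg_normalize)
qed (simp_all add: endo_def artin_hom)

definition act_letter :: "nat \<times> bool \<Rightarrow> nat fg \<Rightarrow> nat fg" where
  "act_letter x = (if snd x then artin (fst x) else artin_inv (fst x))"

definition act_word :: "nat gword \<Rightarrow> nat fg \<Rightarrow> nat fg" where
  "act_word w u = foldr act_letter w u"

lemma act_word_append: "act_word (v @ w) u = act_word v (act_word w u)"
  by (simp add: act_word_def)

lemma endo_act_word: "endo (act_word w)"
proof (induction w)
  case (Cons x w)
  moreover have "endo (act_letter x)" by (cases "snd x") (simp_all add: act_letter_def)
  ultimately show ?case by (simp add: endo_def act_word_def)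
qed (simp add: endo_def act_word_def)

lemma act_word_cong:
  "(v, w) \<in> pres_rel {1..<n} (braid_relations n) \<Longrightarrow> act_word v u = act_word w u"
proof (induction arbitrary: u rule: pres_rel.induct)
  case (rel v w)
  then show ?case
    using artin_far artin_braid by (auto simp: braid_relations_def act_word_def act_letter_def)
next
  case (cancel a t)
  then show ?case by (cases t) (simp_all add: act_word_def act_letter_def)
qed (simp_all add: act_word_append)

section \<open>Freeness\<close>

context group
begin

lemma word_value_Cons:
  "word_value G f (x # w) = (if snd x then f (fst x) else inv (f (fst x))) \<otimes> word_value G f w"
  by (simp add: word_value_def case_prod_beta)

lemma word_value_Nil [simp]: "word_value G f [] = \<one>"
  by (simp add: word_value_def)

lemma word_value_closed:
  assumes "f ` S \<subseteq> carrier G" "w \<in> gwords S"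
  shows "word_value G f w \<in> carrier G"
  using assms(2)
proof (induction w)
  case (Cons x w)
  then have "f (fst x) \<in> carrier G" "word_value G f w \<in> carrier G" using assms(1) by (auto simp: gwords_def)
  then show ?case by (simp add: word_value_Cons)
qed simp

lemma word_value_rcons:
  assumes f: "f ` S \<subseteq> carrier G" and w: "w \<in> gwords S" and x: "fst x \<in> S"
  shows "word_value G f (rcons x w) = word_value G f (x # w)"
proof (cases "w \<noteq> [] \<and> hd w = flip x")
  case True
  then obtain v where v: "w = flip x # v" by (cases w) auto
  then have "word_value G f v \<in> carrier G" using w by (intro word_value_closed[OF f]) (auto simp: gwords_def)
  moreover have "f (fst x) \<in> carrier G" using f x by auto
  ultimately show ?thesis
    by (cases "snd x") (simp_all add: rcons_def v word_value_Cons flip_def m_assoc[symmetric])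
qed (auto simp: rcons_def)

lemma word_value_foldr_rcons:
  assumes f: "f ` S \<subseteq> carrier G" and v: "v \<in> gwords S" "w \<in> gwords S"
  shows "foldr rcons v w \<in> gwords S \<and>
    word_value G f (foldr rcons v w) = word_value G f v \<otimes> word_value G f w"
  using v(1)
proof (induction v)
  case Nil
  then show ?case using v(2) word_value_closed[OF f v(2)] by simp
next
  case (Cons x v)
  then have x: "fst x \<in> S" "x \<in> S \<times> UNIV" and vS: "v \<in> gwords S" by (auto simp: gwords_def)
  have IH: "foldr rcons v w \<in> gwords S"
    "word_value G f (foldr rcons v w) = word_value G f v \<otimes> word_value G f w" using Cons.IH vS by auto
  have "rcons x (foldr rcons v w) \<in> gwords S"
    using IH(1) x(2) set_rcons[of x "foldr rcons v w"] by (auto simp: gwords_def)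
  moreover have "f (fst x) \<in> carrier G" using f x by auto
  ultimately show ?case
    using IH word_value_rcons[OF f IH(1) x(1)] word_value_closed[OF f vS] word_value_closed[OF f v(2)]
    by (simp add: word_value_Cons m_assoc)
qed

end

definition free_on :: "'a set \<Rightarrow> 'a fg set" where
  "free_on S = {u. word u \<in> gwords S}"

lemma free_on_zero [simp]: "0 \<in> free_on S"
  by (simp add: free_on_def gwords_def)

lemma free_on_plus: "u \<in> free_on S \<Longrightarrow> v \<in> free_on S \<Longrightarrow> u + v \<in> free_on S"
  using set_word_plus[of u v] by (auto simp: free_on_def gwords_def lists_eq_set)

lemma free_on_uminus: "u \<in> free_on S \<Longrightarrow> - u \<in> free_on S"
  by (auto simp: free_on_def gwords_def lists_eq_set word_uminus inv_word_def flip_def)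

lemma free_on_diff: "u \<in> free_on S \<Longrightarrow> v \<in> free_on S \<Longrightarrow> u - v \<in> free_on S"
  using free_on_plus[of u S "- v"] free_on_uminus[of v S] by simp

lemma free_on_gen: "a \<in> S \<Longrightarrow> gen a \<in> free_on S"
  by (simp add: free_on_def gen_def gwords_def)

definition kill :: "'a \<Rightarrow> 'a fg \<Rightarrow> 'a fg" where
  "kill m = ext (\<lambda>a. if a = m then 0 else gen a)"

lemma kill_gen: "kill m (gen a) = (if a = m then 0 else gen a)"
  by (simp add: kill_def)

lemma endo_kill [simp]: "endo (kill m)"
  by (simp add: kill_def)

lemmas kill_hom = endo_plus[OF endo_kill] endo_uminus[OF endo_kill] endo_diff[OF endo_kill] endo_zero[OF endo_kill]

lemma kill_power:
  assumes "set (word w) \<subseteq> {(m, True), (m, False)}"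
  shows "kill m w = 0"
proof -
  have "kill m (of_word v) = 0" if "set v \<subseteq> {(m, True), (m, False)}" for v
    using that by (induction v) (auto simp: of_word_Cons kill_hom letter_gen kill_gen)
  from this[OF assms] show ?thesis by simp
qed

lemma kill_artin:
  assumes "i + 1 < m"
  shows "kill m (artin i u) = artin i (kill m u)" "kill m (artin_inv i u) = artin_inv i (kill m u)"
proof -
  have ne: "i \<noteq> m" "Suc i \<noteq> m" "m \<noteq> i" "m \<noteq> Suc i" using assms by auto
  show "kill m (artin i u) = artin i (kill m u)"
    by (rule endo_eqI[of "\<lambda>u. kill m (artin i u)" "\<lambda>u. artin i (kill m u)"])
      (simp_all add: endo_def artin_hom kill_hom artin_gen kill_gen ne)
  show "kill m (artin_inv i u) = artin_inv i (kill m u)"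
    by (rule endo_eqI[of "\<lambda>u. kill m (artin_inv i u)" "\<lambda>u. artin_inv i (kill m u)"])
      (simp_all add: endo_def artin_hom kill_hom artin_inv_gen kill_gen ne)
qed

locale braid_action = braid_generators G n \<sigma>
  for G :: "('g, 'm) monoid_scheme" (structure) and n and \<sigma> +
  fixes act :: "'g \<Rightarrow> nat fg \<Rightarrow> nat fg"
  assumes act_mult: "\<And>x y u. x \<in> carrier G \<Longrightarrow> y \<in> carrier G \<Longrightarrow> act (x \<otimes> y) u = act x (act y u)"
    and act_one [simp]: "\<And>u. act \<one> u = u"
    and act_\<sigma>: "\<And>i u. 1 \<le> i \<Longrightarrow> i < n \<Longrightarrow> act (\<sigma> i) u = artin i u"
    and endo_act: "\<And>x. x \<in> carrier G \<Longrightarrow> endo (act x)"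
begin

lemma act_inv_act: "x \<in> carrier G \<Longrightarrow> act (inv x) (act x u) = u" "x \<in> carrier G \<Longrightarrow> act x (act (inv x) u) = u"
  by (simp_all flip: act_mult)

lemma act_inv_\<sigma>: "1 \<le> i \<Longrightarrow> i < n \<Longrightarrow> act (inv (\<sigma> i)) u = artin_inv i u"
  using act_inv_act(1)[OF \<sigma>_carrier, of i "artin_inv i u"] by (simp add: act_\<sigma>)

text \<open>\<open>push m x g\<close>: the braid \<open>x\<close> pushes the \<open>m\<close>-th puncture along the loop \<open>g\<close> of the
  disk in which that puncture has been filled in, and acts trivially on that disk.\<close>

definition push :: "nat \<Rightarrow> 'g \<Rightarrow> nat fg \<Rightarrow> bool" where
  "push m x g \<longleftrightarrow> (\<exists>w. act x (gen m) = - w + gen m + w \<and> kill m w = g) \<and>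
     (\<forall>u. kill m (act x u) = kill m u)"

lemma push_one: "push m \<one> 0"
  unfolding push_def by (auto intro!: exI[of _ 0] simp: kill_hom)

lemma push_mult:
  assumes c: "x \<in> carrier G" "y \<in> carrier G" and x: "push m x g" and y: "push m y h"
  shows "push m (x \<otimes> y) (g + h)"
proof -
  obtain w v where w: "act x (gen m) = - w + gen m + w" "kill m w = g"
    and v: "act y (gen m) = - v + gen m + v" "kill m v = h" using x y by (auto simp: push_def)
  note e = endo_plus[OF endo_act[OF c(1)]] endo_uminus[OF endo_act[OF c(1)]]
  have "act (x \<otimes> y) (gen m) = - (w + act x v) + gen m + (w + act x v)"
    by (simp only: act_mult[OF c] v(1) e w(1) fg_normalize)
  moreover have "kill m (w + act x v) = g + h" using x w(2) v(2) by (simp add: kill_hom push_def)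
  moreover have "kill m (act (x \<otimes> y) u) = kill m u" for u using x y c by (simp add: act_mult push_def)
  ultimately show ?thesis unfolding push_def by blast
qed

lemma push_inv:
  assumes c: "x \<in> carrier G" and x: "push m x g"
  shows "push m (inv x) (- g)"
proof -
  obtain w where w: "act x (gen m) = - w + gen m + w" "kill m w = g" using x by (auto simp: push_def)
  let ?h = "act (inv x)"
  note e = endo_plus[OF endo_act[OF inv_closed[OF c]]] endo_uminus[OF endo_act[OF inv_closed[OF c]]]
  have "gen m = ?h (- w + gen m + w)" using act_inv_act(1)[OF c, of "gen m"] by (simp add: w(1))
  then have "gen m = - ?h w + ?h (gen m) + ?h w" by (simp only: e)
  then have "?h w + gen m + - ?h w = ?h w + (- ?h w + ?h (gen m) + ?h w) + - ?h w" by (rule arg_cong)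
  then have "?h (gen m) = - (- ?h w) + gen m + - ?h w" by (simp add: add.assoc del: add_uminus_conv_diff)
  moreover have k: "kill m (?h u) = kill m u" for u
    using x act_inv_act(2)[OF c, of u] unfolding push_def by metis
  ultimately show ?thesis unfolding push_def using w(2) by (metis kill_hom(2))
qed

text \<open>Induction downwards from \<open>i = m - 1\<close>, where the witness is
  \<open>gen i + gen m\<close>. Conjugation by \<open>\<sigma> i\<close> leads from
  \<open>i + 1\<close> to \<open>i\<close>, and for \<open>i + 1 < m\<close> its action fixes
  \<open>gen m\<close> and commutes with \<open>kill m\<close>.\<close>

lemma push_s:
  assumes "1 \<le> i" "i < m" "m \<le> n"
  shows "push m (s m i) (gen i)"
  using assms
proof (induction "m - i" arbitrary: i)
  case (Suc d)
  have c: "\<sigma> i \<in> carrier G" using Suc.prems by (intro \<sigma>_carrier) auto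
  have i: "1 \<le> i" "i < n" using Suc.prems by auto
  show ?case
  proof (cases "m = Suc i")
    case True
    have a: "act (s m i) u = artin i (artin i u)" for u
      using c i by (simp add: True s_adjacent act_mult act_\<sigma>)
    have "act (s m i) (gen m) = - (gen i + gen m) + gen m + (gen i + gen m)"
      unfolding a using True by (simp add: artin_gen artin_hom, simp only: fg_normalize)
    moreover have "kill m (gen i + gen m) = gen i" using True by (simp add: kill_hom kill_gen)
    moreover have "kill m (act (s m i) u) = kill m u" for u
    proof (rule endo_eqI[of "\<lambda>u. kill m (act (s m i) u)" "kill m"])
      fix b
      consider "b = i" | "b = m" | "b \<noteq> i" "b \<noteq> m" by blast
      then show "kill m (act (s m i) (gen b)) = kill m (gen b)"
        unfolding a using True by cases (simp_all add: artin_gen artin_hom kill_hom kill_gen)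
    qed (simp_all add: a endo_def artin_hom kill_hom)
    ultimately show ?thesis unfolding push_def by blast
  next
    case False
    then have im: "i + 1 < m" using Suc.prems by simp
    let ?y = "s m (i + 1)"
    have yc: "?y \<in> carrier G" using im Suc.prems by (intro s_carrier) auto
    have "push m ?y (gen (i + 1))" using Suc.prems Suc.hyps(2) im by (intro Suc.hyps(1)) auto
    then obtain w where w: "act ?y (gen m) = - w + gen m + w" "kill m w = gen (i + 1)"
      and k: "\<And>u. kill m (act ?y u) = kill m u" by (auto simp: push_def)
    have "conj_by (\<sigma> i) (s m i) = ?y" using im Suc.prems by (intro conj_s_same) auto
    then have "s m i = conj_by (inv (\<sigma> i)) ?y"
      using c s_carrier[of i m] Suc.prems by (metis conj_by_inv_cancel(1))
    then have a: "act (s m i) u = artin_inv i (act ?y (artin i u))" for u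
      using c yc i by (simp add: conj_by_def act_mult act_inv_\<sigma> act_\<sigma>)
    have gm: "artin i (gen m) = gen m" "artin_inv i (gen m) = gen m" using im by (auto simp: artin_gen artin_inv_gen)
    have "act (s m i) (gen m) = - artin_inv i w + gen m + artin_inv i w"
      by (simp only: a gm w(1) artin_hom)
    moreover have "kill m (artin_inv i w) = gen i" by (simp only: kill_artin[OF im] w(2) artin_inv_gen) simp
    moreover have "kill m (act (s m i) u) = kill m u" for u
      by (simp only: a kill_artin[OF im] k artin_inv_artin)
    ultimately show ?thesis unfolding push_def by blast
  qed
qed simp

lemma act_B_gen:
  assumes m: "1 \<le> m" "m \<le> n" and x: "x \<in> B (m - 1)"
  shows "act x (gen m) = gen m"
  using x unfolding B_def
proof induction
  case (incl h)
  then obtain i where i: "h = \<sigma> i" "1 \<le> i" "i < m - 1" by auto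
  then have "m \<noteq> i" "m \<noteq> Suc i" by auto
  then show ?case using m i by (simp add: act_\<sigma> artin_gen)
next
  case (inv h)
  then obtain i where i: "h = \<sigma> i" "1 \<le> i" "i < m - 1" by auto
  then have "m \<noteq> i" "m \<noteq> Suc i" by auto
  then show ?case using m i by (simp add: act_inv_\<sigma> artin_inv_gen)
next
  case (eng h1 h2)
  have "h1 \<in> carrier G" "h2 \<in> carrier G"
    using eng.hyps generate_in_carrier[OF gens_carrier(3)[of "m - 1"]] m by auto
  then show ?case using eng.IH by (simp add: act_mult)
qed simp

text \<open>The conjugator \<open>w\<close> then centralizes \<open>gen m\<close>, so it is a power
  of it and is annihilated by \<open>kill m\<close>.\<close>

lemma push_fixed:
  assumes "push m x g" "act x (gen m) = gen m"
  shows "g = 0"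
proof -
  obtain w where w: "gen m = - w + gen m + w" "kill m w = g" using assms by (auto simp: push_def)
  from w(1) have "w + gen m = w + (- w + gen m + w)" by (rule arg_cong)
  then have "w + gen m = gen m + w" by (simp add: add.assoc)
  from kill_power[OF gen_centralizer[OF this]] w(2) show ?thesis by simp
qed

text \<open>The homomorphism from the abstract free group on \<open>{1..<m}\<close> onto
  \<open>F (m - 1)\<close>; freeness is its injectivity.\<close>

definition val :: "nat \<Rightarrow> nat fg \<Rightarrow> 'g" where
  "val m u = word_value G (s m) (word u)"

abbreviation loops :: "nat \<Rightarrow> nat fg set" where
  "loops m \<equiv> free_on {1..<m}"

lemma s_image: "m \<le> n \<Longrightarrow> s m ` {1..<m} \<subseteq> carrier G"
  using s_carrier by auto

lemma val_carrier: "m \<le> n \<Longrightarrow> u \<in> loops m \<Longrightarrow> val m u \<in> carrier G"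
  unfolding val_def free_on_def by (intro word_value_closed[OF s_image]) auto

lemma val_zero [simp]: "val m 0 = \<one>"
  by (simp add: val_def)

lemma val_plus: "m \<le> n \<Longrightarrow> u \<in> loops m \<Longrightarrow> v \<in> loops m \<Longrightarrow> val m (u + v) = val m u \<otimes> val m v"
  using word_value_foldr_rcons[OF s_image, of m "word u" "word v"]
  by (simp add: val_def free_on_def word_plus)

lemma val_uminus: "m \<le> n \<Longrightarrow> u \<in> loops m \<Longrightarrow> val m (- u) = inv (val m u)"
  using val_plus[of m "- u" u] val_carrier[of m u] val_carrier[of m "- u"] free_on_uminus[of u]
  by (auto intro!: inv_equality[symmetric])

lemma val_gen: "1 \<le> i \<Longrightarrow> i < m \<Longrightarrow> m \<le> n \<Longrightarrow> val m (gen i) = s m i"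
  using s_carrier[of i m] by (simp add: val_def gen_def word_value_Cons)

lemma push_val:
  assumes m: "m \<le> n" and u: "u \<in> loops m"
  shows "push m (val m u) u"
proof -
  have "push m (word_value G (s m) w) (of_word w)" if "w \<in> gwords {1..<m}" for w
    using that
  proof (induction w)
    case (Cons x w)
    then have w: "w \<in> gwords {1..<m}" and i: "1 \<le> fst x" "fst x < m" by (auto simp: gwords_def)
    have c: "word_value G (s m) w \<in> carrier G" "s m (fst x) \<in> carrier G"
      using word_value_closed[OF s_image[OF m] w] s_carrier i m by auto
    have "push m (if snd x then s m (fst x) else inv (s m (fst x))) (letter x)"
      using push_s[OF i m] push_inv[OF c(2) push_s[OF i m]] by (cases x) (simp add: letter_gen)
    from push_mult[OF _ c(1) this Cons.IH[OF w]] c(2) show ?case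
      by (simp add: word_value_Cons of_word_Cons)
  qed (simp add: push_one)
  from this[of "word u"] u show ?thesis by (simp add: val_def free_on_def)
qed

text \<open>The loop \<open>u\<close> can be read off from the action of \<open>val m u\<close>, but
  \<open>B (m - 1)\<close> fixes \<open>gen m\<close>. This gives freeness and the triviality of the
  intersection of \<open>F (m - 1)\<close> with \<open>B (m - 1)\<close> at once.\<close>

lemma val_in_B:
  assumes m: "1 \<le> m" "m \<le> n" and u: "u \<in> loops m" and B: "val m u \<in> B (m - 1)"
  shows "u = 0"
  by (rule push_fixed[OF push_val[OF m(2) u] act_B_gen[OF m B]])

lemma inj_val: "1 \<le> m \<Longrightarrow> m \<le> n \<Longrightarrow> inj_on (val m) (loops m)"
proof (rule inj_onI)
  fix u v assume m: "1 \<le> m" "m \<le> n" and uv: "u \<in> loops m" "v \<in> loops m" "val m u = val m v"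
  have "val m (- u + v) = \<one>"
    using m uv val_plus[OF m(2) free_on_uminus[OF uv(1)] uv(2)] val_carrier[OF m(2)]
    by (simp add: val_uminus)
  moreover have "\<one> \<in> B (m - 1)" using m by (intro subgroup.one_closed subgroup_B) auto
  ultimately have "- u + v = 0"
    using val_in_B[OF m free_on_plus[OF free_on_uminus[OF uv(1)] uv(2)]] by simp
  then show "u = v" by (metis minus_unique minus_minus)
qed

lemma val_image: "1 \<le> m \<Longrightarrow> m \<le> n \<Longrightarrow> val m ` loops m = F (m - 1)"
proof (intro equalityI subsetI)
  fix x assume m: "1 \<le> m" "m \<le> n" and "x \<in> val m ` loops m"
  then obtain u where u: "u \<in> loops m" "x = val m u" by auto
  have sF: "subgroup (F (m - 1)) G" using m by (intro subgroup_F) auto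
  have "word_value G (s m) w \<in> F (m - 1)" if "w \<in> gwords {1..<m}" for w
    using that
  proof (induction w)
    case Nil
    then show ?case using subgroup.one_closed[OF sF] by simp
  next
    case (Cons x w)
    then have "w \<in> gwords {1..<m}" "1 \<le> fst x" "fst x < m" by (auto simp: gwords_def)
    moreover from this have "s m (fst x) \<in> F (m - 1)" by (intro s_in_F) auto
    ultimately show ?case
      using Cons.IH subgroup.m_closed[OF sF] subgroup.m_inv_closed[OF sF] by (simp add: word_value_Cons)
  qed
  then show "x \<in> F (m - 1)" using u by (simp add: val_def free_on_def)
next
  fix x assume m: "1 \<le> m" "m \<le> n" and x: "x \<in> F (m - 1)"
  have mm: "Suc (m - 1) = m" "{1..m - 1} = {1..<m}" using m by auto
  show "x \<in> val m ` loops m"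
    using x unfolding F_def mm
  proof induction
    case one
    then show ?case by (intro image_eqI[of _ _ 0]) auto
  next
    case (incl h)
    then obtain i where "h = s m i" "i \<in> {1..<m}" by auto
    then show ?case using m val_gen[of i m] by (intro image_eqI[of _ _ "gen i"]) (auto intro: free_on_gen)
  next
    case (inv h)
    then obtain i where "h = s m i" "i \<in> {1..<m}" by auto
    then show ?case using m val_gen[of i m] val_uminus[OF m(2) free_on_gen, of i]
      by (intro image_eqI[of _ _ "- gen i"]) (auto intro!: free_on_uminus free_on_gen)
  next
    case (eng h1 h2)
    then obtain u v where "u \<in> loops m" "h1 = val m u" "v \<in> loops m" "h2 = val m v" by auto
    then show ?case using m by (intro image_eqI[of _ _ "u + v"]) (auto simp: val_plus intro: free_on_plus)
  qed
qed

lemma F_inter_B: "k < n \<Longrightarrow> x \<in> F k \<Longrightarrow> x \<in> B k \<Longrightarrow> x = \<one>"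
proof -
  assume k: "k < n" and x: "x \<in> F k" "x \<in> B k"
  then obtain u where u: "u \<in> loops (Suc k)" "x = val (Suc k) u" using val_image[of "Suc k"] by auto
  then have "u = 0" using k x(2) by (intro val_in_B[of "Suc k"]) auto
  then show ?thesis using u by simp
qed

lemma F_P_unique:
  assumes k: "k < n" and f: "f \<in> F k" "f' \<in> F k" and q: "q \<in> P k" "q' \<in> P k"
    and eq: "f \<otimes> q = f' \<otimes> q'"
  shows "f = f' \<and> q = q'"
proof -
  have sF: "subgroup (F k) G" and sB: "subgroup (B k) G" using k by (auto intro!: subgroup_F subgroup_B)
  have c: "f \<in> carrier G" "f' \<in> carrier G" "q \<in> carrier G" "q' \<in> carrier G"
    using f q k F_carrier[of k] P_carrier[of k] by auto
  have qB: "q \<in> B k" "q' \<in> B k" using q P_subset_B[of k] k by auto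
  have "inv f' \<otimes> f = inv f' \<otimes> (f \<otimes> q) \<otimes> inv q" using c by (simp add: m_assoc)
  also have "\<dots> = q' \<otimes> inv q" unfolding eq using c by (simp add: m_assoc[symmetric])
  finally have e: "inv f' \<otimes> f = q' \<otimes> inv q" .
  have "inv f' \<otimes> f \<in> F k" using f subgroup.m_closed[OF sF] subgroup.m_inv_closed[OF sF] by simp
  moreover have "inv f' \<otimes> f \<in> B k"
    unfolding e using qB subgroup.m_closed[OF sB] subgroup.m_inv_closed[OF sB] by simp
  ultimately have "inv f' \<otimes> f = \<one>" using F_inter_B[OF k] by simp
  then have "f = f'" using c by (metis inv_closed inv_equality inv_inv)
  then show ?thesis using eq c by simp
qed

text \<open>Geometrically the loop around the first \<open>m - 1\<close> punctures.\<close>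

definition boundary :: "nat \<Rightarrow> nat fg" where
  "boundary m = of_word (map (\<lambda>i. (i, True)) [1..<m])"

lemma word_boundary: "word (boundary m) = map (\<lambda>i. (i, True)) [1..<m]"
proof -
  have "reduced (map (\<lambda>i. (i, True)) l)" for l :: "nat list"
    by (induction l rule: induct_list012) (auto simp: reduced_Cons flip_def)
  then show ?thesis unfolding boundary_def by (rule word_of_word)
qed

lemma boundary_loop: "boundary m \<in> loops m"
  by (auto simp: free_on_def word_boundary gwords_def lists_eq_set)

text \<open>Only the adjacent factors \<open>s m k\<close> and \<open>s m (k + 1)\<close> are moved:
  they become \<open>s m (k + 1)\<close> and the conjugate of \<open>s m k\<close> by its inverse,
  with the same product.\<close>

lemma val_boundary_commutes_\<sigma>:
  assumes m: "m \<le> n" and k: "1 \<le> k" "k + 1 < m"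
  shows "conj_by (\<sigma> k) (val m (boundary m)) = val m (boundary m)"
proof -
  define pr where "pr l = foldr (\<lambda>i g. s m i \<otimes> g) l \<one>" for l
  have pr_closed: "pr l \<in> carrier G" if "set l \<subseteq> {1..<m}" for l
    using that m by (induction l) (auto simp: pr_def intro!: m_closed s_carrier)
  have pr_append: "pr (l @ l') = pr l \<otimes> pr l'" if "set l \<subseteq> {1..<m}" "set l' \<subseteq> {1..<m}" for l l'
    using that(1)
  proof (induction l)
    case Nil
    then show ?case using pr_closed[OF that(2)] by (simp add: pr_def)
  next
    case (Cons i l)
    then have "s m i \<in> carrier G" "pr l \<in> carrier G" using m by (auto intro!: s_carrier pr_closed)
    then show ?case using Cons pr_closed[OF that(2)] by (simp add: pr_def m_assoc)
  qed
  have val: "val m (boundary m) = pr [1..<m]"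
    unfolding val_def word_boundary pr_def word_value_def foldr_map by (simp add: o_def)
  have c: "\<sigma> k \<in> carrier G" using k m by (intro \<sigma>_carrier) auto
  have fixed: "conj_by (\<sigma> k) (pr l) = pr l"
    if "\<And>i. i \<in> set l \<Longrightarrow> 1 \<le> i \<and> i < m \<and> (i < k \<or> k + 1 < i)" for l
    using that
  proof (induction l)
    case (Cons i l)
    have i: "1 \<le> i" "i < m" "i < k \<or> k + 1 < i" using Cons.prems by auto
    have "conj_by (\<sigma> k) (s m i) = s m i"
      using i k m conj_s_between[of i k m] conj_s_below[of k i m] by auto
    moreover have "s m i \<in> carrier G" using i m by (intro s_carrier) auto
    moreover have "pr l \<in> carrier G" using Cons.prems by (intro pr_closed) auto
    moreover have "conj_by (\<sigma> k) (pr l) = pr l" using Cons by auto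
    ultimately show ?case using c by (simp add: pr_def conj_by_mult)
  qed (use c in \<open>simp add: pr_def\<close>)
  have sc: "s m k \<in> carrier G" "s m (k + 1) \<in> carrier G" using k m by (auto intro!: s_carrier)
  have two: "conj_by (\<sigma> k) (pr [k, k + 1]) = pr [k, k + 1]"
  proof -
    have "conj_by (\<sigma> k) (s m k) = s m (k + 1)" using k m by (intro conj_s_same) auto
    moreover have "conj_by (\<sigma> k) (s m (k + 1)) = conj_by (inv (s m (k + 1))) (s m k)"
      using k m by (intro conj_s_next) auto
    ultimately show ?thesis
      using c sc by (simp add: pr_def conj_by_mult) (simp add: conj_by_def m_assoc[symmetric])
  qed
  have split: "[1..<m] = [1..<k] @ [k, k + 1] @ [k + 2..<m]"
  proof -
    have "[1..<m] = [1..<k] @ [k..<m]" using k by (metis le_add_diff_inverse less_imp_le_nat upt_add_eq_append add_lessD1)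
    then show ?thesis using k by (simp add: upt_conv_Cons)
  qed
  have in_range: "set [1..<k] \<subseteq> {1..<m}" "set [k, k + 1] \<subseteq> {1..<m}" "set [k + 2..<m] \<subseteq> {1..<m}" using k by auto
  have e: "pr [1..<m] = pr [1..<k] \<otimes> (pr [k, k + 1] \<otimes> pr [k + 2..<m])"
    unfolding split using in_range by (subst pr_append, simp, simp, subst pr_append) auto
  have "conj_by (\<sigma> k) (pr [1..<k]) = pr [1..<k]" "conj_by (\<sigma> k) (pr [k + 2..<m]) = pr [k + 2..<m]"
    using k by (auto intro!: fixed)
  then show ?thesis
    unfolding val e using c two pr_closed[OF in_range(1)] pr_closed[OF in_range(2)] pr_closed[OF in_range(3)]
    by (simp only: conj_by_mult m_closed)
qed

lemma val_boundary_commutes: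
  assumes m: "1 \<le> m" "m \<le> n" and x: "x \<in> B (m - 1)"
  shows "conj_by x (val m (boundary m)) = val m (boundary m)"
  using x unfolding B_def
proof induction
  case one
  then show ?case using val_carrier[OF m(2) boundary_loop] by simp
next
  case (incl h)
  then show ?case using m by (auto intro!: val_boundary_commutes_\<sigma>)
next
  case (inv h)
  then obtain i where "h = \<sigma> i" "1 \<le> i" "i < m - 1" by auto
  then show ?case
    using m val_carrier[OF m(2) boundary_loop] \<sigma>_carrier[of i]
    by (auto intro!: val_boundary_commutes_\<sigma> conj_by_fixed_inv)
next
  case (eng h1 h2)
  have "h1 \<in> carrier G" "h2 \<in> carrier G"
    using eng.hyps generate_in_carrier[OF gens_carrier(3)[of "m - 1"]] m by auto
  then show ?case
    using eng.IH val_carrier[OF m(2) boundary_loop] by (simp flip: conj_by_conj_by)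
qed

end

section \<open>The iterated semidirect product and uniqueness of components\<close>

context braid_action
begin

definition assemble :: "(nat \<Rightarrow> 'g) \<Rightarrow> nat \<Rightarrow> 'g" where
  "assemble c m = foldr (\<lambda>i g. c i \<otimes> g) (rev [1..<m]) \<one>"

lemma assemble_1 [simp]: "assemble c (Suc 0) = \<one>"
  by (simp add: assemble_def)

lemma assemble_Suc: "1 \<le> m \<Longrightarrow> assemble c (Suc m) = c m \<otimes> assemble c m"
  by (simp add: assemble_def)

lemma assemble_cong: "(\<And>i. i \<in> {1..<m} \<Longrightarrow> c i = c' i) \<Longrightarrow> assemble c m = assemble c' m"
  unfolding assemble_def by (intro foldr_cong) auto

lemma assemble_in_P:
  "1 \<le> m \<Longrightarrow> m \<le> n \<Longrightarrow> (\<And>i. i \<in> {1..<m} \<Longrightarrow> c i \<in> F i) \<Longrightarrow> assemble c m \<in> P m"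
proof (induction m rule: dec_induct)
  case base
  then show ?case using subgroup.one_closed[OF subgroup_P[of 1]] by simp
next
  case (step m)
  have "assemble c m \<in> P (Suc m)" using step P_mono[of m "Suc m"] by auto
  moreover have "c m \<in> P (Suc m)" using step F_subset_P[of m "Suc m"] by auto
  ultimately show ?case
    using step subgroup.m_closed[OF subgroup_P[of "Suc m"]] by (simp add: assemble_Suc)
qed

lemma assemble_unique:
  "1 \<le> m \<Longrightarrow> m \<le> n \<Longrightarrow> (\<And>i. i \<in> {1..<m} \<Longrightarrow> c i \<in> F i) \<Longrightarrow> (\<And>i. i \<in> {1..<m} \<Longrightarrow> c' i \<in> F i) \<Longrightarrow>
    assemble c m = assemble c' m \<Longrightarrow> i \<in> {1..<m} \<Longrightarrow> c i = c' i"
proof (induction m arbitrary: i rule: dec_induct)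
  case (step m)
  have "c m \<otimes> assemble c m = c' m \<otimes> assemble c' m" using step by (simp add: assemble_Suc)
  moreover have "assemble c m \<in> P m" "assemble c' m \<in> P m"
    using step.hyps step.prems by (auto intro!: assemble_in_P)
  ultimately have eq: "c m = c' m" "assemble c m = assemble c' m"
    using F_P_unique[of m "c m" "c' m" "assemble c m" "assemble c' m"] step.hyps step.prems by auto
  show ?case
  proof (cases "i = m")
    case False
    have "i \<in> {1..<m}" using False step.prems by auto
    then show ?thesis using step.prems eq(2) by (intro step.IH) auto
  qed (simp add: eq)
qed simp

lemma assemble_exists:
  "1 \<le> m \<Longrightarrow> m \<le> n \<Longrightarrow> x \<in> P m \<Longrightarrow> \<exists>c\<in>(\<Pi>\<^sub>E i\<in>{1..<m}. F i). x = assemble c m"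
proof (induction m arbitrary: x rule: dec_induct)
  case base
  then have "x = \<one>" by (simp add: P_def generate_empty cong: conj_cong)
  then show ?case by (intro bexI[of _ "\<lambda>_. undefined"]) auto
next
  case (step m)
  obtain f q where fq: "f \<in> F m" "q \<in> P m" "x = f \<otimes> q"
    using P_decomposition step.prems by blast
  then obtain c where c: "c \<in> (\<Pi>\<^sub>E i\<in>{1..<m}. F i)" "q = assemble c m" using step by auto
  let ?c = "c(m := f)"
  have "assemble ?c m = q" unfolding c(2) by (rule assemble_cong) auto
  then have "x = assemble ?c (Suc m)" using fq(3) step.hyps by (simp add: assemble_Suc)
  moreover have "?c \<in> (\<Pi>\<^sub>E i\<in>{1..<Suc m}. F i)"
    using c(1) fq(1) step.hyps(1) by (auto simp: PiE_iff extensional_def less_Suc_eq)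
  ultimately show ?case by blast
qed

lemma components_unique:
  assumes "1 \<le> n" "x \<in> P n"
  shows "\<exists>!c. c \<in> (\<Pi>\<^sub>E i\<in>{1..<n}. F i) \<and> x = assemble c n"
proof -
  obtain c where c: "c \<in> (\<Pi>\<^sub>E i\<in>{1..<n}. F i)" "x = assemble c n"
    using assemble_exists[of n x] assms by auto
  show ?thesis
  proof (rule ex1I[of _ c])
    fix d assume d: "d \<in> (\<Pi>\<^sub>E i\<in>{1..<n}. F i) \<and> x = assemble d n"
    show "d = c"
    proof (rule PiE_ext)
      show "d \<in> (\<Pi>\<^sub>E i\<in>{1..<n}. F i)" "c \<in> (\<Pi>\<^sub>E i\<in>{1..<n}. F i)" using c d by auto
      fix i assume "i \<in> {1..<n}"
      then show "d i = c i" using assemble_unique[of n d c i] c d assms by (auto simp: PiE_iff)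
    qed
  qed (use c in auto)
qed

lemma top_component:
  assumes n: "2 \<le> n" and c: "c \<in> (\<Pi>\<^sub>E i\<in>{1..<n}. F i)" and eq: "f \<otimes> q = assemble c n"
    and f: "f \<in> F (n - 1)" and q: "q \<in> P (n - 1)"
  shows "c (n - 1) = f"
proof -
  have n': "n = Suc (n - 1)" "1 \<le> n - 1" using n by auto
  have e: "f \<otimes> q = c (n - 1) \<otimes> assemble c (n - 1)" using assemble_Suc[OF n'(2), of c] eq n'(1) by simp
  have "c (n - 1) \<in> F (n - 1)" "assemble c (n - 1) \<in> P (n - 1)"
    using c n by (auto intro!: assemble_in_P simp: PiE_iff)
  then show ?thesis using F_P_unique[of "n - 1" f _ q _] f q e n by auto
qed

end

section \<open>Coset representatives and the free component of a braid\<close>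

locale braid_cosets = braid_action G n \<sigma> act
  for G :: "('g, 'm) monoid_scheme" (structure) and n and \<sigma> and act +
  fixes T :: "'g set"
  assumes n3: "3 \<le> n" and reps: "coset_representatives G (P n) T" and generated: "carrier G \<subseteq> B n"
begin

definition fac :: "'g \<Rightarrow> 'g \<times> 'g" where
  "fac \<beta> = (THE (\<gamma>, \<pi>). \<gamma> \<in> P n \<and> \<pi> \<in> T \<and> \<beta> = \<gamma> \<otimes> \<pi>)"

lemma T_carrier: "t \<in> T \<Longrightarrow> t \<in> carrier G"
  using reps by (auto simp: coset_representatives_def)

lemma T_unique:
  assumes "t \<in> T" "t' \<in> T" "q \<in> P n" "t' = q \<otimes> t"
  shows "t' = t"
proof -
  have sP: "subgroup (P n) G" by (rule subgroup_P) simp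
  have "P n #> t \<in> rcosets (P n)" using T_carrier assms by (auto simp: RCOSETS_def)
  moreover have "t \<in> P n #> t"
    using T_carrier[OF assms(1)] subgroup.one_closed[OF sP] by (force simp: r_coset_def)
  moreover have "t' \<in> P n #> t" using assms by (auto simp: r_coset_def)
  ultimately show ?thesis using reps assms unfolding coset_representatives_def by blast
qed

lemma fac_eq:
  assumes "\<gamma> \<in> P n" "\<pi> \<in> T" "\<beta> = \<gamma> \<otimes> \<pi>"
  shows "fac \<beta> = (\<gamma>, \<pi>)"
  unfolding fac_def
proof (rule the_equality)
  fix x assume "case x of (\<gamma>, \<pi>) \<Rightarrow> \<gamma> \<in> P n \<and> \<pi> \<in> T \<and> \<beta> = \<gamma> \<otimes> \<pi>"
  then obtain \<gamma>' \<pi>' where x: "x = (\<gamma>', \<pi>')" "\<gamma>' \<in> P n" "\<pi>' \<in> T" "\<gamma> \<otimes> \<pi> = \<gamma>' \<otimes> \<pi>'" using assms by auto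
  have sP: "subgroup (P n) G" by (rule subgroup_P) simp
  have c: "\<gamma> \<in> carrier G" "\<gamma>' \<in> carrier G" "\<pi> \<in> carrier G" "\<pi>' \<in> carrier G"
    using assms x T_carrier P_carrier[of n] by auto
  have "\<pi>' = inv \<gamma>' \<otimes> (\<gamma>' \<otimes> \<pi>')" using c by (simp add: m_assoc[symmetric])
  also have "\<dots> = (inv \<gamma>' \<otimes> \<gamma>) \<otimes> \<pi>" using c by (simp add: x(4)[symmetric] m_assoc)
  finally have "\<pi>' = \<pi>"
    using T_unique[of \<pi> \<pi>' "inv \<gamma>' \<otimes> \<gamma>"] assms x subgroup.m_closed[OF sP] subgroup.m_inv_closed[OF sP] by simp
  moreover from this have "\<gamma>' = \<gamma>" using x(4) c by simp
  ultimately show "x = (\<gamma>, \<pi>)" using x by simp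
qed (use assms in auto)

lemma fac_exists:
  assumes "\<beta> \<in> carrier G"
  shows "\<exists>\<gamma>\<in>P n. \<exists>\<pi>\<in>T. \<beta> = \<gamma> \<otimes> \<pi>"
proof -
  have sP: "subgroup (P n) G" by (rule subgroup_P) simp
  have "P n #> \<beta> \<in> rcosets (P n)" using assms by (auto simp: RCOSETS_def)
  then obtain t where t: "t \<in> T" "t \<in> P n #> \<beta>" using reps unfolding coset_representatives_def by blast
  then obtain q where q: "q \<in> P n" "t = q \<otimes> \<beta>" by (auto simp: r_coset_def)
  have "\<beta> = inv q \<otimes> t" using q assms P_carrier[of n q] by (simp add: m_assoc[symmetric])
  then show ?thesis using t(1) q(1) subgroup.m_inv_closed[OF sP] by blast
qed

lemma fac:
  assumes "\<beta> \<in> carrier G"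
  shows "fst (fac \<beta>) \<in> P n" "snd (fac \<beta>) \<in> T" "\<beta> = fst (fac \<beta>) \<otimes> snd (fac \<beta>)"
  using fac_exists[OF assms] fac_eq by force+

text \<open>Every element of \<open>T\<close> is recovered by \<open>fac\<close> from a member of
  the finite transversal in the same coset.\<close>

lemma finite_T: "finite T"
proof -
  obtain R where R: "finite R" "R \<subseteq> carrier G" "\<And>x. x \<in> B n \<Longrightarrow> \<exists>q\<in>P n. \<exists>r\<in>R. x = q \<otimes> r"
    using finite_P_transversal[of n] n3 by auto
  have sP: "subgroup (P n) G" by (rule subgroup_P) simp
  have "\<exists>r\<in>R. snd (fac r) = t" if t: "t \<in> T" for t
  proof -
    obtain q r where q: "q \<in> P n" "r \<in> R" "t = q \<otimes> r" using R(3)[of t] T_carrier[OF t] generated by auto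
    then have "r = inv q \<otimes> t" using R(2) P_carrier[of n q] by (auto simp: m_assoc[symmetric])
    then have "fac r = (inv q, t)" using q t subgroup.m_inv_closed[OF sP] by (intro fac_eq) auto
    then show ?thesis using q by force
  qed
  then have "T \<subseteq> (\<lambda>r. snd (fac r)) ` R" by force
  then show ?thesis using R(1) finite_surj by blast
qed

text \<open>The free component \<open>A\<close> of the overview, as an element of the abstract free
  group; the lower factors are collected in \<open>q\<close>.\<close>

definition loop :: "'g \<Rightarrow> nat fg" where
  "loop \<beta> = (THE u. u \<in> loops n \<and> (\<exists>q\<in>P (n - 1). fst (fac \<beta>) = val n u \<otimes> q))"

lemma loop_eq:
  assumes "u \<in> loops n" "q \<in> P (n - 1)" "fst (fac \<beta>) = val n u \<otimes> q"
  shows "loop \<beta> = u"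
  unfolding loop_def
proof (rule the_equality)
  fix v assume "v \<in> loops n \<and> (\<exists>q\<in>P (n - 1). fst (fac \<beta>) = val n v \<otimes> q)"
  then obtain q' where v: "v \<in> loops n" "q' \<in> P (n - 1)" "val n u \<otimes> q = val n v \<otimes> q'" using assms by auto
  have "val n u \<in> F (n - 1)" "val n v \<in> F (n - 1)" using val_image[of n] assms v n3 by auto
  then have "val n u = val n v" using F_P_unique[of "n - 1" "val n u" "val n v" q q'] assms v n3 by auto
  then show "v = u" using inj_onD[OF inj_val[of n], of u v] assms v n3 by auto
qed (use assms in auto)

lemma loop:
  assumes "\<beta> \<in> carrier G"
  shows "loop \<beta> \<in> loops n" "\<exists>q\<in>P (n - 1). fst (fac \<beta>) = val n (loop \<beta>) \<otimes> q"
proof -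
  have "Suc (n - 1) = n" using n3 by simp
  then obtain f q where fq: "f \<in> F (n - 1)" "q \<in> P (n - 1)" "fst (fac \<beta>) = f \<otimes> q"
    using P_decomposition[of "n - 1" "fst (fac \<beta>)"] fac(1)[OF assms] by auto
  then obtain u where u: "u \<in> loops n" "f = val n u" using val_image[of n] n3 by auto
  then have "loop \<beta> = u" using loop_eq fq by blast
  then show "loop \<beta> \<in> loops n" "\<exists>q\<in>P (n - 1). fst (fac \<beta>) = val n (loop \<beta>) \<otimes> q" using u fq by auto
qed

text \<open>Conjugation by a pure braid on \<open>F (n - 1)\<close>, transported to the abstract
  free group; it plays the role of \<theta>.\<close>

definition loop_conj :: "'g \<Rightarrow> nat fg \<Rightarrow> nat fg" where
  "loop_conj \<gamma> u = inv_into (loops n) (val n) (conj_by \<gamma> (val n u))"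

lemma P_normalizes_F:
  assumes "\<gamma> \<in> P n" "x \<in> F (n - 1)"
  shows "conj_by \<gamma> x \<in> F (n - 1)"
proof -
  have nn: "Suc (n - 1) = n" "n - 1 < n" using n3 by auto
  obtain f q where fq: "f \<in> F (n - 1)" "q \<in> P (n - 1)" "\<gamma> = f \<otimes> q"
    using P_decomposition[of "n - 1" \<gamma>] assms(1) nn by auto
  have sF: "subgroup (F (n - 1)) G" using nn by (intro subgroup_F)
  have c: "f \<in> carrier G" "q \<in> carrier G" "x \<in> carrier G"
    using fq assms F_carrier[of "n - 1"] P_carrier[of "n - 1"] nn by auto
  have "q \<in> B (n - 1)" using fq P_subset_B[of "n - 1"] by auto
  then have "conj_by q x \<in> F (n - 1)" using F_normal[of "n - 1" q x] nn assms by auto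
  then have "conj_by f (conj_by q x) \<in> F (n - 1)"
    using fq(1) subgroup.m_closed[OF sF] subgroup.m_inv_closed[OF sF] by (simp add: conj_by_def)
  then show ?thesis using c by (simp add: conj_by_conj_by fq(3))
qed

lemma val_loop_conj:
  assumes "\<gamma> \<in> P n" "u \<in> loops n"
  shows "loop_conj \<gamma> u \<in> loops n" "val n (loop_conj \<gamma> u) = conj_by \<gamma> (val n u)"
proof -
  have im: "val n ` loops n = F (n - 1)" using n3 by (intro val_image) auto
  have "conj_by \<gamma> (val n u) \<in> val n ` loops n"
    unfolding im using assms im by (intro P_normalizes_F) auto
  then show "loop_conj \<gamma> u \<in> loops n" "val n (loop_conj \<gamma> u) = conj_by \<gamma> (val n u)"
    unfolding loop_conj_def by (rule inv_into_into, rule f_inv_into_f)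
qed

lemma loop_conj_eqI:
  assumes "\<gamma> \<in> P n" "u \<in> loops n" "v \<in> loops n" "conj_by \<gamma> (val n u) = val n v"
  shows "loop_conj \<gamma> u = v"
  using inj_onD[OF inj_val[of n], of "loop_conj \<gamma> u" v] val_loop_conj[OF assms(1,2)] assms n3 by auto

text \<open>Left multiplication by \<open>F (n - 1)\<close> changes neither the coset representative
  nor the factor in \<open>P (n - 1)\<close>.\<close>

lemma loop_left_mult:
  assumes \<beta>: "\<beta> \<in> carrier G" and u: "u \<in> loops n"
  shows "loop (val n u \<otimes> \<beta>) = u + loop \<beta>"
proof -
  have sP: "subgroup (P n) G" by (rule subgroup_P) simp
  have vc: "val n u \<in> carrier G" and vP: "val n u \<in> P n"
    using val_carrier[OF le_refl u] val_image[of n] F_subset_P[of "n - 1" n] u n3 by auto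
  have c: "fst (fac \<beta>) \<in> carrier G" "snd (fac \<beta>) \<in> carrier G"
    using fac[OF \<beta>] T_carrier P_carrier[of n] by auto
  have "val n u \<otimes> \<beta> = (val n u \<otimes> fst (fac \<beta>)) \<otimes> snd (fac \<beta>)"
    using vc c fac(3)[OF \<beta>] by (metis m_assoc)
  then have f: "fac (val n u \<otimes> \<beta>) = (val n u \<otimes> fst (fac \<beta>), snd (fac \<beta>))"
    using fac[OF \<beta>] vP subgroup.m_closed[OF sP] by (intro fac_eq) auto
  obtain q where q: "q \<in> P (n - 1)" "fst (fac \<beta>) = val n (loop \<beta>) \<otimes> q" using loop(2)[OF \<beta>] by blast
  have qc: "q \<in> carrier G" using q P_carrier[of "n - 1"] by simp
  have "fst (fac (val n u \<otimes> \<beta>)) = val n (u + loop \<beta>) \<otimes> q"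
    using vc qc val_carrier[OF le_refl loop(1)[OF \<beta>]]
    by (simp add: f q(2) val_plus[OF le_refl u loop(1)[OF \<beta>]] m_assoc)
  then show ?thesis using free_on_plus[OF u loop(1)[OF \<beta>]] q(1) by (intro loop_eq)
qed

lemma mult_gen: "word (nmult j (gen a)) = replicate j (a, True)" for a :: nat
proof (induction j)
  case (Suc j)
  then show ?case by (cases j) (simp_all add: gen_def word_letter_plus rcons_def flip_def)
qed simp

lemma gens_not_commuting: "gen 1 + gen 2 \<noteq> gen 2 + (gen 1 :: nat fg)"
proof
  assume "gen 1 + gen 2 = gen 2 + (gen 1 :: nat fg)"
  then have "word (gen 1 + gen 2) = word (gen 2 + (gen 1 :: nat fg))" by simp
  then show False by (simp add: gen_def word_letter_plus rcons_def flip_def)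
qed

lemma loop_converges:
  assumes "group_walk G \<mu> M"
  shows "AE \<tau> in M. converges_at_infinity (\<lambda>k. word (loop (\<tau> k)))"
proof -
  interpret group_walk G \<mu> M by fact
  have bw: "word (boundary n) = (1, True) # map (\<lambda>i. (i, True)) [2..<n]"
    using n3 by (simp add: word_boundary upt_conv_Cons numeral_2_eq_2)
  \<comment> \<open>For \<open>g = \<gamma> \<otimes> \<pi>\<close>, right multiplication by
    \<open>inv \<pi> \<otimes> val n u \<otimes> \<pi>\<close> is left multiplication by the
    conjugate of \<open>val n u\<close> by \<gamma>, which lies in \<open>F (n - 1)\<close>.\<close>
  interpret W: free_component_walk G \<mu> M loop "\<lambda>\<beta>. snd (fac \<beta>)" "\<lambda>t u. inv t \<otimes> val n u \<otimes> t"
    "\<lambda>\<beta>. loop_conj (fst (fac \<beta>))" "loops n" "gen 1" "gen 2" "boundary n" "{1..<n} \<times> UNIV"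
  proof unfold_locales
    show "finite ({1..<n} \<times> (UNIV :: bool set))" by simp
    show "set (word (loop g)) \<subseteq> {1..<n} \<times> UNIV" if "g \<in> carrier G" for g
      using loop(1)[OF that] by (auto simp: free_on_def gwords_def lists_eq_set)
    show "finite ((\<lambda>\<beta>. snd (fac \<beta>)) ` carrier G)"
      by (rule finite_subset[OF _ finite_T]) (use fac(2) in auto)
    show "inv (snd (fac g)) \<otimes> val n u \<otimes> snd (fac g) \<in> carrier G" if "g \<in> carrier G" "u \<in> loops n" for g u
      using T_carrier[OF fac(2)[OF that(1)]] val_carrier[OF le_refl that(2)] by simp
    show "loop (g \<otimes> (inv (snd (fac g)) \<otimes> val n u \<otimes> snd (fac g)) \<otimes> x) = loop_conj (fst (fac g)) u + loop (g \<otimes> x)"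
      if g: "g \<in> carrier G" and u: "u \<in> loops n" and x: "x \<in> carrier G" for g u x
    proof -
      let ?\<gamma> = "fst (fac g)" and ?\<pi> = "snd (fac g)"
      have c: "?\<gamma> \<in> carrier G" "?\<pi> \<in> carrier G" "val n u \<in> carrier G"
        using fac[OF g] T_carrier P_carrier[of n] val_carrier[OF le_refl u] by auto
      have "g \<otimes> (inv ?\<pi> \<otimes> val n u \<otimes> ?\<pi>) \<otimes> x = (?\<gamma> \<otimes> ?\<pi>) \<otimes> (inv ?\<pi> \<otimes> val n u \<otimes> ?\<pi>) \<otimes> x"
        using fac(3)[OF g] by simp
      also have "\<dots> = conj_by ?\<gamma> (val n u) \<otimes> ((?\<gamma> \<otimes> ?\<pi>) \<otimes> x)"
        using c x by (simp add: conj_by_def m_assoc) (simp add: m_assoc[symmetric])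
      also have "\<dots> = val n (loop_conj ?\<gamma> u) \<otimes> (g \<otimes> x)"
        using fac(3)[OF g] val_loop_conj[OF fac(1)[OF g] u] by simp
      finally show ?thesis
        using loop_left_mult[OF m_closed[OF g x] val_loop_conj(1)[OF fac(1)[OF g] u]] by simp
    qed
    show "loop_conj (fst (fac g)) (u + v) = loop_conj (fst (fac g)) u + loop_conj (fst (fac g)) v"
      if g: "g \<in> carrier G" and uv: "u \<in> loops n" "v \<in> loops n" for g u v
    proof (rule loop_conj_eqI)
      note l = val_loop_conj[OF fac(1)[OF g] uv(1)] val_loop_conj[OF fac(1)[OF g] uv(2)]
      show "conj_by (fst (fac g)) (val n (u + v)) =
          val n (loop_conj (fst (fac g)) u + loop_conj (fst (fac g)) v)"
        using uv l P_carrier[OF le_refl fac(1)[OF g]] val_carrier[OF le_refl]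
        by (simp add: val_plus conj_by_mult)
      show "loop_conj (fst (fac g)) u + loop_conj (fst (fac g)) v \<in> loops n"
        using l by (intro free_on_plus)
    qed (use fac(1)[OF g] uv free_on_plus in auto)
    show "inj_on (loop_conj (fst (fac g))) (loops n)" if g: "g \<in> carrier G" for g
    proof (rule inj_onI)
      fix u v assume uv: "u \<in> loops n" "v \<in> loops n" "loop_conj (fst (fac g)) u = loop_conj (fst (fac g)) v"
      have "conj_by (fst (fac g)) (val n u) = conj_by (fst (fac g)) (val n v)"
        using uv val_loop_conj(2)[OF fac(1)[OF g]] by metis
      then have "val n u = val n v"
        using P_carrier[OF le_refl fac(1)[OF g]] val_carrier[OF le_refl] uv by (metis conj_by_inv_cancel(1))
      then show "u = v" using inj_onD[OF inj_val[of n]] uv n3 by auto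
    qed
    show "nmult j (gen 1) \<noteq> (0 :: nat fg)" "nmult j (gen 2) \<noteq> (0 :: nat fg)" if "j > 0" for j
      using mult_gen[of j] that by (metis length_greater_0_conv length_replicate word_zero)+
    show "loop_conj (fst (fac g)) (boundary n) = loop g + boundary n - loop g" if g: "g \<in> carrier G" for g
    proof (rule loop_conj_eqI)
      note lg = loop(1)[OF g]
      obtain q where q: "q \<in> P (n - 1)" "fst (fac g) = val n (loop g) \<otimes> q" using loop(2)[OF g] by blast
      have c: "q \<in> carrier G" "val n (loop g) \<in> carrier G" "val n (boundary n) \<in> carrier G"
        using q P_carrier[of "n - 1"] val_carrier[OF le_refl] lg boundary_loop by auto
      have "q \<in> B (n - 1)" using q(1) P_subset_B[of "n - 1"] by auto
      then have "conj_by q (val n (boundary n)) = val n (boundary n)"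
        using n3 by (intro val_boundary_commutes) auto
      then have "conj_by (fst (fac g)) (val n (boundary n)) = conj_by (val n (loop g)) (val n (boundary n))"
        using c by (simp add: q(2) flip: conj_by_conj_by)
      also have "\<dots> = val n (loop g + boundary n + - loop g)"
        unfolding conj_by_def using lg boundary_loop[of n]
        by (simp only: val_plus val_uminus le_refl free_on_plus free_on_uminus)
      finally show "conj_by (fst (fac g)) (val n (boundary n)) = val n (loop g + boundary n - loop g)" by simp
      show "loop g + boundary n - loop g \<in> loops n"
        using lg boundary_loop by (intro free_on_diff free_on_plus)
    qed (use fac(1)[OF g] boundary_loop in auto)
    show "boundary n \<in> loops n" by (rule boundary_loop)
    show "word (boundary n) \<noteq> []" by (simp add: bw)
    show "hd (word (boundary n)) \<noteq> flip (last (word (boundary n)))"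
      unfolding word_boundary using n3 by (simp add: hd_map last_map flip_def)
  qed (use n3 gens_not_commuting in \<open>auto intro!: free_on_plus free_on_uminus free_on_gen\<close>)
  show ?thesis by (rule W.free_component_converges)
qed

end

section \<open>The braid group\<close>

definition artin_gen_braid :: "nat \<Rightarrow> nat \<Rightarrow> braid" where
  "artin_gen_braid n i = braid_of n [(i, True)]"

text \<open>A braid is a class of words; by \<open>act_word_cong\<close> all its members act alike,
  so the choice is harmless.\<close>

definition braid_act :: "braid \<Rightarrow> nat fg \<Rightarrow> nat fg" where
  "braid_act x = act_word (SOME w. w \<in> x)"

lemma braid_of_mult:
  "u \<in> gwords {1..<n} \<Longrightarrow> v \<in> gwords {1..<n} \<Longrightarrow>
    braid_of n u \<otimes>\<^bsub>braid_group n\<^esub> braid_of n v = braid_of n (u @ v)"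
  unfolding braid_of_def braid_group_def by (rule presented_group_mult_class)

lemma braid_of_carrier: "u \<in> gwords {1..<n} \<Longrightarrow> braid_of n u \<in> carrier (braid_group n)"
  by (auto simp: braid_of_def braid_group_def presented_group_def quotient_def)

lemma braid_of_surj: "x \<in> carrier (braid_group n) \<Longrightarrow> \<exists>w\<in>gwords {1..<n}. x = braid_of n w"
  by (auto simp: braid_of_def braid_group_def presented_group_def quotient_def)

lemma braid_of_Nil: "braid_of n [] = \<one>\<^bsub>braid_group n\<^esub>"
  by (simp add: braid_of_def braid_group_def presented_group_def)

lemma braid_of_eqI: "(u, v) \<in> pres_rel {1..<n} (braid_relations n) \<Longrightarrow> braid_of n u = braid_of n v"
  unfolding braid_of_def by (rule equiv_class_eq[OF equiv_pres_rel])

lemma braid_of_relation: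
  "(u, v) \<in> braid_relations n \<Longrightarrow> u \<in> gwords {1..<n} \<Longrightarrow> v \<in> gwords {1..<n} \<Longrightarrow> braid_of n u = braid_of n v"
  by (intro braid_of_eqI pres_rel.rel)

lemma braid_act_braid_of:
  assumes "w \<in> gwords {1..<n}"
  shows "braid_act (braid_of n w) u = act_word w u"
proof -
  have "w \<in> braid_of n w" using assms by (auto simp: braid_of_def intro: pres_rel.refl)
  then have "(SOME v. v \<in> braid_of n w) \<in> braid_of n w" by (rule someI)
  then have "(w, SOME v. v \<in> braid_of n w) \<in> pres_rel {1..<n} (braid_relations n)"
    by (simp add: braid_of_def)
  from act_word_cong[OF this] show ?thesis by (simp add: braid_act_def)
qed

lemma gwords_Nil [simp]: "[] \<in> gwords S"
  and gwords_Cons [simp]: "x # w \<in> gwords S \<longleftrightarrow> fst x \<in> S \<and> w \<in> gwords S"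
  and gwords_append [simp]: "v @ w \<in> gwords S \<longleftrightarrow> v \<in> gwords S \<and> w \<in> gwords S"
  by (auto simp: gwords_def mem_Times_iff)

lemma braid_action_braid_group: "braid_action (braid_group n) n (artin_gen_braid n) braid_act"
proof -
  interpret group "braid_group n" by (rule group_braid_group)
  show ?thesis
  proof unfold_locales
    show "artin_gen_braid n i \<in> carrier (braid_group n)" if "1 \<le> i" "i < n" for i
      using that by (auto simp: artin_gen_braid_def intro!: braid_of_carrier)
    show "artin_gen_braid n i \<otimes>\<^bsub>braid_group n\<^esub> artin_gen_braid n j =
        artin_gen_braid n j \<otimes>\<^bsub>braid_group n\<^esub> artin_gen_braid n i"
      if "1 \<le> i" "i < n" "1 \<le> j" "j < n" "i + 2 \<le> j \<or> j + 2 \<le> i" for i j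
    proof -
      have "([(i, True), (j, True)], [(j, True), (i, True)]) \<in> braid_relations n"
        using that unfolding braid_relations_def by auto
      then show ?thesis using that by (simp add: artin_gen_braid_def braid_of_mult braid_of_relation)
    qed
    show "artin_gen_braid n i \<otimes>\<^bsub>braid_group n\<^esub> artin_gen_braid n (i + 1) \<otimes>\<^bsub>braid_group n\<^esub> artin_gen_braid n i =
        artin_gen_braid n (i + 1) \<otimes>\<^bsub>braid_group n\<^esub> artin_gen_braid n i \<otimes>\<^bsub>braid_group n\<^esub> artin_gen_braid n (i + 1)"
      if "1 \<le> i" "i + 1 < n" for i
    proof -
      have "([(i, True), (i + 1, True), (i, True)], [(i + 1, True), (i, True), (i + 1, True)]) \<in> braid_relations n"
        using that unfolding braid_relations_def by auto
      then show ?thesis using that by (simp add: artin_gen_braid_def braid_of_mult braid_of_relation)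
    qed
    show "braid_act (x \<otimes>\<^bsub>braid_group n\<^esub> y) u = braid_act x (braid_act y u)"
      if xy: "x \<in> carrier (braid_group n)" "y \<in> carrier (braid_group n)" for x y u
    proof -
      obtain v w where "v \<in> gwords {1..<n}" "x = braid_of n v" "w \<in> gwords {1..<n}" "y = braid_of n w"
        using braid_of_surj xy by metis
      then show ?thesis by (simp add: braid_of_mult braid_act_braid_of act_word_append)
    qed
    show "braid_act \<one>\<^bsub>braid_group n\<^esub> u = u" for u
      using braid_act_braid_of[of "[]" n u] by (simp add: braid_of_Nil act_word_def)
    show "braid_act (artin_gen_braid n i) u = artin i u" if "1 \<le> i" "i < n" for i u
      using braid_act_braid_of[of "[(i, True)]" n u] that
      by (simp add: artin_gen_braid_def act_word_def act_letter_def)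
    show "endo (braid_act x)" if x: "x \<in> carrier (braid_group n)" for x
    proof -
      obtain w where w: "w \<in> gwords {1..<n}" "x = braid_of n w" using braid_of_surj[OF x] by blast
      then have "braid_act x = act_word w" using braid_act_braid_of by auto
      then show ?thesis by (simp add: endo_act_word)
    qed
  qed
qed

context
  fixes n :: nat
begin

interpretation braid_action "braid_group n" n "artin_gen_braid n" braid_act
  by (rule braid_action_braid_group)

lemma inv_artin_gen_braid:
  assumes "1 \<le> i" "i < n"
  shows "inv\<^bsub>braid_group n\<^esub> (artin_gen_braid n i) = braid_of n [(i, False)]"
proof (rule inv_equality)
  have "([(i, False), (i, \<not> False)], []) \<in> pres_rel {1..<n} (braid_relations n)"
    using assms by (intro pres_rel.cancel) auto
  then show "braid_of n [(i, False)] \<otimes>\<^bsub>braid_group n\<^esub> artin_gen_braid n i = \<one>\<^bsub>braid_group n\<^esub>"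
    using assms braid_of_eqI[of "[(i, False), (i, True)]" "[]" n]
    by (simp add: artin_gen_braid_def braid_of_mult braid_of_Nil)
qed (use assms in \<open>auto simp: artin_gen_braid_def intro!: braid_of_carrier\<close>)

lemma carrier_generated: "carrier (braid_group n) \<subseteq> B n"
proof
  fix x assume "x \<in> carrier (braid_group n)"
  then obtain w where w: "w \<in> gwords {1..<n}" "x = braid_of n w" using braid_of_surj by blast
  have sB: "subgroup (B n) (braid_group n)" by (rule subgroup_B) simp
  have "braid_of n w \<in> B n"
    using w(1)
  proof (induction w)
    case Nil
    then show ?case using subgroup.one_closed[OF sB] by (simp add: braid_of_Nil)
  next
    case (Cons y w)
    then have y: "1 \<le> fst y" "fst y < n" and wg: "w \<in> gwords {1..<n}" by auto
    have "braid_of n [y] \<in> B n"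
      using \<sigma>_in_B[OF y] subgroup.m_inv_closed[OF sB \<sigma>_in_B[OF y]] inv_artin_gen_braid[OF y]
      by (cases y; cases "snd y") (auto simp: artin_gen_braid_def)
    moreover have "braid_of n (y # w) = braid_of n [y] \<otimes>\<^bsub>braid_group n\<^esub> braid_of n w"
      using Cons.prems wg by (simp add: braid_of_mult)
    ultimately show ?case using subgroup.m_closed[OF sB] Cons.IH[OF wg] by simp
  qed
  then show "x \<in> B n" by (simp add: w(2))
qed

lemma pure_gen_eq_s:
  "1 \<le> i \<Longrightarrow> i < j \<Longrightarrow> j \<le> n \<Longrightarrow> pure_gen n j i = s j i"
proof (induction j)
  case (Suc j)
  let ?w = "\<lambda>j. map (\<lambda>k. (k, True)) (rev [i + 1..<j]) @ [(i, True), (i, True)] @ map (\<lambda>k. (k, False)) [i + 1..<j]"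
  show ?case
  proof (cases "i = j")
    case True
    have "artin_gen_braid n j \<otimes>\<^bsub>braid_group n\<^esub> artin_gen_braid n j = braid_of n [(j, True), (j, True)]"
      using Suc.prems True by (simp add: artin_gen_braid_def braid_of_mult)
    then show ?thesis using True by (simp add: pure_gen_def s_adjacent)
  next
    case False
    then have j: "1 \<le> j" "j < n" "i < j" using Suc.prems by auto
    have w: "?w (Suc j) = [(j, True)] @ ?w j @ [(j, False)]" using j by simp
    have g: "?w j \<in> gwords {1..<n}" "[(j, True)] \<in> gwords {1..<n}" "[(j, False)] \<in> gwords {1..<n}"
      using Suc.prems j by (auto simp: gwords_def)
    have "pure_gen n (Suc j) i =
        braid_of n [(j, True)] \<otimes>\<^bsub>braid_group n\<^esub> (braid_of n (?w j) \<otimes>\<^bsub>braid_group n\<^esub> braid_of n [(j, False)])"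
      unfolding pure_gen_def w using g by (simp only: braid_of_mult gwords_append)
    also have "\<dots> = conj_by (artin_gen_braid n j) (pure_gen n j i)"
      unfolding conj_by_def inv_artin_gen_braid[OF j(1,2)] pure_gen_def[of n j i]
      unfolding artin_gen_braid_def using g by (simp only: m_assoc braid_of_carrier)
    finally show ?thesis using Suc.IH j Suc.prems by (simp add: s_Suc)
  qed
qed simp

lemma pure_braids_eq_P: "m \<le> n \<Longrightarrow> pure_braids n m = P m"
  unfolding pure_braids_def P_def
  by (intro arg_cong[of _ _ "generate (braid_group n)"] Collect_cong ex_cong1) (auto simp: pure_gen_eq_s)

lemma free_part_eq_F: "k < n \<Longrightarrow> free_part n k = F k"
  unfolding free_part_def F_def
  by (intro arg_cong[of _ _ "generate (braid_group n)"] image_cong) (auto simp: pure_gen_eq_s)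

lemma pure_components_top:
  assumes n: "2 \<le> n" and u: "u \<in> loops n" and q: "q \<in> P (n - 1)"
  shows "pure_components n (val n u \<otimes>\<^bsub>braid_group n\<^esub> q) (n - 1) = val n u"
proof -
  let ?\<gamma> = "val n u \<otimes>\<^bsub>braid_group n\<^esub> q"
  have f: "val n u \<in> F (n - 1)" using val_image[of n] u n by auto
  have "val n u \<in> P n" "q \<in> P n" using f q F_subset_P[of "n - 1" n] P_mono[of "n - 1" n] n by auto
  then have \<gamma>: "?\<gamma> \<in> P n" using subgroup.m_closed[OF subgroup_P[of n]] by simp
  have Pi: "(\<Pi>\<^sub>E i\<in>{1..<n}. free_part n i) = (\<Pi>\<^sub>E i\<in>{1..<n}. F i)"
    by (rule PiE_cong) (simp add: free_part_eq_F)
  have "pure_components n ?\<gamma> = (THE c. c \<in> (\<Pi>\<^sub>E i\<in>{1..<n}. F i) \<and> ?\<gamma> = assemble c n)"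
    unfolding pure_components_def Pi assemble_def ..
  with theI'[OF components_unique[OF _ \<gamma>]] n
  have "pure_components n ?\<gamma> \<in> (\<Pi>\<^sub>E i\<in>{1..<n}. F i) \<and> ?\<gamma> = assemble (pure_components n ?\<gamma>) n" by simp
  then show ?thesis using top_component[OF n _ _ f q] by blast
qed

lemma free_word_val:
  assumes n: "2 \<le> n" and u: "u \<in> loops n"
  shows "free_word n (n - 1) (val n u) = word u"
proof -
  have nn: "n - 1 + 1 = n" "{1..n - 1} = {1..<n}" using n by auto
  have wv: "word_value (braid_group n) (pure_gen n n) w = word_value (braid_group n) (s n) w"
    if "w \<in> gwords {1..<n}" for w
    using that by (induction w) (auto simp: word_value_Cons pure_gen_eq_s)
  show ?thesis
    unfolding free_word_def nn
  proof (rule the_equality)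
    show "word u \<in> gwords {1..<n} \<and> reduced (word u) \<and> word_value (braid_group n) (pure_gen n n) (word u) = val n u"
      using u by (simp add: free_on_def wv val_def)
    fix w assume w: "w \<in> gwords {1..<n} \<and> reduced w \<and> word_value (braid_group n) (pure_gen n n) w = val n u"
    then have ww: "word (of_word w) = w" by (simp add: word_of_word)
    have "val n (of_word w) = word_value (braid_group n) (s n) w" by (simp only: val_def ww)
    also have "\<dots> = word_value (braid_group n) (pure_gen n n) w" using w by (intro wv[symmetric]) blast
    finally have "val n (of_word w) = val n u" using w by simp
    moreover have "of_word w \<in> loops n" using w ww by (simp add: free_on_def)
    ultimately have "of_word w = u" using inj_onD[OF inj_val[of n]] u n by auto
    then show "w = word u" using ww by simp
  qed
qed

text \<open>\<open>MI_pure\<close> lists the components from the highest index down, so the reduced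
  word of the top one comes first.\<close>

lemma MI_pure_top:
  assumes n: "2 \<le> n" and u: "u \<in> loops n" and q: "q \<in> P (n - 1)"
  shows "\<exists>v. MI_pure n (val n u \<otimes>\<^bsub>braid_group n\<^esub> q) = map (\<lambda>(j, b). Pure n j b) (word u) @ v"
proof -
  obtain k where k: "n = Suc k" "1 \<le> k" using n by (cases n) auto
  have "rev [1..<n] = (n - 1) # rev [1..<n - 1]" using k by simp
  then show ?thesis
    using pure_components_top[OF assms] free_word_val[OF n u] k by (simp add: MI_pure_def)
qed

end

lemma converges_at_infinity_map_append:
  assumes V: "converges_at_infinity V" and V': "\<And>i. \<exists>v. V' i = map f (V i) @ v"
  shows "converges_at_infinity V'"
  unfolding converges_at_infinity_def
proof
  fix k
  obtain N where N: "\<And>j. j > N \<Longrightarrow> length (V j) > k \<and> take k (V j) = take k (V N)"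
    using V unfolding converges_at_infinity_def by blast
  \<comment> \<open>Convergence bounds the lengths only beyond \<open>N\<close>; the word at
    \<open>N\<close> is long enough because its prefix equals a prefix of length \<open>k\<close> of
    a later word.\<close>
  have len: "length (V N) \<ge> k"
    using N[of "Suc N"] by (metis length_take lessI min.absorb2 min.cobounded1 order_less_imp_le)
  have "take k (V' j) = map f (take k (V j))" if "length (V j) \<ge> k" for j
    using V'[of j] that by (auto simp: take_map)
  moreover have "length (V' j) \<ge> length (V j)" for j using V'[of j] by auto
  ultimately show "\<exists>N. \<forall>j>N. length (V' j) > k \<and> take k (V' j) = take k (V' N)"
    using N len by (intro exI[of _ N]) (metis less_imp_le order_less_le_trans)
qed

theorem theorem3:
  fixes n :: nat and T :: "braid set" and \<mu> :: "braid pmf" and M :: "(nat \<Rightarrow> braid) measure"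
  assumes "n \<ge> 3"
    and "coset_representatives (braid_group n) (pure_braids n n) T"
    and "set_pmf \<mu> \<subseteq> carrier (braid_group n)"
    and "nondegenerate (braid_group n) \<mu>"
    and "random_walk_measure (braid_group n) \<mu> M"
  shows "AE \<tau> in M. converges_at_infinity (\<lambda>i. MI_braid n T (\<tau> i))"
proof -
  interpret A: braid_action "braid_group n" n "artin_gen_braid n" braid_act
    by (rule braid_action_braid_group)
  have pure: "pure_braids n n = A.P n" by (simp add: pure_braids_eq_P)
  interpret C: braid_cosets "braid_group n" n "artin_gen_braid n" braid_act T
    using assms(1,2) carrier_generated by unfold_locales (simp_all add: pure)
  interpret W: group_walk "braid_group n" \<mu> M
    using assms(3-5) by unfold_locales (auto intro: countable_braid_group)
  have fac: "pure_factorization n T \<beta> = C.fac \<beta>" for \<beta>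
    unfolding pure_factorization_def C.fac_def pure ..
  have MI: "\<exists>v. MI_braid n T \<beta> = map (\<lambda>(j, b). Pure n j b) (word (C.loop \<beta>)) @ v"
    if \<beta>: "\<beta> \<in> carrier (braid_group n)" for \<beta>
  proof -
    obtain q where q: "q \<in> A.P (n - 1)" "fst (C.fac \<beta>) = A.val n (C.loop \<beta>) \<otimes>\<^bsub>braid_group n\<^esub> q"
      using C.loop(2)[OF \<beta>] by blast
    from MI_pure_top[OF _ C.loop(1)[OF \<beta>] q(1)] assms(1)
    obtain v where "MI_pure n (fst (C.fac \<beta>)) = map (\<lambda>(j, b). Pure n j b) (word (C.loop \<beta>)) @ v"
      by (auto simp: q(2))
    then show ?thesis by (simp add: MI_braid_def fac case_prod_beta)
  qed
  have "AE \<tau> in M. converges_at_infinity (\<lambda>k. word (C.loop (\<tau> k)))"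
    by (rule C.loop_converges) unfold_locales
  then show ?thesis
    using W.AE_carrier
    by eventually_elim (rule converges_at_infinity_map_append, assumption, use MI in blast)
qed

end
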